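(* Let $S$ be a parabolic Inoue surface with second Betti number $m>0$, let $E$ be the elliptic curve on $S$, $C$ the cycle of rational curves on $S$, and $U:=S-C$, which has the natural structure of a holomorphic line bundle $U\to E$ of degree $-m$ with $E\subseteq U$ as zero section. Then $\mathrm{Aut}\,S$ is isomorphic to the group of bundle automorphisms of $U\to E$ which induce translations on $E$.
   Context: Construction of parabolic Inoue surfaces. Let $W$ be the complex surface covered by open charts $U_k=\mathbb{C}^2$ with coordinates $(x_k,y_k)$, $k\in\mathbb{Z}$, and $V=\mathbb{C}^*\times\mathbb{C}$ with coordinates $(w,x)$, glued by $x_{k+1}=y_k^{-1}$, $y_{k+1}=x_ky_k^2$ on $U_k\cap U_{k+1}$, and $w=x_ky_k$, $x=x_k^{k+1}y_k^k$ (equivalently $x_k=w^{-k}x$, $y_k=w^{k+1}x^{-1}$) on $U_k\cap V$. For an integer $m\ge 1$ and $\alpha\in\mathbb{C}$ with $0<|\alpha|<1$ let $\gamma_{m,\alpha}$ be the automorphism of $W$ given by $(w,x)\mapsto(\alpha w,w^mx)$ on $V$ and mapping $U_{k-m}$ to $U_k$ by $(x_k,y_k)=(\alpha^{-k}x_{k-m},\alpha^{k+1}y_{k-m})$. It generates an infinite cyclic group acting freely, properly discontinuously and cocompactly on $W$. A parabolic Inoue surface with second Betti number $m$ is a surface of the form $S=S(m,\alpha):=W/\langle\gamma_{m,\alpha}\rangle$. Curves. For $k\in\mathbb{Z}$ let $\tilde C_{k+1}\subset W$ be the compact smooth rational curve defined by $x_k=0$ on $U_k$ and $y_{k+1}=0$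 on $U_{k+1}$. The image of $\tilde C_i$ in $S$ is denoted $C_i$ ($1\le i\le m$); $C=C_1+\cdots+C_m$ is a cycle of rational curves on $S$ (a rational curve with one node if $m=1$). The image $E$ of $\{x=0\}\subset V$ is a smooth elliptic curve with $E^2=-m$. The $C_i$ and $E$ are the only irreducible curves on $S$. Line bundle structure: $U=S-C=V/\langle\gamma_{m,\alpha}\rangle$, and the projection $U\to E=\mathbb{C}^*/\langle\alpha\rangle$ is induced by $(w,x)\mapsto w$, with $x$ as linear fiber coordinate. A bundle automorphism of $U\to E$ is an automorphism of the total space covering some automorphism of $E$ and linear on fibers. $\mathrm{Aut}\,S$ is the group of holomorphic automorphisms of $S$. *)

theory Defs
  imports "HOL-Analysis.Analysis" "HOL-Algebra.Bij"
begin

section \<open>Complex manifolds and holomorphic maps\<close>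

text \<open>Holomorphy on an open set of \<open>\<complex>\<^sup>n\<close>: real differentiability with complex-linear derivative.\<close>

definition holo_on :: "(complex^'n \<Rightarrow> complex^'k) \<Rightarrow> (complex^'n) set \<Rightarrow> bool" where
  "holo_on f D \<longleftrightarrow>
     (\<forall>v\<in>D. \<exists>f'. (f has_derivative f') (at v) \<and> (\<forall>c u. f' (c *s u) = c *s f' u))"

text \<open>An atlas is stored through the inverses of its charts: \<open>(D, \<phi>)\<close> is an injective
  parametrization \<open>\<phi>\<close>, on the open set \<open>D\<close> of \<open>\<complex>\<^sup>n\<close>, of an open part of the manifold.\<close>

record ('p, 'n::finite) complex_mfd =
  points :: "'p set"
  charts :: "((complex^'n) set \<times> (complex^'n \<Rightarrow> 'p)) set"

definition mfd_topology :: "('p, 'n::finite) complex_mfd \<Rightarrow> 'p topology" where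
  "mfd_topology M =
     topology (\<lambda>G. G \<subseteq> points M \<and> (\<forall>(D, \<phi>)\<in>charts M. open {v\<in>D. \<phi> v \<in> G}))"

lemma openin_mfd_topology:
  "openin (mfd_topology M) G \<longleftrightarrow>
     G \<subseteq> points M \<and> (\<forall>(D, \<phi>)\<in>charts M. open {v\<in>D. \<phi> v \<in> G})"
proof -
  have "istopology (\<lambda>G. G \<subseteq> points M \<and> (\<forall>(D, \<phi>)\<in>charts M. open {v\<in>D. \<phi> v \<in> G}))"
    unfolding istopology_def
  proof (rule conjI; clarify)
    fix S T
    assume S: "S \<subseteq> points M" "\<forall>(D, \<phi>)\<in>charts M. open {v\<in>D. \<phi> v \<in> S}"
      and T: "\<forall>(D, \<phi>)\<in>charts M. open {v\<in>D. \<phi> v \<in> T}"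
    have "open {v\<in>D. \<phi> v \<in> S \<inter> T}" if "(D, \<phi>) \<in> charts M" for D \<phi>
    proof -
      have "{v\<in>D. \<phi> v \<in> S \<inter> T} = {v\<in>D. \<phi> v \<in> S} \<inter> {v\<in>D. \<phi> v \<in> T}" by blast
      then show ?thesis using S T that by (auto intro!: open_Int)
    qed
    with S show "S \<inter> T \<subseteq> points M \<and> (\<forall>(D, \<phi>)\<in>charts M. open {v\<in>D. \<phi> v \<in> S \<inter> T})" by blast
  next
    fix K
    assume K: "\<forall>S\<in>K. S \<subseteq> points M \<and> (\<forall>(D, \<phi>)\<in>charts M. open {v\<in>D. \<phi> v \<in> S})"
    have "open {v\<in>D. \<phi> v \<in> \<Union>K}" if "(D, \<phi>) \<in> charts M" for D \<phi>
    proof -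
      have "{v\<in>D. \<phi> v \<in> \<Union>K} = (\<Union>S\<in>K. {v\<in>D. \<phi> v \<in> S})" by blast
      then show ?thesis using K that by (auto intro!: open_UN)
    qed
    with K show "\<Union>K \<subseteq> points M \<and> (\<forall>(D, \<phi>)\<in>charts M. open {v\<in>D. \<phi> v \<in> \<Union>K})" by blast
  qed
  then show ?thesis by (simp add: mfd_topology_def)
qed

definition holomorphic_map ::
    "('p, 'n::finite) complex_mfd \<Rightarrow> ('q, 'k::finite) complex_mfd \<Rightarrow> ('p \<Rightarrow> 'q) \<Rightarrow> bool" where
  "holomorphic_map M N f \<longleftrightarrow>
     continuous_map (mfd_topology M) (mfd_topology N) f \<and>
     (\<forall>(D, \<phi>)\<in>charts M. \<forall>(D', \<psi>)\<in>charts N.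
        holo_on (inv_into D' \<psi> \<circ> f \<circ> \<phi>) {v\<in>D. f (\<phi> v) \<in> \<psi> ` D'})"

text \<open>As in \<^const>\<open>BijGroup\<close>, self-maps of the point set are represented by extensional functions.\<close>

definition Aut :: "('p, 'n::finite) complex_mfd \<Rightarrow> ('p \<Rightarrow> 'p) monoid" where
  "Aut M = (BijGroup (points M))
     \<lparr>carrier := {f \<in> Bij (points M). holomorphic_map M M f \<and>
                                     holomorphic_map M M (inv_into (points M) f)}\<rparr>"

definition open_submfd :: "('p, 'n::finite) complex_mfd \<Rightarrow> 'p set \<Rightarrow> ('p, 'n) complex_mfd" where
  "open_submfd M G = \<lparr>points = G, charts = {({v\<in>D. \<phi> v \<in> G}, \<phi>) | D \<phi>. (D, \<phi>) \<in> charts M}\<rparr>"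

text \<open>Quotient by the orbit relation of a free and properly discontinuous action: the charts are
  the restrictions of the old ones to open sets on which the quotient map is injective.\<close>

definition quotient_mfd :: "('p, 'n::finite) complex_mfd \<Rightarrow> ('p \<times> 'p) set \<Rightarrow> ('p set, 'n) complex_mfd"
  where
  "quotient_mfd M R = \<lparr>points = points M // R,
     charts = {(D, \<lambda>v. R `` {\<phi> v}) | D D\<^sub>0 \<phi>.
       (D\<^sub>0, \<phi>) \<in> charts M \<and> open D \<and> D \<subseteq> D\<^sub>0 \<and> inj_on (\<lambda>v. R `` {\<phi> v}) D}\<rparr>"


section \<open>The surface \<open>W\<close>\<close>

text \<open>\<open>In_U k x y\<close> is the point of \<open>U\<^sub>k = \<complex>\<^sup>2\<close> with coordinates \<open>(x\<^sub>k, y\<^sub>k) = (x, y)\<close>, and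
  \<open>In_V w x\<close>, for \<open>w \<noteq> 0\<close>, the point of \<open>V = \<complex>\<^sup>* \<times> \<complex>\<close> with coordinates \<open>(w, x)\<close>.\<close>

datatype patch_point = In_U int complex complex | In_V complex complex

definition patch_points :: "patch_point set" where
  "patch_points = {In_U k x y | k x y. True} \<union> {In_V w x | w x. w \<noteq> 0}"

inductive glued :: "patch_point \<Rightarrow> patch_point \<Rightarrow> bool" where
  UU: "y \<noteq> 0 \<Longrightarrow> glued (In_U k x y) (In_U (k + 1) (inverse y) (x * y\<^sup>2))"
| UV: "x \<noteq> 0 \<Longrightarrow> y \<noteq> 0 \<Longrightarrow> glued (In_U k x y) (In_V (x * y) (x powi (k + 1) * y powi k))"

definition W_point :: "patch_point \<Rightarrow> patch_point set" where
  "W_point p = {q. equivclp glued p q}"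

definition U_param :: "int \<Rightarrow> complex^2 \<Rightarrow> patch_point set" where
  "U_param k v = W_point (In_U k (v $ 1) (v $ 2))"

definition V_param :: "complex^2 \<Rightarrow> patch_point set" where
  "V_param v = W_point (In_V (v $ 1) (v $ 2))"

definition W :: "(patch_point set, 2) complex_mfd" where
  "W = \<lparr>points = W_point ` patch_points,
        charts = insert ({v. v $ 1 \<noteq> 0}, V_param) (range (\<lambda>k. (UNIV, U_param k)))\<rparr>"

text \<open>\<open>Ctilde (k+1)\<close> is given by \<open>x\<^sub>k = 0\<close> in \<open>U\<^sub>k\<close> and by \<open>y\<^sub>k\<^sub>+\<^sub>1 = 0\<close> in \<open>U\<^sub>k\<^sub>+\<^sub>1\<close>.\<close>

definition Ctilde :: "int \<Rightarrow> patch_point set set" where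
  "Ctilde i = range (\<lambda>y. W_point (In_U (i - 1) 0 y)) \<union> range (\<lambda>x. W_point (In_U i x 0))"

text \<open>The curve \<open>{x = 0}\<close> in \<open>V\<close>, with coordinate \<open>w\<close>.\<close>

definition Etilde :: "(patch_point set, 1) complex_mfd" where
  "Etilde = \<lparr>points = {W_point (In_V w 0) | w. w \<noteq> 0},
             charts = {({v. v $ 1 \<noteq> 0}, \<lambda>v. W_point (In_V (v $ 1) 0))}\<rparr>"


section \<open>The parabolic Inoue surface \<open>S(m, \<alpha>)\<close>\<close>

text \<open>The map \<open>gamma_patch m \<alpha>\<close> sends \<open>U\<^sub>k\<close> to \<open>U\<^sub>k\<^sub>+\<^sub>m\<close>.\<close>

fun gamma_patch :: "nat \<Rightarrow> complex \<Rightarrow> patch_point \<Rightarrow> patch_point" where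
  "gamma_patch m \<alpha> (In_U k x y) =
     In_U (k + int m) (\<alpha> powi (- (k + int m)) * x) (\<alpha> powi (k + int m + 1) * y)"
| "gamma_patch m \<alpha> (In_V w x) = In_V (\<alpha> * w) (w ^ m * x)"

definition gamma :: "nat \<Rightarrow> complex \<Rightarrow> patch_point set \<Rightarrow> patch_point set" where
  "gamma m \<alpha> P = gamma_patch m \<alpha> ` P"

definition orbit_rel :: "nat \<Rightarrow> complex \<Rightarrow> (patch_point set \<times> patch_point set) set" where
  "orbit_rel m \<alpha> = {(P, Q). P \<in> points W \<and> Q \<in> points W \<and>
     (\<exists>n. Q = (gamma m \<alpha> ^^ n) P \<or> P = (gamma m \<alpha> ^^ n) Q)}"

type_synonym surface_point = "patch_point set set"

definition parabolic_Inoue :: "nat \<Rightarrow> complex \<Rightarrow> (surface_point, 2) complex_mfd" where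
  "parabolic_Inoue m \<alpha> = quotient_mfd W (orbit_rel m \<alpha>)"

definition Inoue_C :: "nat \<Rightarrow> complex \<Rightarrow> int \<Rightarrow> surface_point set" where
  "Inoue_C m \<alpha> i = (\<lambda>P. orbit_rel m \<alpha> `` {P}) ` Ctilde i"

definition Inoue_cycle :: "nat \<Rightarrow> complex \<Rightarrow> surface_point set" where
  "Inoue_cycle m \<alpha> = (\<Union>i\<in>{1..int m}. Inoue_C m \<alpha> i)"

definition Inoue_E :: "nat \<Rightarrow> complex \<Rightarrow> (surface_point, 1) complex_mfd" where
  "Inoue_E m \<alpha> = quotient_mfd Etilde (orbit_rel m \<alpha>)"


section \<open>The line bundle \<open>U \<rightarrow> E\<close> and its automorphisms\<close>

definition Inoue_U :: "nat \<Rightarrow> complex \<Rightarrow> (surface_point, 2) complex_mfd" where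
  "Inoue_U m \<alpha> =
     open_submfd (parabolic_Inoue m \<alpha>) (points (parabolic_Inoue m \<alpha>) - Inoue_cycle m \<alpha>)"

text \<open>The image in \<open>S\<close> of the point \<open>(w, x)\<close> of \<open>V\<close>. For fixed \<open>w \<noteq> 0\<close>, the map
  \<open>x \<mapsto> U_point m \<alpha> w x\<close> is the inverse of a linear coordinate on the fiber of \<open>U \<rightarrow> E\<close>
  over the class of \<open>w\<close>.\<close>

definition U_point :: "nat \<Rightarrow> complex \<Rightarrow> complex \<Rightarrow> complex \<Rightarrow> surface_point" where
  "U_point m \<alpha> w x = orbit_rel m \<alpha> `` {W_point (In_V w x)}"

text \<open>\<open>\<complex>\<^sup>* / \<langle>\<alpha>\<rangle>\<close> is identified with the zero section \<open>E\<close> of \<open>U\<close>: the class of \<open>w\<close>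
  corresponds to the image of \<open>(w, 0)\<close>.\<close>

definition E_point :: "nat \<Rightarrow> complex \<Rightarrow> complex \<Rightarrow> surface_point" where
  "E_point m \<alpha> w = U_point m \<alpha> w 0"

definition bundle_proj :: "nat \<Rightarrow> complex \<Rightarrow> surface_point \<Rightarrow> surface_point" where
  "bundle_proj m \<alpha> p = (THE e. \<exists>w x. w \<noteq> 0 \<and> p = U_point m \<alpha> w x \<and> e = E_point m \<alpha> w)"

definition linear_on_fibers :: 
    "nat \<Rightarrow> complex \<Rightarrow> (surface_point \<Rightarrow> surface_point) \<Rightarrow> (surface_point \<Rightarrow> surface_point) \<Rightarrow> bool"
  where
  "linear_on_fibers m \<alpha> g F \<longleftrightarrow>
     (\<forall>w w'. w \<noteq> 0 \<longrightarrow> w' \<noteq> 0 \<longrightarrow> g (E_point m \<alpha> w) = E_point m \<alpha> w' \<longrightarrow>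
        (\<exists>T. Vector_Spaces.linear (*) (*) T \<and> (\<forall>x. F (U_point m \<alpha> w x) = U_point m \<alpha> w' (T x))))"

text \<open>\<open>F\<close> is an automorphism of the bundle \<open>U \<rightarrow> E\<close> covering the automorphism \<open>g\<close> of \<open>E\<close>.\<close>

definition bundle_automorphism_over ::
    "nat \<Rightarrow> complex \<Rightarrow> (surface_point \<Rightarrow> surface_point) \<Rightarrow> (surface_point \<Rightarrow> surface_point) \<Rightarrow> bool"
  where
  "bundle_automorphism_over m \<alpha> g F \<longleftrightarrow>
     F \<in> carrier (Aut (Inoue_U m \<alpha>)) \<and> g \<in> carrier (Aut (Inoue_E m \<alpha>)) \<and>
     (\<forall>p\<in>points (Inoue_U m \<alpha>). bundle_proj m \<alpha> (F p) = g (bundle_proj m \<alpha> p)) \<and>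
     linear_on_fibers m \<alpha> g F"

text \<open>Translations for the group law on \<open>E = \<complex>\<^sup>* / \<langle>\<alpha>\<rangle>\<close>.\<close>

definition E_translation :: "nat \<Rightarrow> complex \<Rightarrow> (surface_point \<Rightarrow> surface_point) \<Rightarrow> bool" where
  "E_translation m \<alpha> g \<longleftrightarrow>
     (\<exists>c. c \<noteq> 0 \<and> (\<forall>w. w \<noteq> 0 \<longrightarrow> g (E_point m \<alpha> w) = E_point m \<alpha> (c * w)))"

definition translation_bundle_Aut :: "nat \<Rightarrow> complex \<Rightarrow> (surface_point \<Rightarrow> surface_point) monoid" where
  "translation_bundle_Aut m \<alpha> = (BijGroup (points (Inoue_U m \<alpha>)))
     \<lparr>carrier := {F. \<exists>g. bundle_automorphism_over m \<alpha> g F \<and> E_translation m \<alpha> g}\<rparr>"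

end

theory Submission
  imports Defs "HOL-Complex_Analysis.Complex_Analysis"
    "HOL-Computational_Algebra.Fundamental_Theorem_Algebra"
begin

text \<open>
  The isomorphism is restriction to \<open>U\<close>. Since \<open>\<complex>\<^sup>2\<close> is simply connected, an automorphism \<open>f\<close> of \<open>S\<close>,
  read in the charts of \<open>W\<close>, lifts along the covering \<open>W \<rightarrow> S\<close>. The function \<open>w\<close> on \<open>W\<close> is
  constant on lifts of rational curves, which forces \<open>f\<close> to preserve the cycle \<open>C\<close>. Hence \<open>f\<close>
  lifts to a self-map \<open>\<Psi>\<close> of \<open>V\<close> with \<open>\<Psi> \<circ> \<gamma> = \<gamma>\<^sup>n \<circ> \<Psi>\<close>, and comparison with \<open>f\<^sup>-\<^sup>1\<close> gives \<open>n = \<plusminus>1\<close>.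
  The function \<open>w\<^sup>-\<^sup>n (w \<circ> \<Psi>)\<close> is \<open>\<gamma>\<close>-invariant and bounded, so it is constant; as \<open>w \<circ> \<Psi>\<close> vanishes
  along \<open>C\<close>, this means \<open>n = 1\<close> and \<open>w \<circ> \<Psi> = c w\<close>. On the fibers \<open>\<Psi>\<close> is then affine; its
  constant term vanishes because the bundle has negative degree, and its linear coefficient
  is a monomial \<open>A w\<^sup>j\<close> with \<open>\<alpha>\<^sup>j = c\<^sup>m\<close>. The bundle automorphisms over translations have the same
  form \<open>(w, x) \<mapsto> (c w, A w\<^sup>j x)\<close>, and these toric maps extend to \<open>W\<close> by permuting the charts \<open>U\<^sub>k\<close>.
\<close>

section \<open>Holomorphic maps in several variables\<close>

text \<open>V itself is not simply connected, so a lift over log w could have monodromy along the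
  loop w -> e^(it) w. This loop bounds a disc in U_0, at x_0 = 1 and y_0 = w, and f is defined there
  too; hence the lift descends to V. The cycle is used again when w \<circ> \<Psi> is bounded by a
  multiple of |w| near the crossing point of U_0: the quotient by w^n is then of size |w|^(1-n),
  which stays bounded for n \<le> 1, and n = -1 is impossible because c / w would blow up. A
  rational curve sent off C would lift to V, where Liouville makes first w and then x constant,
  against injectivity. Both sides of the isomorphism end in the same equation a(\<alpha> w) = c^m
  a(w) for a zero-free function on the punctured plane. In log w its logarithmic derivative is an
  elliptic function without poles, hence constant. The constant term of the affine map satisfies
  d(\<alpha> w) = c^m w^m d(w) instead; the factor w^m makes d bounded near 0 and then rules out
  every finite order of vanishing there.\<close>

lemma holo_on_subset: "holo_on f D \<Longrightarrow> E \<subseteq> D \<Longrightarrow> holo_on f E"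
  by (auto simp: holo_on_def)

lemma holo_on_compose:
  assumes "holo_on f D" "holo_on g E" "f ` D \<subseteq> E"
  shows "holo_on (g \<circ> f) D"
  unfolding holo_on_def
proof
  fix v assume v: "v \<in> D"
  obtain f' where f': "(f has_derivative f') (at v)" "\<And>c u. f' (c *s u) = c *s f' u"
    using assms(1) v by (auto simp: holo_on_def)
  obtain g' where g': "(g has_derivative g') (at (f v))" "\<And>c u. g' (c *s u) = c *s g' u"
    using assms(2,3) v unfolding holo_on_def by (meson image_subset_iff)
  have "(g \<circ> f has_derivative g' \<circ> f') (at v)"
    using diff_chain_at f'(1) g'(1) by blast
  then show "\<exists>h. (g \<circ> f has_derivative h) (at v) \<and> (\<forall>c u. h (c *s u) = c *s h u)"
    using f'(2) g'(2) by (intro exI[of _ "g' \<circ> f'"]) auto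
qed

lemma holo_on_local:
  assumes "\<And>v. v \<in> D \<Longrightarrow> \<exists>B g. open B \<and> v \<in> B \<and> holo_on g B \<and> (\<forall>u\<in>B. f u = g u)"
  shows "holo_on f D"
  unfolding holo_on_def
proof
  fix v assume "v \<in> D"
  then obtain B g where B: "open B" "v \<in> B" "holo_on g B" "\<forall>u\<in>B. f u = g u"
    using assms by blast
  obtain g' where g': "(g has_derivative g') (at v)" "\<forall>c u. g' (c *s u) = c *s g' u"
    using B by (auto simp: holo_on_def)
  have "(f has_derivative g') (at v)"
    by (rule has_derivative_transform_within_open[OF g'(1) B(1,2)]) (use B in auto)
  with g'(2) show "\<exists>f'. (f has_derivative f') (at v) \<and> (\<forall>c u. f' (c *s u) = c *s f' u)"
    by blast
qed

lemma holo_on_cong: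
  assumes "open D" "holo_on g D" "\<And>v. v \<in> D \<Longrightarrow> f v = g v"
  shows "holo_on f D"
  using assms by (intro holo_on_local) blast

lemma holo_on_id [simp]: "holo_on (\<lambda>v. v) D"
  unfolding holo_on_def by (auto intro!: exI[of _ "\<lambda>v. v"])

lemma holo_on_continuous: "holo_on f D \<Longrightarrow> continuous_on D f"
  unfolding holo_on_def continuous_on_eq_continuous_within
  by (meson has_derivative_continuous has_derivative_at_withinI)

lemma holo_on_vimage_open:
  assumes "holo_on f D" "open D" "open B"
  shows "open {v\<in>D. f v \<in> B}"
proof -
  have "open (f -` B \<inter> D)"
    using assms holo_on_continuous continuous_on_open_vimage by blast
  moreover have "f -` B \<inter> D = {v\<in>D. f v \<in> B}" by auto
  ultimately show ?thesis by simp
qed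

lemma bounded_linear_vec_scale: "bounded_linear (\<lambda>v::complex^'n. c *s v)"
proof -
  have "bounded_linear (\<lambda>v::complex^'n. \<chi> i. c * v $ i)"
    unfolding linear_conv_bounded_linear[symmetric]
    by (rule linearI) (auto simp: vec_eq_iff algebra_simps)
  then show ?thesis by (simp add: vector_scalar_mult_def)
qed

lemma holo_on_scale: "holo_on (\<lambda>v. c *s v) D"
  unfolding holo_on_def
proof
  fix v assume "v \<in> D"
  show "\<exists>f'. ((*s) c has_derivative f') (at v) \<and> (\<forall>ca u. f' (ca *s u) = ca *s f' u)"
    by (rule exI[of _ "\<lambda>v. c *s v"])
      (auto simp: vec_eq_iff intro: bounded_linear.has_derivative[OF bounded_linear_vec_scale has_derivative_ident])
qed

section \<open>Scalar functions, one point at a time\<close>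

definition holo_at :: "(complex^'n \<Rightarrow> complex) \<Rightarrow> complex^'n \<Rightarrow> bool" where
  "holo_at a v \<longleftrightarrow> (\<exists>a'. (a has_derivative a') (at v) \<and> (\<forall>c u. a' (c *s u) = c * a' u))"

lemma holo_at_const: "holo_at (\<lambda>v. c) v"
  unfolding holo_at_def by (rule exI[of _ "\<lambda>_. 0"]) auto

lemma holo_at_nth: "holo_at (\<lambda>v. v $ i) v"
  unfolding holo_at_def
  by (rule exI[of _ "\<lambda>v. v $ i"]) (auto intro: bounded_linear.has_derivative[OF bounded_linear_vec_nth] has_derivative_ident)

lemma holo_at_mult:
  assumes "holo_at a v" "holo_at b v"
  shows "holo_at (\<lambda>u. a u * b u) v"
proof -
  obtain a' b' where "(a has_derivative a') (at v)" "\<forall>c u. a' (c *s u) = c * a' u"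
    "(b has_derivative b') (at v)" "\<forall>c u. b' (c *s u) = c * b' u"
    using assms by (auto simp: holo_at_def)
  then show ?thesis unfolding holo_at_def
    by (intro exI[of _ "\<lambda>h. a v * b' h + a' h * b v"] conjI has_derivative_mult)
       (auto simp: algebra_simps)
qed

lemma holo_at_compose:
  assumes "holo_at a v" "g field_differentiable (at (a v))"
  shows "holo_at (\<lambda>u. g (a u)) v"
proof -
  obtain a' where a': "(a has_derivative a') (at v)" "\<forall>c u. a' (c *s u) = c * a' u"
    using assms by (auto simp: holo_at_def)
  obtain d where "(g has_field_derivative d) (at (a v))"
    using assms(2) by (auto simp: field_differentiable_def)
  then have "(g has_derivative (*) d) (at (a v))" by (simp add: has_field_derivative_def)
  from has_derivative_compose[OF a'(1) this]
  show ?thesis unfolding holo_at_def using a'(2)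
    by (intro exI[of _ "\<lambda>h. d * a' h"]) (auto simp: algebra_simps)
qed

lemma holo_at_power_int:
  assumes "holo_at a v" "a v \<noteq> 0 \<or> (n::int) \<ge> 0"
  shows "holo_at (\<lambda>u. a u powi n) v"
proof (cases "n \<ge> 0")
  case True
  have "(\<lambda>z. z ^ nat n) field_differentiable (at (a v))"
    by (intro derivative_intros)
  with True show ?thesis
    using holo_at_compose[OF assms(1)] by (simp add: power_int_def)
next
  case False
  with assms have "a v \<noteq> 0" by auto
  then have "(\<lambda>z. z powi n) field_differentiable (at (a v))"
    unfolding field_differentiable_def
    by (intro exI[of _ "of_int n * a v powi (n - 1) * 1"] DERIV_power_int[OF DERIV_ident]) auto
  with assms show ?thesis using holo_at_compose by blast
qed

lemma holo_at_inverse: "holo_at a v \<Longrightarrow> a v \<noteq> 0 \<Longrightarrow> holo_at (\<lambda>u. inverse (a u)) v"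
  by (rule holo_at_compose) (auto intro: derivative_intros)

lemma holo_at_exp: "holo_at a v \<Longrightarrow> holo_at (\<lambda>u. exp (a u)) v"
  by (rule holo_at_compose) (auto intro: derivative_intros simp: field_differentiable_within_exp)

lemma holo_at_add:
  assumes "holo_at a v" "holo_at b v"
  shows "holo_at (\<lambda>u. a u + b u) v"
proof -
  obtain a' b' where "(a has_derivative a') (at v)" "\<forall>c u. a' (c *s u) = c * a' u"
    "(b has_derivative b') (at v)" "\<forall>c u. b' (c *s u) = c * b' u"
    using assms by (auto simp: holo_at_def)
  then show ?thesis unfolding holo_at_def
    by (intro exI[of _ "\<lambda>h. a' h + b' h"] conjI has_derivative_add)
       (auto simp: algebra_simps)
qed

lemma holo_at_cong_open:
  assumes "holo_at g v" "open B" "v \<in> B" "\<And>u. u \<in> B \<Longrightarrow> f u = g u"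
  shows "holo_at f v"
  using assms unfolding holo_at_def
  by (metis has_derivative_transform_within_open)

lemma holo_on_compose_holo_at:
  assumes "holo_on f D" "v \<in> D" "holo_at a (f v)"
  shows "holo_at (\<lambda>u. a (f u)) v"
proof -
  obtain f' where f': "(f has_derivative f') (at v)" "\<And>c u. f' (c *s u) = c *s f' u"
    using assms(1,2) by (auto simp: holo_on_def)
  obtain a' where a': "(a has_derivative a') (at (f v))" "\<And>c u. a' (c *s u) = c * a' u"
    using assms(3) by (auto simp: holo_at_def)
  from has_derivative_compose[OF f'(1) a'(1)] show ?thesis
    unfolding holo_at_def using f'(2) a'(2) by (intro exI[of _ "\<lambda>h. a' (f' h)"]) auto
qed

lemma holo_at_continuous: "holo_at a v \<Longrightarrow> isCont a v"
  by (auto simp: holo_at_def dest: has_derivative_continuous)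

section \<open>Coordinates on \<complex>^2 and curves in it\<close>

abbreviation vec2 :: "complex \<Rightarrow> complex \<Rightarrow> complex^2" where
  "vec2 x y \<equiv> vector [x, y]"

lemma vec2_eta [simp]: "vec2 (v $ 1) (v $ 2) = v"
  by (simp add: vec_eq_iff forall_2)

lemma vec2_eq_iff [simp]: "vec2 x y = vec2 x' y' \<longleftrightarrow> x = x' \<and> y = y'"
  by (simp add: vec_eq_iff forall_2)

lemma bounded_linear_vec2: "bounded_linear (\<lambda>p. vec2 (fst p) (snd p))"
  unfolding linear_conv_bounded_linear[symmetric]
  by (rule linearI) (auto simp: vec_eq_iff forall_2)

lemma holo_on_vec2:
  assumes "\<And>v. v \<in> D \<Longrightarrow> holo_at a v" "\<And>v. v \<in> D \<Longrightarrow> holo_at b v"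
  shows "holo_on (\<lambda>v. vec2 (a v) (b v)) D"
  unfolding holo_on_def
proof
  fix v assume "v \<in> D"
  then obtain a' b' where *: "(a has_derivative a') (at v)" "\<forall>c u. a' (c *s u) = c * a' u"
    "(b has_derivative b') (at v)" "\<forall>c u. b' (c *s u) = c * b' u"
    using assms unfolding holo_at_def by meson
  have "((\<lambda>v. vec2 (fst (a v, b v)) (snd (a v, b v))) has_derivative
      (\<lambda>h. vec2 (fst (a' h, b' h)) (snd (a' h, b' h)))) (at v)"
    by (rule bounded_linear.has_derivative[OF bounded_linear_vec2 has_derivative_Pair[OF *(1,3)]])
  then show "\<exists>f'. ((\<lambda>v. vec2 (a v) (b v)) has_derivative f') (at v) \<and> (\<forall>c u. f' (c *s u) = c *s f' u)"
    using *(2,4) by (intro exI[of _ "\<lambda>h. vec2 (a' h) (b' h)"]) (auto simp: vec_eq_iff forall_2)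
qed

text \<open>The bridge to one-variable function theory, which is later applied on axes and fibers.
  Complex linearity turns the real derivative along the curve into multiplication by one complex
  number.\<close>

lemma holo_at_curve:
  assumes "holo_at a (vec2 (p t) (q t))" "p field_differentiable (at t)" "q field_differentiable (at t)"
  shows "(\<lambda>t. a (vec2 (p t) (q t))) field_differentiable (at t)"
proof -
  obtain a' where a': "(a has_derivative a') (at (vec2 (p t) (q t)))" "\<forall>c u. a' (c *s u) = c * a' u"
    using assms by (auto simp: holo_at_def)
  obtain p' q' where pq: "(p has_derivative (*) p') (at t)" "(q has_derivative (*) q') (at t)"
    using assms(2,3) by (auto simp: field_differentiable_def has_field_derivative_def)
  have "((\<lambda>t. vec2 (fst (p t, q t)) (snd (p t, q t))) has_derivative
      (\<lambda>h. vec2 (fst (p' * h, q' * h)) (snd (p' * h, q' * h)))) (at t)"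
    by (rule bounded_linear.has_derivative[OF bounded_linear_vec2 has_derivative_Pair[OF pq]])
  from has_derivative_compose[OF this, of a a'] a'(1)
  have "((\<lambda>t. a (vec2 (p t) (q t))) has_derivative (\<lambda>h. a' (vec2 (p' * h) (q' * h)))) (at t)"
    by simp
  moreover have "(\<lambda>h. a' (vec2 (p' * h) (q' * h))) = (*) (a' (vec2 p' q'))"
  proof
    fix h
    have "vec2 (p' * h) (q' * h) = h *s vec2 p' q'"
      by (simp add: vec_eq_iff forall_2)
    then show "a' (vec2 (p' * h) (q' * h)) = a' (vec2 p' q') * h" using a'(2) by simp
  qed
  ultimately show ?thesis
    unfolding field_differentiable_def has_field_derivative_def by (intro exI) simp
qed

lemma continuous_on_vec2 [continuous_intros]:
  assumes "continuous_on S p" "continuous_on S q"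
  shows "continuous_on S (\<lambda>t. vec2 (p t) (q t))"
  using continuous_on_compose2[OF linear_continuous_on[OF bounded_linear_vec2, of UNIV]
      continuous_on_Pair[OF assms]] by auto

section \<open>Atlases with holomorphic transition maps\<close>

text \<open>The manifold record carries no axioms; these are the ones used. Transition maps are
  germs \<tau> at a pair of points, because in a quotient they depend on the deck transformation
  that matches the two points.\<close>

definition compatible_atlas :: "('p, 'n::finite) complex_mfd \<Rightarrow> bool" where
  "compatible_atlas M \<longleftrightarrow>
     (\<forall>(D, \<phi>)\<in>charts M. open D \<and> inj_on \<phi> D \<and> \<phi> ` D \<subseteq> points M) \<and>
     (\<forall>p\<in>points M. \<exists>(D, \<phi>)\<in>charts M. p \<in> \<phi> ` D) \<and>
     (\<forall>(D, \<phi>)\<in>charts M. \<forall>(D', \<psi>)\<in>charts M. \<forall>v\<in>D. \<forall>v'\<in>D'. \<phi> v = \<psi> v' \<longrightarrow>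
        (\<exists>B \<tau>. open B \<and> v \<in> B \<and> B \<subseteq> D \<and> holo_on \<tau> B \<and> \<tau> ` B \<subseteq> D' \<and> \<tau> v = v' \<and>
               (\<forall>u\<in>B. \<psi> (\<tau> u) = \<phi> u)))"

lemma compatible_atlasD:
  assumes "compatible_atlas M" "(D, \<phi>) \<in> charts M"
  shows "open D" "inj_on \<phi> D" "\<And>v. v \<in> D \<Longrightarrow> \<phi> v \<in> points M"
  using assms(1)[unfolded compatible_atlas_def, THEN conjunct1, THEN bspec, OF assms(2)] by auto

lemma compatible_atlas_cover:
  assumes "compatible_atlas M" "p \<in> points M"
  obtains D \<phi> v where "(D, \<phi>) \<in> charts M" "v \<in> D" "p = \<phi> v"
  using assms(1)[unfolded compatible_atlas_def, THEN conjunct2, THEN conjunct1, THEN bspec, OF assms(2)]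
  by blast

lemma compatible_atlas_transition:
  assumes "compatible_atlas M" "(D, \<phi>) \<in> charts M" "(D', \<psi>) \<in> charts M" "v \<in> D" "v' \<in> D'" "\<phi> v = \<psi> v'"
  obtains B \<tau> where "open B" "v \<in> B" "B \<subseteq> D" "holo_on \<tau> B" "\<tau> ` B \<subseteq> D'" "\<tau> v = v'"
    "\<And>u. u \<in> B \<Longrightarrow> \<psi> (\<tau> u) = \<phi> u"
proof -
  have "\<forall>(D', \<psi>)\<in>charts M. \<forall>v\<in>D. \<forall>v'\<in>D'. \<phi> v = \<psi> v' \<longrightarrow>
        (\<exists>B \<tau>. open B \<and> v \<in> B \<and> B \<subseteq> D \<and> holo_on \<tau> B \<and> \<tau> ` B \<subseteq> D' \<and> \<tau> v = v' \<and>
               (\<forall>u\<in>B. \<psi> (\<tau> u) = \<phi> u))"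
    using assms(1)[unfolded compatible_atlas_def, THEN conjunct2, THEN conjunct2, THEN bspec, OF assms(2)]
    by simp
  from bspec[OF this assms(3)] have "\<exists>B \<tau>. open B \<and> v \<in> B \<and> B \<subseteq> D \<and> holo_on \<tau> B \<and> \<tau> ` B \<subseteq> D' \<and> \<tau> v = v' \<and>
               (\<forall>u\<in>B. \<psi> (\<tau> u) = \<phi> u)"
    using assms(4,5,6) by simp
  then show ?thesis using that by blast
qed

lemma topspace_mfd [simp]:
  assumes "compatible_atlas M"
  shows "topspace (mfd_topology M) = points M"
proof -
  have "{v\<in>D. \<phi> v \<in> points M} = D" "open D" if "(D, \<phi>) \<in> charts M" for D \<phi>
    using compatible_atlasD[OF assms that] by auto
  then have "openin (mfd_topology M) (points M)"
    unfolding openin_mfd_topology by auto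
  moreover have "topspace (mfd_topology M) \<subseteq> points M"
    using openin_mfd_topology[of M] openin_topspace by blast
  ultimately show ?thesis by (simp add: openin_subset subset_antisym)
qed

text \<open>The topology only tests preimages under charts; that chart images are open comes from
  the continuity of the transition germs.\<close>

lemma openin_chart_image:
  assumes M: "compatible_atlas M" and c: "(D', \<psi>) \<in> charts M" and B': "open B'" "B' \<subseteq> D'"
  shows "openin (mfd_topology M) (\<psi> ` B')"
  unfolding openin_mfd_topology
proof (intro conjI; clarify?)
  show "\<psi> v \<in> points M" if "v \<in> B'" for v using that compatible_atlasD(3)[OF M c] B' by auto
next
  fix D \<phi> assume d: "(D, \<phi>) \<in> charts M"
  show "open {v \<in> D. \<phi> v \<in> \<psi> ` B'}"
  proof (subst open_subopen, intro ballI)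
    fix v assume "v \<in> {v \<in> D. \<phi> v \<in> \<psi> ` B'}"
    then obtain v' where v': "v \<in> D" "v' \<in> B'" "\<phi> v = \<psi> v'" by auto
    obtain B \<tau> where B: "open B" "v \<in> B" "B \<subseteq> D" "holo_on \<tau> B" "\<tau> ` B \<subseteq> D'" "\<tau> v = v'"
      "\<And>u. u \<in> B \<Longrightarrow> \<psi> (\<tau> u) = \<phi> u"
      using compatible_atlas_transition[OF M d c v'(1) _ v'(3)] v' B'(2) by blast
    have "open {u\<in>B. \<tau> u \<in> B'}" by (rule holo_on_vimage_open[OF B(4,1) B'(1)])
    moreover have "{u\<in>B. \<tau> u \<in> B'} \<subseteq> {v \<in> D. \<phi> v \<in> \<psi> ` B'}"
    proof clarify
      fix u assume "u \<in> B" "\<tau> u \<in> B'"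
      then show "u \<in> D \<and> \<phi> u \<in> \<psi> ` B'"
        using B(3) B(7)[of u, symmetric] by auto
    qed
    ultimately show "\<exists>T. open T \<and> v \<in> T \<and> T \<subseteq> {v \<in> D. \<phi> v \<in> \<psi> ` B'}"
      using B(2,6) v'(2) by (intro exI[of _ "{u\<in>B. \<tau> u \<in> B'}"]) auto
  qed
qed

text \<open>\<open>holomorphic_map\<close> tests every pair of charts. One freely chosen target
  chart per point suffices, since a transition germ carries the local expression into any other
  chart.\<close>

lemma holomorphic_mapI:
  assumes M: "compatible_atlas M" and N: "compatible_atlas N"
    and loc: "\<And>D \<phi> v. (D, \<phi>) \<in> charts M \<Longrightarrow> v \<in> D \<Longrightarrow>
      \<exists>D' \<psi> B \<tau>. (D', \<psi>) \<in> charts N \<and> open B \<and> v \<in> B \<and> B \<subseteq> D \<and> holo_on \<tau> B \<and> \<tau> ` B \<subseteq> D' \<and>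
        (\<forall>u\<in>B. f (\<phi> u) = \<psi> (\<tau> u))"
  shows "holomorphic_map M N f"
  unfolding holomorphic_map_def
proof (intro conjI)
  show "continuous_map (mfd_topology M) (mfd_topology N) f"
    unfolding continuous_map
  proof (intro conjI allI impI)
    show "f ` topspace (mfd_topology M) \<subseteq> topspace (mfd_topology N)"
    proof clarify
      fix p assume "p \<in> topspace (mfd_topology M)"
      then have "p \<in> points M" by (simp add: M)
      then obtain D \<phi> v where d: "(D, \<phi>) \<in> charts M" "v \<in> D" "p = \<phi> v"
        by (rule compatible_atlas_cover[OF M])
      obtain D' \<psi> B \<tau> where c: "(D', \<psi>) \<in> charts N" "v \<in> B" "\<tau> ` B \<subseteq> D'"
        "\<forall>u\<in>B. f (\<phi> u) = \<psi> (\<tau> u)"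
        using loc[OF d(1,2)] by blast
      then have "f p = \<psi> (\<tau> v)" "\<tau> v \<in> D'" using d by auto
      then show "f p \<in> topspace (mfd_topology N)"
        using compatible_atlasD(3)[OF N c(1)] by (simp add: N)
    qed
  next
    fix G assume G: "openin (mfd_topology N) G"
    have "open {v \<in> D. \<phi> v \<in> {x \<in> points M. f x \<in> G}}" if d: "(D, \<phi>) \<in> charts M" for D \<phi>
    proof (subst open_subopen, intro ballI)
      fix v assume v: "v \<in> {v \<in> D. \<phi> v \<in> {x \<in> points M. f x \<in> G}}"
      then have vD: "v \<in> D" and vG: "f (\<phi> v) \<in> G" by auto
      obtain D' \<psi> B \<tau> where c: "(D', \<psi>) \<in> charts N" "open B" "v \<in> B" "B \<subseteq> D" "holo_on \<tau> B"
        "\<tau> ` B \<subseteq> D'" "\<forall>u\<in>B. f (\<phi> u) = \<psi> (\<tau> u)"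
        using loc[OF d vD] by blast
      have "open {v'\<in>D'. \<psi> v' \<in> G}" using G c(1) by (auto simp: openin_mfd_topology)
      then have "open {u\<in>B. \<tau> u \<in> {v'\<in>D'. \<psi> v' \<in> G}}"
        by (rule holo_on_vimage_open[OF c(5,2)])
      moreover have "{u\<in>B. \<tau> u \<in> {v'\<in>D'. \<psi> v' \<in> G}} \<subseteq> {v \<in> D. \<phi> v \<in> {x \<in> points M. f x \<in> G}}"
        using c compatible_atlasD(3)[OF M d] by auto
      ultimately show "\<exists>T. open T \<and> v \<in> T \<and> T \<subseteq> {v \<in> D. \<phi> v \<in> {x \<in> points M. f x \<in> G}}"
        using c(3,6,7) vG by (intro exI[of _ "{u\<in>B. \<tau> u \<in> {v'\<in>D'. \<psi> v' \<in> G}}"] conjI) auto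
    qed
    then show "openin (mfd_topology M) {x \<in> topspace (mfd_topology M). f x \<in> G}"
      by (auto simp: M openin_mfd_topology)
  qed
next
  have "holo_on (inv_into D' \<psi> \<circ> f \<circ> \<phi>) {v \<in> D. f (\<phi> v) \<in> \<psi> ` D'}"
    if d: "(D, \<phi>) \<in> charts M" and d': "(D', \<psi>) \<in> charts N" for D \<phi> D' \<psi>
  proof (rule holo_on_local)
    fix v assume "v \<in> {v \<in> D. f (\<phi> v) \<in> \<psi> ` D'}"
    then obtain v' where v: "v \<in> D" "v' \<in> D'" "f (\<phi> v) = \<psi> v'" by auto
    obtain D1 \<psi>1 B \<tau> where c: "(D1, \<psi>1) \<in> charts N" "open B" "v \<in> B" "B \<subseteq> D" "holo_on \<tau> B"
        "\<tau> ` B \<subseteq> D1" "\<forall>u\<in>B. f (\<phi> u) = \<psi>1 (\<tau> u)"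
      using loc[OF d v(1)] by blast
    have "\<psi>1 (\<tau> v) = \<psi> v'" "\<tau> v \<in> D1" using c v by auto
    then obtain B1 \<tau>1 where b: "open B1" "\<tau> v \<in> B1" "B1 \<subseteq> D1" "holo_on \<tau>1 B1" "\<tau>1 ` B1 \<subseteq> D'"
      "\<And>u. u \<in> B1 \<Longrightarrow> \<psi> (\<tau>1 u) = \<psi>1 u"
      using compatible_atlas_transition[OF N c(1) d' _ v(2)] by metis
    define T where "T = {u\<in>B. \<tau> u \<in> B1}"
    have T: "open T" "v \<in> T" unfolding T_def using holo_on_vimage_open c b by auto
    have "holo_on (\<tau>1 \<circ> \<tau>) T"
      by (rule holo_on_compose[OF holo_on_subset[OF c(5)] b(4)]) (auto simp: T_def)
    moreover have "(inv_into D' \<psi> \<circ> f \<circ> \<phi>) u = (\<tau>1 \<circ> \<tau>) u" if "u \<in> T" for u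
    proof -
      have "f (\<phi> u) = \<psi> (\<tau>1 (\<tau> u))" "\<tau>1 (\<tau> u) \<in> D'"
        using that c b by (auto simp: T_def)
      then show ?thesis
        using compatible_atlasD(2)[OF N d'] by (simp add: inv_into_f_f)
    qed
    ultimately show "\<exists>B g. open B \<and> v \<in> B \<and> holo_on g B \<and> (\<forall>u\<in>B. (inv_into D' \<psi> \<circ> f \<circ> \<phi>) u = g u)"
      using T by blast
  qed
  then show "\<forall>(D, \<phi>)\<in>charts M. \<forall>(D', \<psi>)\<in>charts N.
     holo_on (inv_into D' \<psi> \<circ> f \<circ> \<phi>) {v \<in> D. f (\<phi> v) \<in> \<psi> ` D'}" by auto
qed

text \<open>Openness of the domain is recorded separately, as \<open>holo_on\<close> alone does not
  ask for it.\<close>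

lemma holomorphic_mapD:
  assumes f: "holomorphic_map M N f" and M: "compatible_atlas M" and N: "compatible_atlas N"
    and d: "(D, \<phi>) \<in> charts M" and d': "(D', \<psi>) \<in> charts N"
  shows "open {v \<in> D. f (\<phi> v) \<in> \<psi> ` D'}"
    and "holo_on (inv_into D' \<psi> \<circ> f \<circ> \<phi>) {v \<in> D. f (\<phi> v) \<in> \<psi> ` D'}"
proof -
  show "holo_on (inv_into D' \<psi> \<circ> f \<circ> \<phi>) {v \<in> D. f (\<phi> v) \<in> \<psi> ` D'}"
    using f d d' by (auto simp: holomorphic_map_def)
  have "openin (mfd_topology N) (\<psi> ` D')"
    using openin_chart_image[OF N d'] compatible_atlasD(1)[OF N d'] by blast
  then have "openin (mfd_topology M) {x \<in> points M. f x \<in> \<psi> ` D'}"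
    using f M by (auto simp: holomorphic_map_def continuous_map)
  then have "open {v \<in> D. \<phi> v \<in> {x \<in> points M. f x \<in> \<psi> ` D'}}"
    using d by (auto simp: openin_mfd_topology)
  moreover have "{v \<in> D. \<phi> v \<in> {x \<in> points M. f x \<in> \<psi> ` D'}} = {v \<in> D. f (\<phi> v) \<in> \<psi> ` D'}"
    using compatible_atlasD(3)[OF M d] by auto
  ultimately show "open {v \<in> D. f (\<phi> v) \<in> \<psi> ` D'}" by simp
qed

lemma holomorphic_map_points:
  assumes "holomorphic_map M N f" "compatible_atlas M" "compatible_atlas N" "p \<in> points M"
  shows "f p \<in> points N"
  using assms by (auto simp: holomorphic_map_def continuous_map)

lemma holomorphic_map_cong:
  assumes M: "compatible_atlas M" and N: "compatible_atlas N"
    and f: "holomorphic_map M N f" and eq: "\<And>p. p \<in> points M \<Longrightarrow> g p = f p"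
  shows "holomorphic_map M N g"
proof -
  have *: "g (\<phi> v) = f (\<phi> v)" if "(D, \<phi>) \<in> charts M" "v \<in> D" for D \<phi> v
    using compatible_atlasD(3)[OF M that(1)] that eq by auto
  have "{v \<in> D. g (\<phi> v) \<in> G} = {v \<in> D. f (\<phi> v) \<in> G}" if "(D, \<phi>) \<in> charts M" for D \<phi> G
    using *[OF that] by auto
  moreover have "continuous_map (mfd_topology M) (mfd_topology N) g"
    using f eq M by (auto simp: holomorphic_map_def intro: continuous_map_eq)
  moreover have "holo_on (inv_into D' \<psi> \<circ> g \<circ> \<phi>) {v \<in> D. f (\<phi> v) \<in> \<psi> ` D'}"
    if "(D, \<phi>) \<in> charts M" "(D', \<psi>) \<in> charts N" for D \<phi> D' \<psi>
    by (rule holo_on_cong[OF holomorphic_mapD[OF f M N that]]) (use *[OF that(1)] in auto)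
  ultimately show ?thesis unfolding holomorphic_map_def by auto
qed

section \<open>Atlases of open submanifolds and of quotients\<close>

lemma compatible_atlas_open_submfd:
  assumes M: "compatible_atlas M" and G: "openin (mfd_topology M) G"
  shows "compatible_atlas (open_submfd M G)"
  unfolding compatible_atlas_def
proof (intro conjI; clarify)
  fix D \<phi> assume "(D, \<phi>) \<in> charts (open_submfd M G)"
  then obtain D0 where d: "D = {v\<in>D0. \<phi> v \<in> G}" "(D0, \<phi>) \<in> charts M"
    by (auto simp: open_submfd_def)
  show "open D \<and> inj_on \<phi> D \<and> \<phi> ` D \<subseteq> points (open_submfd M G)"
    using d G compatible_atlasD[OF M d(2)]
    by (auto simp: openin_mfd_topology open_submfd_def inj_on_def)
next
  fix p assume "p \<in> points (open_submfd M G)"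
  then have p: "p \<in> G" "p \<in> points M"
    using G by (auto simp: open_submfd_def openin_mfd_topology)
  then obtain D \<phi> v where "(D, \<phi>) \<in> charts M" "v \<in> D" "p = \<phi> v"
    using compatible_atlas_cover[OF M] by blast
  then show "\<exists>(D, \<phi>)\<in>charts (open_submfd M G). p \<in> \<phi> ` D"
    using p by (intro bexI[of _ "({v\<in>D. \<phi> v \<in> G}, \<phi>)"]) (auto simp: open_submfd_def)
next
  fix D \<phi> D' \<psi> v v'
  assume a: "(D, \<phi>) \<in> charts (open_submfd M G)" "(D', \<psi>) \<in> charts (open_submfd M G)"
    "v \<in> D" "v' \<in> D'" "\<phi> v = \<psi> v'"
  then obtain D0 D0' where d: "D = {v\<in>D0. \<phi> v \<in> G}" "(D0, \<phi>) \<in> charts M"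
     "D' = {v\<in>D0'. \<psi> v \<in> G}" "(D0', \<psi>) \<in> charts M"
    by (auto simp: open_submfd_def)
  then obtain B \<tau> where B: "open B" "v \<in> B" "B \<subseteq> D0" "holo_on \<tau> B" "\<tau> ` B \<subseteq> D0'" "\<tau> v = v'"
    "\<And>u. u \<in> B \<Longrightarrow> \<psi> (\<tau> u) = \<phi> u"
    using compatible_atlas_transition[OF M d(2,4)] a(3,4,5) by blast
  have "open D" using d G by (auto simp: openin_mfd_topology)
  then show "\<exists>B \<tau>. open B \<and> v \<in> B \<and> B \<subseteq> D \<and> holo_on \<tau> B \<and> \<tau> ` B \<subseteq> D' \<and> \<tau> v = v' \<and>
     (\<forall>u\<in>B. \<psi> (\<tau> u) = \<phi> u)"
    using B a d by (intro exI[of _ "B \<inter> D"] exI[of _ \<tau>]) (auto intro: holo_on_subset)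
qed

text \<open>R may live on a larger set X, so that the orbit relation of W also serves for the curve
  \<open>Etilde\<close>. \<open>linj\<close> provides enough quotient charts, and
  \<open>trans\<close> spreads one pair of related points to a holomorphic germ of such
  pairs.\<close>

lemma compatible_atlas_quotient:
  assumes opn: "\<And>D \<phi>. (D, \<phi>) \<in> charts M \<Longrightarrow> open D \<and> \<phi> ` D \<subseteq> points M"
    and cover: "\<And>p. p \<in> points M \<Longrightarrow> \<exists>(D, \<phi>)\<in>charts M. p \<in> \<phi> ` D"
    and R: "equiv X R" "points M \<subseteq> X"
    and linj: "\<And>D \<phi> v. (D, \<phi>) \<in> charts M \<Longrightarrow> v \<in> D \<Longrightarrow>
       \<exists>B. open B \<and> v \<in> B \<and> B \<subseteq> D \<and> inj_on (\<lambda>u. R `` {\<phi> u}) B"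
    and trans: "\<And>D \<phi> D' \<psi> v v'. (D, \<phi>) \<in> charts M \<Longrightarrow> (D', \<psi>) \<in> charts M \<Longrightarrow> v \<in> D \<Longrightarrow> v' \<in> D' \<Longrightarrow>
       (\<phi> v, \<psi> v') \<in> R \<Longrightarrow>
       \<exists>B \<tau>. open B \<and> v \<in> B \<and> B \<subseteq> D \<and> holo_on \<tau> B \<and> \<tau> ` B \<subseteq> D' \<and> \<tau> v = v' \<and>
         (\<forall>u\<in>B. (\<phi> u, \<psi> (\<tau> u)) \<in> R)"
  shows "compatible_atlas (quotient_mfd M R)"
  unfolding compatible_atlas_def
proof (intro conjI; clarify)
  fix D \<phi> assume "(D, \<phi>) \<in> charts (quotient_mfd M R)"
  then show "open D \<and> inj_on \<phi> D \<and> \<phi> ` D \<subseteq> points (quotient_mfd M R)"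
    using opn by (fastforce simp: quotient_mfd_def intro!: quotientI)
next
  fix q assume "q \<in> points (quotient_mfd M R)"
  then obtain p where p: "p \<in> points M" "q = R `` {p}"
    by (auto simp: quotient_mfd_def elim: quotientE)
  then obtain D \<phi> v where d: "(D, \<phi>) \<in> charts M" "v \<in> D" "p = \<phi> v"
    using cover by blast
  then obtain B where "open B" "v \<in> B" "B \<subseteq> D" "inj_on (\<lambda>u. R `` {\<phi> u}) B" using linj by blast
  then show "\<exists>(D, \<phi>)\<in>charts (quotient_mfd M R). q \<in> \<phi> ` D"
    using p d by (intro bexI[of _ "(B, \<lambda>u. R `` {\<phi> u})"]) (auto simp: quotient_mfd_def)
next
  fix D \<phi> D' \<psi> v v'
  assume a: "(D, \<phi>) \<in> charts (quotient_mfd M R)" "(D', \<psi>) \<in> charts (quotient_mfd M R)"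
    "v \<in> D" "v' \<in> D'" "\<phi> v = \<psi> v'"
  then obtain D0 \<phi>0 D0' \<psi>0 where d: "(D0, \<phi>0) \<in> charts M" "open D" "D \<subseteq> D0" "\<phi> = (\<lambda>v. R `` {\<phi>0 v})"
      "(D0', \<psi>0) \<in> charts M" "open D'" "D' \<subseteq> D0'" "\<psi> = (\<lambda>v. R `` {\<psi>0 v})"
    by (auto simp: quotient_mfd_def)
  have "\<psi>0 v' \<in> X" using opn[OF d(5)] R(2) a(4) d(7) by blast
  moreover have "R `` {\<phi>0 v} = R `` {\<psi>0 v'}" using a(5) d(4,8) by simp
  ultimately have "(\<phi>0 v, \<psi>0 v') \<in> R"
    using eq_equiv_class[OF _ R(1)] by blast
  then obtain B \<tau> where B: "open B" "v \<in> B" "B \<subseteq> D0" "holo_on \<tau> B" "\<tau> ` B \<subseteq> D0'" "\<tau> v = v'"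
         "\<forall>u\<in>B. (\<phi>0 u, \<psi>0 (\<tau> u)) \<in> R"
    using trans[OF d(1,5) subsetD[OF d(3) a(3)] subsetD[OF d(7) a(4)]] by blast
  define T where "T = {u\<in>B. \<tau> u \<in> D'} \<inter> D"
  have "open T" unfolding T_def using holo_on_vimage_open[OF B(4,1) d(6)] d(2) by auto
  moreover have "\<psi> (\<tau> u) = \<phi> u" if "u \<in> T" for u
    using equiv_class_eq[OF R(1), of "\<phi>0 u" "\<psi>0 (\<tau> u)"] B(7) that d(4,8) by (simp add: T_def)
  ultimately show "\<exists>B \<tau>. open B \<and> v \<in> B \<and> B \<subseteq> D \<and> holo_on \<tau> B \<and> \<tau> ` B \<subseteq> D' \<and> \<tau> v = v' \<and>
     (\<forall>u\<in>B. \<psi> (\<tau> u) = \<phi> u)"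
    using B a(3,4)
    by (intro exI[of _ T] exI[of _ \<tau>]) (auto simp: T_def intro: holo_on_subset)
qed

section \<open>The points of \<open>W\<close>\<close>

text \<open>Decides the gluing: a point is represented in V if w is nonzero, and otherwise in a
  chart U_k with y = 0, which moves (0, y) with y nonzero to the next chart. Equality in W becomes
  equality of terms.\<close>

fun normal_form :: "patch_point \<Rightarrow> patch_point" where
  "normal_form (In_U k x y) =
     (if x \<noteq> 0 \<and> y \<noteq> 0 then In_V (x * y) ((x * y) powi k * x)
      else if y \<noteq> 0 then In_U (k + 1) (inverse y) 0 else In_U k x 0)"
| "normal_form (In_V w x) = In_V w x"

lemma x_coordinate: "x \<noteq> 0 \<Longrightarrow> x powi (k + 1) * y powi k = (x * y) powi k * (x::complex)"
  by (simp add: power_int_add power_int_mult_distrib)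

lemma glued_normal_form: "glued p q \<Longrightarrow> normal_form p = normal_form q"
proof (induction rule: glued.induct)
  case (UU y k x)
  have "inverse y * (x * y\<^sup>2) = x * y" using UU by (simp add: field_simps power2_eq_square)
  note e = this
  have "x \<noteq> 0 \<Longrightarrow> (x * y) powi (k + 1) * inverse y = (x * y) powi k * x"
    using UU by (simp add: power_int_add field_simps)
  then show ?case using UU unfolding normal_form.simps e by simp
next
  case (UV x y k)
  then show ?case using x_coordinate[of x k y] by simp
qed

lemma equivclp_normal_form: "equivclp glued p (normal_form p)"
proof (cases p)
  case (In_U k x y)
  consider "x \<noteq> 0" "y \<noteq> 0" | "x = 0" "y \<noteq> 0" | "y = 0" by blast
  then show ?thesis
  proof cases
    case 1
    then show ?thesis using glued.UV[OF 1, of k] In_U x_coordinate[of x k y]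
      by (simp add: r_into_equivclp)
  next
    case 2
    then show ?thesis using glued.UU[of y k 0] In_U by (simp add: r_into_equivclp)
  next
    case 3
    then show ?thesis using In_U by simp
  qed
qed simp

lemma equivclp_glued_normal_form: "equivclp glued p q \<longleftrightarrow> normal_form p = normal_form q"
proof
  show "equivclp glued p q \<Longrightarrow> normal_form p = normal_form q"
    by (induction rule: equivclp_induct) (use glued_normal_form in metis)+
  show "normal_form p = normal_form q \<Longrightarrow> equivclp glued p q"
    by (metis equivclp_normal_form equivclp_sym equivclp_trans)
qed

lemma W_point_eq_iff: "W_point p = W_point q \<longleftrightarrow> normal_form p = normal_form q"
  unfolding W_point_def equivclp_glued_normal_form by (auto simp: set_eq_iff)

lemma patch_points_simps [simp]: "In_U k x y \<in> patch_points" "In_V w x \<in> patch_points \<longleftrightarrow> w \<noteq> 0"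
  by (auto simp: patch_points_def)

lemma patch_points_normal_form: "normal_form p \<in> patch_points \<longleftrightarrow> p \<in> patch_points"
  by (cases p) auto

abbreviation U_pt :: "int \<Rightarrow> complex \<Rightarrow> complex \<Rightarrow> patch_point set" where
  "U_pt k x y \<equiv> W_point (In_U k x y)"

abbreviation V_pt :: "complex \<Rightarrow> complex \<Rightarrow> patch_point set" where
  "V_pt w x \<equiv> W_point (In_V w x)"

lemma U_pt_in_W [simp]: "U_pt k x y \<in> points W"
  and V_pt_in_W [simp]: "w \<noteq> 0 \<Longrightarrow> V_pt w x \<in> points W"
  by (auto simp: W_def)

lemma U_pt_eq_V_pt: "x \<noteq> 0 \<Longrightarrow> y \<noteq> 0 \<Longrightarrow> U_pt k x y = V_pt (x * y) ((x * y) powi k * x)"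
  by (simp add: W_point_eq_iff)

lemma V_pt_eq_U_pt:
  assumes "w \<noteq> 0" "x \<noteq> 0"
  shows "V_pt w x = U_pt k (w powi (-k) * x) (w powi (k + 1) * inverse x)"
proof -
  have "w powi (-k) * x * (w powi (k + 1) * inverse x) = w"
    using assms by (simp add: power_int_add power_int_minus field_simps)
  moreover have "w powi k * (w powi (-k) * x) = x"
    using assms by (simp add: power_int_minus field_simps)
  ultimately show ?thesis
    using assms by (simp add: W_point_eq_iff)
qed

lemma V_pt_eq_iff [simp]: "V_pt w x = V_pt w' x' \<longleftrightarrow> w = w' \<and> x = x'"
  by (simp add: W_point_eq_iff)

lemma U_pt_eq_V_ptD: "U_pt k x y = V_pt w z \<Longrightarrow> w \<noteq> 0 \<Longrightarrow> x \<noteq> 0 \<and> y \<noteq> 0 \<and> w = x * y \<and> z = w powi k * x"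
  by (auto simp: W_point_eq_iff split: if_splits)

lemma U_pt_inj: "U_pt k x y = U_pt k x' y' \<longleftrightarrow> x = x' \<and> y = y'"
  by (auto simp: W_point_eq_iff split: if_splits)

lemma U_pt_Suc: "y \<noteq> 0 \<Longrightarrow> U_pt k x y = U_pt (k + 1) (inverse y) (x * y\<^sup>2)"
  unfolding W_point_eq_iff using glued_normal_form[OF glued.UU] .

text \<open>The gluing of U_k with U_(k+d) as polynomial equations, which make sense on the axes as
  well. Being closed, they give uniqueness of limits in W; the first, a product equal to 1, is what
  fails on small polydiscs.\<close>

lemma U_pt_eq_U_pt:
  assumes "d \<ge> (1::nat)"
  shows "U_pt k x y = U_pt (k + int d) x' y' \<longleftrightarrow> x' * x ^ (d - 1) * y ^ d = 1 \<and> y' = x ^ d * y ^ Suc d"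
    (is "?L \<longleftrightarrow> ?R")
proof (cases "x \<noteq> 0 \<and> y \<noteq> 0")
  case True
  then have xy: "x \<noteq> 0" "y \<noteq> 0" by auto
  have pw: "(x * y) ^ d = x * x ^ (d - 1) * y ^ d"
    using assms by (cases d) (auto simp: power_mult_distrib)
  have shift: "(x * y) powi (k + int d) = (x * y) powi k * (x * y) ^ d"
    using xy by (simp add: power_int_add)
  have kn: "(x * y) powi k \<noteq> 0" using xy by simp
  have xd: "x ^ d = x * x ^ (d - 1)" using assms by (cases d) auto
  show ?thesis
  proof
    assume ?L
    then have L: "x' \<noteq> 0" "y' \<noteq> 0" "x' * y' = x * y" "(x * y) powi (k + int d) * x' = (x * y) powi k * x"
      using xy by (auto simp: W_point_eq_iff split: if_splits)
    then have "(x * y) ^ d * x' = x" using kn xy unfolding shift by (auto simp: mult.assoc)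
    then have 1: "x' * x ^ (d - 1) * y ^ d = 1"
      using xy unfolding pw by (simp add: algebra_simps)
    have "y' = x' * x ^ (d - 1) * y ^ d * y'" using 1 by simp
    also have "\<dots> = (x' * y') * (x ^ (d - 1) * y ^ d)" by (simp add: algebra_simps)
    also have "\<dots> = (x * x ^ (d - 1)) * y ^ Suc d" using L(3) by (simp add: algebra_simps)
    also have "\<dots> = x ^ d * y ^ Suc d" using xd by simp
    finally show ?R using 1 by simp
  next
    assume R: ?R
    then have nz: "x' \<noteq> 0" "y' \<noteq> 0" using xy by auto
    have "x' * y' = x' * ((x * x ^ (d - 1)) * y ^ Suc d)" using conjunct2[OF R] unfolding xd[symmetric] by (simp only:)
    also have "\<dots> = (x' * x ^ (d - 1) * y ^ d) * (x * y)"
      by (simp add: algebra_simps)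
    finally have 2: "x' * y' = x * y" unfolding conjunct1[OF R] by simp
    have "(x * y) ^ d * x' = x * (x' * x ^ (d - 1) * y ^ d)" unfolding pw by (simp add: algebra_simps)
    then have "(x * y) ^ d * x' = x" unfolding conjunct1[OF R] by simp
    then show ?L using nz xy 2 shift by (simp add: W_point_eq_iff mult.assoc)
  qed
next
  case False
  show ?thesis
  proof
    assume ?L
    then have "y \<noteq> 0" "x = 0" "d = 1" "x' = inverse y" "y' = 0"
      using False assms by (auto simp: W_point_eq_iff split: if_splits)
    then show ?R by simp
  next
    assume R: ?R
    then have "y \<noteq> 0" using assms by (auto simp: power_0_left)
    with False have "x = 0" by auto
    \<comment> \<open>For x = 0 the factor \<open>x ^ (d - 1)\<close> has to be
      \<open>0 ^ 0\<close>: on the axes only neighbouring charts meet.\<close>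
    with R have "d = 1" using assms by (cases "d = 1") (auto simp: power_0_left)
    with R \<open>x = 0\<close> \<open>y \<noteq> 0\<close> have "x' = inverse y" "y' = 0" by (auto simp: field_simps)
    with \<open>d = 1\<close> \<open>x = 0\<close> \<open>y \<noteq> 0\<close> show ?L by (simp add: W_point_eq_iff)
  qed
qed

section \<open>The functions w and x on W\<close>

definition nf_of :: "patch_point set \<Rightarrow> patch_point" where
  "nf_of P = normal_form (SOME p. P = W_point p)"

lemma nf_of_W_point [simp]: "nf_of (W_point p) = normal_form p"
  unfolding nf_of_def by (metis (mono_tags, lifting) W_point_eq_iff someI)

fun w_of_patch :: "patch_point \<Rightarrow> complex" where
  "w_of_patch (In_U k x y) = x * y"
| "w_of_patch (In_V w x) = w"

text \<open>The coordinate \<open>x\<close> is undefined on the curves \<open>w = 0\<close>; there \<open>x_of\<close> has the junk value \<open>0\<close>.\<close>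

fun x_of_patch :: "patch_point \<Rightarrow> complex" where
  "x_of_patch (In_U k x y) = 0"
| "x_of_patch (In_V w x) = x"

definition w_of :: "patch_point set \<Rightarrow> complex" where "w_of P = w_of_patch (nf_of P)"
definition x_of :: "patch_point set \<Rightarrow> complex" where "x_of P = x_of_patch (nf_of P)"

lemma w_of_simps [simp]: "w_of (U_pt k x y) = x * y" "w_of (V_pt w x) = w"
  by (auto simp: w_of_def)

lemma x_of_simps [simp]: "x_of (V_pt w x) = x"
  "x \<noteq> 0 \<Longrightarrow> y \<noteq> 0 \<Longrightarrow> x_of (U_pt k x y) = (x * y) powi k * x"
  by (auto simp: x_of_def)

lemma points_W_cases:
  assumes "P \<in> points W"
  obtains (V) w x where "w \<noteq> 0" "P = V_pt w x" | (C) k x where "P = U_pt k x 0"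
proof -
  obtain p where p: "p \<in> patch_points" "P = W_point p" using assms by (auto simp: W_def)
  have "W_point (normal_form p) = P"
    using p by (metis W_point_def equivclp_glued_normal_form equivclp_normal_form Collect_cong)
  moreover have "normal_form p \<in> patch_points" using p patch_points_normal_form by simp
  moreover have "y = 0" if "normal_form p = In_U k x y" for k x y
    using that by (cases p) (auto split: if_splits)
  ultimately show ?thesis using V C by (cases "normal_form p") auto
qed

lemma V_pt_coordinates:
  assumes "P \<in> points W" "w_of P \<noteq> 0"
  shows "P = V_pt (w_of P) (x_of P)"
  using assms(1) by (cases rule: points_W_cases) (use assms(2) in auto)

lemma w_of_eq_0_cases:
  assumes "P \<in> points W" "w_of P = 0"
  obtains k x where "P = U_pt k x 0"
  using assms(1) by (cases rule: points_W_cases) (use assms(2) that in auto)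

lemma w_of_eq_0_cases':
  assumes "P \<in> points W" "w_of P = 0"
  obtains k y where "P = U_pt k 0 y"
proof -
  obtain k x where P: "P = U_pt k x 0" using w_of_eq_0_cases assms by blast
  show ?thesis
  proof (cases "x = 0")
    case True then show ?thesis using P that by simp
  next
    case False
    then have "P = U_pt (k - 1) 0 (inverse x)" using P U_pt_Suc[of "inverse x" "k - 1" 0] by simp
    then show ?thesis by (rule that)
  qed
qed

section \<open>Toric maps of \<open>W\<close>\<close>

text \<open>On U_k this is the formula on V rewritten with x_k = w^(-k) x, which is why charts are
  shifted by j. The powers of \<gamma> and all automorphisms of S turn out to come from this one
  family.\<close>

fun toric_patch :: "complex \<Rightarrow> complex \<Rightarrow> int \<Rightarrow> patch_point \<Rightarrow> patch_point" where
  "toric_patch c a j (In_U k x y) =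
     In_U (k + j) (c powi (-(k + j)) * a * x) (c powi (k + j + 1) * inverse a * y)"
| "toric_patch c a j (In_V w x) = In_V (c * w) (a * w powi j * x)"

definition toric :: "complex \<Rightarrow> complex \<Rightarrow> int \<Rightarrow> patch_point set \<Rightarrow> patch_point set" where
  "toric c a j P = toric_patch c a j ` P"

lemma toric_patch_glued:
  assumes "c \<noteq> 0" "a \<noteq> 0" "glued p q"
  shows "glued (toric_patch c a j p) (toric_patch c a j q)"
  using assms(3)
proof cases
  case (UU y k x)
  define K where "K = k + j"
  have e: "k + 1 + j = K + 1" "k + j = K" by (auto simp: K_def)
  have 1: "c powi (-(K + 1)) * a * inverse y = inverse (c powi (K + 1) * inverse a * y)"
    by (simp only: power_int_minus inverse_mult_distrib inverse_inverse_eq)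
  have 2: "c powi (K + 1 + 1) * inverse a * (x * y\<^sup>2)
      = (c powi (-K) * a * x) * (c powi (K + 1) * inverse a * y)\<^sup>2"
    using assms by (simp add: power_int_minus power_int_add power2_eq_square field_simps)
  show ?thesis
    unfolding UU toric_patch.simps e 1 2
    by (rule glued.UU) (use assms UU in auto)
next
  case (UV x y k)
  define K where "K = k + j"
  define X Y where "X = c powi (-K) * a * x" and "Y = c powi (K + 1) * inverse a * y"
  have nz: "X \<noteq> 0" "Y \<noteq> 0" using assms UV by (auto simp: X_def Y_def)
  have 1: "c * (x * y) = X * Y" using assms
    by (simp add: X_def Y_def power_int_minus power_int_add field_simps)
  have "a * (x * y) powi j * (x powi (k + 1) * y powi k) = a * (x * y) powi j * ((x * y) powi k * x)"
    using x_coordinate UV by simp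
  also have "\<dots> = a * (x * y) powi K * x" using UV by (simp add: K_def power_int_add algebra_simps)
  also have "\<dots> = (c * (x * y)) powi K * X"
    using assms unfolding power_int_mult_distrib[of c] X_def by (simp add: power_int_minus field_simps)
  also have "\<dots> = X powi (K + 1) * Y powi K" using 1 x_coordinate[OF nz(1)] by simp
  finally have 2: "a * (x * y) powi j * (x powi (k + 1) * y powi k) = X powi (K + 1) * Y powi K" .
  show ?thesis
    unfolding UV toric_patch.simps 1 2 K_def[symmetric] X_def[symmetric] Y_def[symmetric]
    by (rule glued.UV[OF nz])
qed

lemma toric_patch_equivclp:
  assumes "c \<noteq> 0" "a \<noteq> 0" "equivclp glued p q"
  shows "equivclp glued (toric_patch c a j p) (toric_patch c a j q)"
  using assms(3)
proof (induction rule: equivclp_induct)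
  case (step y z)
  have "equivclp glued (toric_patch c a j y) (toric_patch c a j z)"
    using step(2)
  proof
    assume "glued y z"
    then show ?thesis by (intro r_into_equivclp toric_patch_glued assms(1,2))
  next
    assume "glued z y"
    then show ?thesis by (intro equivclp_sym[OF r_into_equivclp] toric_patch_glued assms(1,2))
  qed
  then show ?case by (rule equivclp_trans[OF step(3)])
qed simp

lemma toric_patch_in [simp]: "c \<noteq> 0 \<Longrightarrow> p \<in> patch_points \<Longrightarrow> toric_patch c a j p \<in> patch_points"
  by (cases p) auto

text \<open>The factor \<open>c' powi j\<close> arises because the outer monomial
  \<open>w powi j\<close> is evaluated at c' w.\<close>

lemma toric_patch_compose:
  assumes "c \<noteq> 0" "c' \<noteq> 0" "a \<noteq> 0" "a' \<noteq> 0" "p \<in> patch_points"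
  shows "toric_patch c a j (toric_patch c' a' j' p) = toric_patch (c * c') (a * a' * c' powi j) (j + j') p"
proof (cases p)
  case (In_U k x y)
  have 1: "(c * c') powi (-(k + (j + j'))) * (a * a' * c' powi j) =
     c powi (-(k + j' + j)) * a * (c' powi (-(k + j')) * a')"
    using assms unfolding power_int_mult_distrib
    by (simp add: power_int_minus power_int_add power_int_diff field_simps)
  have 2: "(c * c') powi (k + (j + j') + 1) * inverse (a * a' * c' powi j) =
     c powi (k + j' + j + 1) * inverse a * (c' powi (k + j' + 1) * inverse a')"
    using assms unfolding power_int_mult_distrib
    by (simp add: power_int_add field_simps)
  show ?thesis
    unfolding In_U toric_patch.simps 1 2 by (simp add: algebra_simps)
next
  case (In_V w x)
  then show ?thesis using assms
    by (simp add: power_int_mult_distrib power_int_add algebra_simps)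
qed

lemma toric_patch_id [simp]: "toric_patch 1 1 0 p = p"
  by (cases p) auto

lemma W_point_subset: "p \<in> patch_points \<Longrightarrow> W_point p \<subseteq> patch_points"
  unfolding W_point_def equivclp_glued_normal_form by clarsimp (metis patch_points_normal_form)

lemma toric_W_point:
  assumes "c \<noteq> 0" "a \<noteq> 0" "p \<in> patch_points"
  shows "toric c a j (W_point p) = W_point (toric_patch c a j p)"
proof
  show "toric c a j (W_point p) \<subseteq> W_point (toric_patch c a j p)"
    using toric_patch_equivclp[OF assms(1,2)] by (auto simp: toric_def W_point_def)
next
  \<comment> \<open>The inverse, found by solving the composition law for the identity; it shows
    that the image of a gluing class is a whole class.\<close>
  let ?i = "toric_patch (inverse c) (inverse a * c powi j) (-j)"
  have nz: "inverse c \<noteq> 0" "inverse a * c powi j \<noteq> 0" using assms by auto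
  have one: "inverse a * c powi j * a * inverse c powi j = 1" "a * (inverse a * c powi j) * inverse c powi j = 1"
    using assms by (simp_all add: power_int_inverse field_simps)
  have inv1: "?i (toric_patch c a j q) = q" if "q \<in> patch_points" for q
    using toric_patch_compose[OF nz(1) assms(1) nz(2) assms(2) that, of "-j" j] one(1) assms
    by (simp add: power_int_minus power_int_inverse)
  have inv2: "toric_patch c a j (?i q) = q" if "q \<in> patch_points" for q
    using toric_patch_compose[OF assms(1) nz(1) assms(2) nz(2) that, of j "-j"] one(2) assms
    by simp
  show "W_point (toric_patch c a j p) \<subseteq> toric c a j (W_point p)"
  proof
    fix q assume q: "q \<in> W_point (toric_patch c a j p)"
    have qp: "q \<in> patch_points" using q W_point_subset assms by (meson subsetD toric_patch_in)
    have "equivclp glued (?i (toric_patch c a j p)) (?i q)"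
      using q toric_patch_equivclp[OF nz] by (simp add: W_point_def)
    then have "?i q \<in> W_point p" using inv1[OF assms(3)] by (simp add: W_point_def)
    then show "q \<in> toric c a j (W_point p)"
      unfolding toric_def using inv2[OF qp] by (metis imageI)
  qed
qed

lemma toric_U_pt [simp]:
  "c \<noteq> 0 \<Longrightarrow> a \<noteq> 0 \<Longrightarrow> toric c a j (U_pt k x y) =
     U_pt (k + j) (c powi (-(k + j)) * a * x) (c powi (k + j + 1) * inverse a * y)"
  by (simp add: toric_W_point)

lemma toric_V_pt [simp]:
  "c \<noteq> 0 \<Longrightarrow> a \<noteq> 0 \<Longrightarrow> w \<noteq> 0 \<Longrightarrow> toric c a j (V_pt w x) = V_pt (c * w) (a * w powi j * x)"
  by (simp add: toric_W_point)

lemma toric_in_W [simp]: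
  assumes "c \<noteq> 0" "a \<noteq> 0" "P \<in> points W" shows "toric c a j P \<in> points W"
  using assms by (auto simp: W_def toric_W_point)

lemma toric_compose:
  assumes "c \<noteq> 0" "c' \<noteq> 0" "a \<noteq> 0" "a' \<noteq> 0" "P \<in> points W"
  shows "toric c a j (toric c' a' j' P) = toric (c * c') (a * a' * c' powi j) (j + j') P"
proof -
  obtain p where "p \<in> patch_points" "P = W_point p" using assms by (auto simp: W_def)
  then show ?thesis using assms by (simp add: toric_W_point toric_patch_compose)
qed

lemma toric_id [simp]: "toric 1 1 0 P = P"
  by (simp add: toric_def)

lemma w_of_toric [simp]:
  assumes "c \<noteq> 0" "a \<noteq> 0" "P \<in> points W"
  shows "w_of (toric c a j P) = c * w_of P"
  using assms(3) by (cases rule: points_W_cases) (use assms in auto)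

section \<open>The atlas of \<open>W\<close>\<close>

lemma charts_W: "charts W = insert ({v::complex^2. v $ 1 \<noteq> 0}, V_param) (range (\<lambda>k. (UNIV, U_param k)))"
  by (simp add: W_def)

lemma V_chart [simp]: "({v::complex^2. v $ 1 \<noteq> 0}, V_param) \<in> charts W"
  and U_chart [simp]: "(UNIV, U_param k) \<in> charts W"
  by (auto simp: charts_W)

lemma charts_W_cases:
  assumes "(D, \<phi>) \<in> charts W"
  obtains (V) "D = {v::complex^2. v $ 1 \<noteq> 0}" "\<phi> = V_param" | (U) k where "D = UNIV" "\<phi> = U_param k"
  using assms by (auto simp: charts_W)

lemma open_nth_neq_0: "open {v::complex^'n. v $ i \<noteq> 0}"
  by (rule open_Collect_neq) (intro continuous_intros)+

lemma charts_W_open: "(D, \<phi>) \<in> charts W \<Longrightarrow> open D"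
  by (auto simp: charts_W open_nth_neq_0)

lemma charts_W_in: "(D, \<phi>) \<in> charts W \<Longrightarrow> v \<in> D \<Longrightarrow> \<phi> v \<in> points W"
  by (auto simp: charts_W U_param_def V_param_def)

lemma charts_W_inj: "(D, \<phi>) \<in> charts W \<Longrightarrow> inj_on \<phi> D"
  by (auto simp: charts_W inj_on_def U_param_def V_param_def U_pt_inj vec_eq_iff forall_2)

lemma charts_W_cover:
  assumes "P \<in> points W"
  obtains D \<phi> v where "(D, \<phi>) \<in> charts W" "v \<in> D" "P = \<phi> v"
  using assms
proof (cases rule: points_W_cases)
  case (V w x)
  then show ?thesis by (intro that[OF V_chart, of "vec2 w x"]) (auto simp: V_param_def)
next
  case (C k x)
  then show ?thesis by (intro that[OF U_chart, of "vec2 x 0" k]) (auto simp: U_param_def)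
qed

lemma toric_chart:
  assumes "c \<noteq> 0" "a \<noteq> 0" "(D, \<phi>) \<in> charts W"
  shows "\<exists>\<phi>' \<delta>. (D, \<phi>') \<in> charts W \<and> holo_on \<delta> D \<and> \<delta> ` D \<subseteq> D \<and>
     (\<forall>v\<in>D. toric c a j (\<phi> v) = \<phi>' (\<delta> v))"
  using assms(3)
proof (cases rule: charts_W_cases)
  case V
  have "holo_on (\<lambda>v::complex^2. vec2 (c * v $ 1) (a * v $ 1 powi j * v $ 2)) D"
    using V by (intro holo_on_vec2 holo_at_mult holo_at_const holo_at_nth holo_at_power_int) auto
  then show ?thesis
    using assms V
    by (intro exI[of _ V_param] exI[of _ "\<lambda>v::complex^2. vec2 (c * v $ 1) (a * v $ 1 powi j * v $ 2)"])
       (auto simp: V_param_def)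
next
  case (U k)
  let ?\<delta> = "\<lambda>v::complex^2. vec2 (c powi (-(k + j)) * a * v $ 1) (c powi (k + j + 1) * inverse a * v $ 2)"
  have "holo_on ?\<delta> D"
    by (intro holo_on_vec2 holo_at_mult holo_at_const holo_at_nth)
  then show ?thesis
    using assms U by (intro exI[of _ "U_param (k + j)"] exI[of _ ?\<delta>]) (auto simp: U_param_def)
qed

text \<open>Where both coordinates are nonzero, a change between U-charts factors through V. On the
  axes only equal or neighbouring U-charts meet, and there the gluing formula or its inverse is the
  transition map.\<close>

lemma W_transition:
  assumes "(D, \<phi>) \<in> charts W" "(D', \<psi>) \<in> charts W" "v \<in> D" "v' \<in> D'" "\<phi> v = \<psi> v'"
  shows "\<exists>B \<tau>. open B \<and> v \<in> B \<and> B \<subseteq> D \<and> holo_on \<tau> B \<and> \<tau> ` B \<subseteq> D' \<and> (\<forall>u\<in>B. \<psi> (\<tau> u) = \<phi> u)"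
    (is "?T D \<phi> D' \<psi>")
proof -
  note intros = holo_on_vec2 holo_at_mult holo_at_const holo_at_nth holo_at_power_int holo_at_inverse
  have nz2: "open {v::complex^2. v $ 1 \<noteq> 0 \<and> v $ 2 \<noteq> 0}"
    by (intro open_Collect_conj open_nth_neq_0)
  have UV: "?T UNIV (U_param k) {v::complex^2. v $ 1 \<noteq> 0} V_param" if "v $ 1 \<noteq> 0" "v $ 2 \<noteq> 0" for k
    by (rule exI[of _ "{v::complex^2. v $ 1 \<noteq> 0 \<and> v $ 2 \<noteq> 0}"],
        rule exI[of _ "\<lambda>v::complex^2. vec2 (v $ 1 * v $ 2) ((v $ 1 * v $ 2) powi k * v $ 1)"])
       (use that nz2 in \<open>auto intro!: intros simp: U_param_def V_param_def U_pt_eq_V_pt\<close>)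
  have VU: "?T {v::complex^2. v $ 1 \<noteq> 0} V_param UNIV (U_param k)" if "v $ 1 \<noteq> 0" "v $ 2 \<noteq> 0" for k
    by (rule exI[of _ "{v::complex^2. v $ 1 \<noteq> 0 \<and> v $ 2 \<noteq> 0}"],
        rule exI[of _ "\<lambda>v::complex^2. vec2 (v $ 1 powi (-k) * v $ 2) (v $ 1 powi (k + 1) * inverse (v $ 2))"])
       (use that nz2 in \<open>auto intro!: intros simp: U_param_def V_param_def V_pt_eq_U_pt[symmetric]\<close>)
  show ?thesis
    using assms(1)
  proof (cases rule: charts_W_cases)
    case V
    note V1 = V
    show ?thesis using assms(2)
    proof (cases rule: charts_W_cases)
      case V
      show ?thesis
        using V V1 assms(3) open_nth_neq_0
        by (intro exI[of _ "{v::complex^2. v $ 1 \<noteq> 0}"] exI[of _ "\<lambda>v. v"]) auto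
    next
      case (U k)
      have "v $ 2 \<noteq> 0" "v $ 1 \<noteq> 0"
        using U_pt_eq_V_ptD[of k "v' $ 1" "v' $ 2" "v $ 1" "v $ 2"] assms V1 U by (auto simp: U_param_def V_param_def)
      then show ?thesis using VU V1 U by simp
    qed
  next
    case (U k)
    note U1 = U
    show ?thesis using assms(2)
    proof (cases rule: charts_W_cases)
      case V
      have "v $ 2 \<noteq> 0" "v $ 1 \<noteq> 0"
        using U_pt_eq_V_ptD[of k "v $ 1" "v $ 2" "v' $ 1" "v' $ 2"] assms V U1 by (auto simp: U_param_def V_param_def)
      then show ?thesis using UV V U1 by simp
    next
      case (U l)
      have eq: "U_pt k (v $ 1) (v $ 2) = U_pt l (v' $ 1) (v' $ 2)"
        using assms U U1 by (auto simp: U_param_def)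
      show ?thesis
      proof (cases "v $ 1 \<noteq> 0 \<and> v $ 2 \<noteq> 0")
        case True
        let ?\<tau> = "\<lambda>v::complex^2. vec2 ((v $ 1 * v $ 2) powi (-l) * ((v $ 1 * v $ 2) powi k * v $ 1))
          ((v $ 1 * v $ 2) powi (l + 1) * inverse ((v $ 1 * v $ 2) powi k * v $ 1))"
        have "U_param l (?\<tau> u) = U_param k u" if "u $ 1 \<noteq> 0" "u $ 2 \<noteq> 0" for u :: "complex^2"
          using that V_pt_eq_U_pt[of "u $ 1 * u $ 2" "(u $ 1 * u $ 2) powi k * u $ 1" l, symmetric]
            U_pt_eq_V_pt[OF that, of k]
          by (simp add: U_param_def)
        then show ?thesis
          using U U1 True nz2
          by (intro exI[of _ "{v::complex^2. v $ 1 \<noteq> 0 \<and> v $ 2 \<noteq> 0}"] exI[of _ ?\<tau>]) (auto intro!: intros)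
      next
        case False
        consider "l = k" | "l = k + 1" "v $ 2 \<noteq> 0" | "k = l + 1" "v $ 1 \<noteq> 0"
          using eq False by (auto simp: W_point_eq_iff split: if_splits)
        then show ?thesis
        proof cases
          case 1
          then show ?thesis using U U1 by (intro exI[of _ UNIV] exI[of _ "\<lambda>v. v"]) auto
        next
          case 2
          then show ?thesis using U U1 open_nth_neq_0[of 2] U_pt_Suc
            by (intro exI[of _ "{v::complex^2. v $ 2 \<noteq> 0}"] exI[of _ "\<lambda>v::complex^2. vec2 (inverse (v $ 2)) (v $ 1 * (v $ 2 * v $ 2))"])
              (auto intro!: intros simp: U_param_def power2_eq_square)
        next
          case 3
          have "U_param l (vec2 (u $ 2 * (u $ 1 * u $ 1)) (inverse (u $ 1))) = U_param k u" if "u $ 1 \<noteq> 0" for u :: "complex^2"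
          proof -
            have *: "u $ 2 * (u $ 1 * u $ 1) * (inverse (u $ 1) * inverse (u $ 1)) = u $ 2"
              using that by (simp add: field_simps)
            show ?thesis
            using that 3 U_pt_Suc[of "inverse (u $ 1)" l "u $ 2 * (u $ 1 * u $ 1)"] *
            by (simp add: U_param_def power2_eq_square)
          qed
          then show ?thesis using U U1 3 open_nth_neq_0[of 1]
            by (intro exI[of _ "{v::complex^2. v $ 1 \<noteq> 0}"] exI[of _ "\<lambda>v::complex^2. vec2 (v $ 2 * (v $ 1 * v $ 1)) (inverse (v $ 1))"])
              (auto intro!: intros)
        qed
      qed
    qed
  qed
qed

text \<open>With powers of \<gamma> this gives the transition germs of the quotient, with other
  parameters the holomorphy of induced maps of S. Injectivity of the target chart fixes the value of
  \<tau> at v.\<close>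

lemma toric_local:
  assumes ca: "c \<noteq> 0" "a \<noteq> 0"
    and d: "(D, \<phi>) \<in> charts W" "(D', \<psi>) \<in> charts W" "v \<in> D" "v' \<in> D'" "toric c a j (\<phi> v) = \<psi> v'"
  shows "\<exists>B \<tau>. open B \<and> v \<in> B \<and> B \<subseteq> D \<and> holo_on \<tau> B \<and> \<tau> ` B \<subseteq> D' \<and> \<tau> v = v' \<and>
     (\<forall>u\<in>B. toric c a j (\<phi> u) = \<psi> (\<tau> u))"
proof -
  obtain \<phi>' \<delta> where \<delta>: "(D, \<phi>') \<in> charts W" "holo_on \<delta> D" "\<delta> ` D \<subseteq> D"
     "\<And>v. v \<in> D \<Longrightarrow> toric c a j (\<phi> v) = \<phi>' (\<delta> v)"
    using toric_chart[OF ca d(1)] by metis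
  have v: "\<delta> v \<in> D" "\<phi>' (\<delta> v) = \<psi> v'" using \<delta> d by auto
  obtain B \<tau> where B: "open B" "\<delta> v \<in> B" "B \<subseteq> D" "holo_on \<tau> B" "\<tau> ` B \<subseteq> D'" "\<forall>u\<in>B. \<psi> (\<tau> u) = \<phi>' u"
    using W_transition[OF \<delta>(1) d(2) v(1) d(4) v(2)] by blast
  define T where "T = {u\<in>D. \<delta> u \<in> B}"
  have T: "open T" "v \<in> T" "T \<subseteq> D"
    unfolding T_def using holo_on_vimage_open[OF \<delta>(2) charts_W_open[OF d(1)] B(1)] B(2) d by auto
  have h: "holo_on (\<tau> \<circ> \<delta>) T"
    by (rule holo_on_compose[OF holo_on_subset[OF \<delta>(2) T(3)] B(4)]) (auto simp: T_def)
  have i: "(\<tau> \<circ> \<delta>) ` T \<subseteq> D'" using B(5) by (auto simp: T_def)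
  have e: "\<forall>u\<in>T. toric c a j (\<phi> u) = \<psi> ((\<tau> \<circ> \<delta>) u)"
    using B(6) \<delta>(4) T by (auto simp: T_def)
  then have "\<psi> ((\<tau> \<circ> \<delta>) v) = \<psi> v'" using T d by metis
  moreover have "(\<tau> \<circ> \<delta>) v \<in> D'" using i T by blast
  ultimately have "(\<tau> \<circ> \<delta>) v = v'"
    using charts_W_inj[OF d(2)] d(4) by (meson inj_onD)
  then show ?thesis using T h i e by blast
qed

section \<open>The surface as a quotient of \<open>W\<close>\<close>

text \<open>The exponent of \<alpha> collected by \<gamma>^n: the successive applications multiply x
  by \<open>(\<alpha> ^ i * w) ^ m\<close> for i < n, and these i sum to n(n-1)/2. The formula stays
  right for negative n.\<close>

definition triangular :: "int \<Rightarrow> int" where "triangular n = n * (n - 1) div 2"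

lemma triangular_add: "triangular (n + n') = triangular n + triangular n' + n * n'"
proof -
  have *: "2 * triangular k = k * (k - 1)" for k
    unfolding triangular_def by simp
  have "2 * triangular (n + n') = 2 * (triangular n + triangular n' + n * n')"
    using *[of "n + n'"] *[of n] *[of n'] by (simp add: algebra_simps)
  then show ?thesis by simp
qed

lemma triangular_simps [simp]: "triangular 0 = 0" "triangular 1 = 0"
  by (auto simp: triangular_def)

lemma triangular_nonneg: "triangular n \<ge> 0"
proof -
  have "n * (n - 1) \<ge> 0" by (cases "n \<ge> 1") (auto simp: mult_nonpos_nonpos)
  then show ?thesis by (simp add: triangular_def)
qed

locale parabolic_Inoue_data =
  fixes m :: nat and \<alpha> :: complex
  assumes m_pos: "m > 0" and \<alpha>_pos: "0 < norm \<alpha>" and \<alpha>_less_1: "norm \<alpha> < 1"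
begin

lemma \<alpha>_nonzero [simp]: "\<alpha> \<noteq> 0" using \<alpha>_pos by auto

lemma norm_\<alpha>_powi:
  "n \<ge> 1 \<Longrightarrow> norm (\<alpha> powi n) \<le> norm \<alpha>" "n \<le> -1 \<Longrightarrow> norm (\<alpha> powi n) \<ge> inverse (norm \<alpha>)"
proof -
  have *: "norm \<alpha> ^ k \<le> norm \<alpha>" if "k \<ge> 1" for k
    using power_decreasing[OF that, of "norm \<alpha>"] \<alpha>_less_1 by simp
  show "n \<ge> 1 \<Longrightarrow> norm (\<alpha> powi n) \<le> norm \<alpha>"
    using *[of "nat n"] by (simp add: power_int_def norm_power)
  show "n \<le> -1 \<Longrightarrow> norm (\<alpha> powi n) \<ge> inverse (norm \<alpha>)"
    using *[of "nat (-n)"] \<alpha>_pos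
    by (simp add: power_int_def norm_power norm_inverse power_inverse le_imp_inverse_le)
qed

text \<open>The norms of the powers of \<alpha> form a geometric progression, so a rough estimate of
  |w| identifies a deck transformation as trivial.\<close>

lemma \<alpha>_powi_near_1:
  assumes "norm \<alpha> < norm (\<alpha> powi n)" "norm (\<alpha> powi n) < inverse (norm \<alpha>)"
  shows "n = 0"
  using norm_\<alpha>_powi[of n] assms by linarith

lemma \<alpha>_powi_inj [simp]: "\<alpha> powi n = \<alpha> powi n' \<longleftrightarrow> n = n'"
proof
  assume *: "\<alpha> powi n = \<alpha> powi n'"
  have "\<alpha> powi (n - n') = 1" using * by (simp add: power_int_diff)
  then have "n - n' = 0"
    using \<alpha>_less_1 \<alpha>_pos by (intro \<alpha>_powi_near_1) (auto simp: one_less_inverse)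
  then show "n = n'" by simp
qed simp

definition gpow :: "int \<Rightarrow> patch_point set \<Rightarrow> patch_point set" where
  "gpow n = toric (\<alpha> powi n) (\<alpha> powi (int m * triangular n)) (int m * n)"

lemma gpow_in_W [simp]: "P \<in> points W \<Longrightarrow> gpow n P \<in> points W"
  by (simp add: gpow_def)

lemma gpow_0 [simp]: "gpow 0 P = P"
  by (simp add: gpow_def)

lemma gpow_gpow [simp]:
  assumes "P \<in> points W"
  shows "gpow n (gpow n' P) = gpow (n + n') P"
proof -
  \<comment> \<open>The cross term \<open>n * n'\<close> of \<open>triangular_add\<close>, times m,
    is the power of \<alpha> that appears when the monomial of \<gamma>^n is evaluated at the
    w-coordinate moved by \<gamma>^n'.\<close>
  have "\<alpha> powi (int m * triangular n) * \<alpha> powi (int m * triangular n') * (\<alpha> powi n') powi (int m * n)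
    = \<alpha> powi (int m * triangular (n + n'))"
    by (simp add: power_int_mult[symmetric] power_int_add[symmetric] triangular_add algebra_simps)
  then show ?thesis
    unfolding gpow_def using assms
    by (subst toric_compose) (auto simp: power_int_add distrib_left)
qed

lemma gamma_eq_gpow: "gamma m \<alpha> P = gpow 1 P"
proof -
  have "gamma_patch m \<alpha> p = toric_patch \<alpha> 1 (int m) p" for p
    by (cases p) auto
  then show ?thesis by (simp add: gamma_def gpow_def toric_def)
qed

lemma funpow_gamma: "P \<in> points W \<Longrightarrow> (gamma m \<alpha> ^^ n) P = gpow (int n) P"
  by (induction n) (auto simp: gamma_eq_gpow)

lemma orbit_rel_iff: "(P, Q) \<in> orbit_rel m \<alpha> \<longleftrightarrow> P \<in> points W \<and> (\<exists>n. Q = gpow n P)"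
proof
  assume *: "(P, Q) \<in> orbit_rel m \<alpha>"
  then have PQ: "P \<in> points W" "Q \<in> points W" and "\<exists>n. Q = (gamma m \<alpha> ^^ n) P \<or> P = (gamma m \<alpha> ^^ n) Q"
    by (auto simp: orbit_rel_def)
  then obtain n where "Q = gpow (int n) P \<or> P = gpow (int n) Q"
    by (auto simp only: funpow_gamma)
  with PQ show "P \<in> points W \<and> (\<exists>n. Q = gpow n P)"
    using gpow_gpow[of Q "- int n" "int n"] by (metis add.left_inverse gpow_0)
next
  assume "P \<in> points W \<and> (\<exists>n. Q = gpow n P)"
  then obtain n where P: "P \<in> points W" "Q = gpow n P" by blast
  show "(P, Q) \<in> orbit_rel m \<alpha>"
  proof (cases "n \<ge> 0")
    case True
    then show ?thesis using P funpow_gamma[of P "nat n"] by (auto simp: orbit_rel_def intro!: exI[of _ "nat n"])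
  next
    case False
    then show ?thesis using P funpow_gamma[of Q "nat (-n)"] by (auto simp: orbit_rel_def intro!: exI[of _ "nat (-n)"])
  qed
qed

lemma equiv_orbit_rel: "equiv (points W) (orbit_rel m \<alpha>)"
proof (rule equivI)
  show "refl_on (points W) (orbit_rel m \<alpha>)"
    unfolding refl_on_def orbit_rel_iff using gpow_0 by metis
  show "sym (orbit_rel m \<alpha>)"
  proof (rule symI)
    fix P Q assume "(P, Q) \<in> orbit_rel m \<alpha>"
    then obtain n where "P \<in> points W" "Q = gpow n P" by (auto simp: orbit_rel_iff)
    then show "(Q, P) \<in> orbit_rel m \<alpha>" by (auto simp: orbit_rel_iff intro!: exI[of _ "-n"])
  qed
  show "trans (orbit_rel m \<alpha>)"
  proof (rule transI)
    fix P Q R assume "(P, Q) \<in> orbit_rel m \<alpha>" "(Q, R) \<in> orbit_rel m \<alpha>"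
    then show "(P, R) \<in> orbit_rel m \<alpha>" by (auto simp: orbit_rel_iff)
  qed
qed (auto simp: orbit_rel_iff)

abbreviation pr :: "patch_point set \<Rightarrow> surface_point" where
  "pr P \<equiv> orbit_rel m \<alpha> `` {P}"

lemma pr_eq_iff:
  assumes "P \<in> points W" "Q \<in> points W"
  shows "pr P = pr Q \<longleftrightarrow> (\<exists>n. Q = gpow n P)"
  using eq_equiv_class_iff[OF equiv_orbit_rel assms] assms by (simp add: orbit_rel_iff)

lemma pr_gpow [simp]: "P \<in> points W \<Longrightarrow> pr (gpow n P) = pr P"
  using pr_eq_iff[of P "gpow n P"] by auto

lemma w_of_gpow [simp]: "P \<in> points W \<Longrightarrow> w_of (gpow n P) = \<alpha> powi n * w_of P"
  by (simp add: gpow_def)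

lemma gpow_V_pt: "w \<noteq> 0 \<Longrightarrow>
  gpow n (V_pt w x) = V_pt (\<alpha> powi n * w) (\<alpha> powi (int m * triangular n) * w powi (int m * n) * x)"
  by (simp add: gpow_def)

text \<open>The deck group acts freely: on V this is seen in w, and on the curves w = 0 in the chart
  index, which moves by m n.\<close>

lemma gpow_inj:
  assumes "P \<in> points W"
  shows "gpow n P = gpow n' P \<longleftrightarrow> n = n'"
proof
  assume eq: "gpow n P = gpow n' P"
  show "n = n'"
    using assms
  proof (cases rule: points_W_cases)
    case (V w x)
    then show ?thesis using arg_cong[OF eq, of w_of] by simp
  next
    case (C k x)
    then have "int m * n = int m * n'" using eq by (simp add: gpow_def W_point_eq_iff)
    then show ?thesis using m_pos by simp
  qed
qed simp

abbreviation S :: "(surface_point, 2) complex_mfd" where "S \<equiv> parabolic_Inoue m \<alpha>"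

lemma points_S: "points S = pr ` points W"
  by (auto simp: parabolic_Inoue_def quotient_mfd_def quotient_def)

section \<open>Local injectivity of the quotient map\<close>

lemma locally_injective_V:
  assumes d: "(D, \<phi>) \<in> charts W" "v \<in> D" "w_of (\<phi> v) \<noteq> 0"
    and cont: "continuous_on D (\<lambda>u. w_of (\<phi> u))"
  shows "\<exists>B. open B \<and> v \<in> B \<and> B \<subseteq> D \<and> inj_on (\<lambda>u. pr (\<phi> u)) B"
proof -
  \<comment> \<open>The radii r s and r / s have ratio 1/|\<alpha>|, so the annulus between them
    meets none of its nontrivial translates.\<close>
  define s where "s = sqrt (norm \<alpha>)"
  have s: "0 < s" "s < 1" "s * s = norm \<alpha>" using \<alpha>_pos \<alpha>_less_1 by (auto simp: s_def)
  define r where "r = norm (w_of (\<phi> v))"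
  have r: "r > 0" using d by (simp add: r_def)
  define B where "B = {u\<in>D. norm (w_of (\<phi> u)) \<in> {r * s<..<r / s}}"
  have "open ((\<lambda>u. norm (w_of (\<phi> u))) -` {r * s<..<r / s} \<inter> D)"
    using cont charts_W_open[OF d(1)] by (intro continuous_on_open_vimage[THEN iffD1, rule_format] continuous_intros) auto
  moreover have "(\<lambda>u. norm (w_of (\<phi> u))) -` {r * s<..<r / s} \<inter> D = B" by (auto simp: B_def)
  ultimately have "open B" by simp
  moreover have "v \<in> B" using d r s by (auto simp: B_def r_def[symmetric] field_simps)
  moreover have "inj_on (\<lambda>u. pr (\<phi> u)) B"
  proof (rule inj_onI)
    fix u u' assume u: "u \<in> B" "u' \<in> B" "pr (\<phi> u) = pr (\<phi> u')"
    have D: "u \<in> D" "u' \<in> D" using u by (auto simp: B_def)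
    then obtain n where n: "\<phi> u' = gpow n (\<phi> u)"
      using u pr_eq_iff charts_W_in[OF d(1)] by blast
    define b where "b = norm (w_of (\<phi> u))"
    have b: "r * s < b" "b < r / s" using u by (auto simp: B_def b_def)
    have b': "r * s < norm (\<alpha> powi n) * b" "norm (\<alpha> powi n) * b < r / s"
      using u charts_W_in[OF d(1) D(1)] by (auto simp: B_def n b_def norm_mult)
    have b0: "b > 0" using b(1) r s by (meson mult_pos_pos order_less_trans)
    have "norm \<alpha> * b < r * s" using b s by (simp add: field_simps flip: s(3))
    with b' b0 have 1: "norm \<alpha> < norm (\<alpha> powi n)" by (smt (verit) mult_right_less_imp_less)
    have "norm \<alpha> * (norm (\<alpha> powi n) * b) < r * s"
      using b'(2) s by (simp add: field_simps flip: s(3))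
    then have "norm \<alpha> * norm (\<alpha> powi n) * b < 1 * b" using b by simp
    then have "norm \<alpha> * norm (\<alpha> powi n) < 1" using b0 by (simp only: mult_less_cancel_right_disj) auto
    then have "norm (\<alpha> powi n) < inverse (norm \<alpha>)" using \<alpha>_pos by (simp add: field_simps)
    with 1 have "n = 0" by (rule \<alpha>_powi_near_1)
    then have "\<phi> u' = \<phi> u" using n by simp
    then show "u = u'" using charts_W_inj[OF d(1)] D by (metis inj_onD)
  qed
  ultimately show ?thesis by (intro exI[of _ B]) (auto simp: B_def)
qed

text \<open>If \<open>\<gamma>\<^sup>n\<close>, \<open>n \<ge> 1\<close>, maps \<open>(x, y)\<close> to \<open>(x', y')\<close> within one chart \<open>U\<^sub>k\<close>, then \<open>\<alpha>\<^sup>F x\<^sup>d y\<^sup>d\<^sup>-\<^sup>1 y' = 1\<close>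
  with \<open>d = mn\<close> and a suitable exponent \<open>F\<close>; this fails on small polydiscs.\<close>

lemma gpow_U_pt_disjoint:
  assumes n: "n \<ge> 1" and rR: "0 < r" "0 < R" "r * R \<le> norm \<alpha> ^ nat (\<bar>k\<bar> + 1)"
    and b: "norm x < r" "norm y < R" "norm x' < r" "norm y' < R"
  shows "U_pt k x' y' \<noteq> gpow n (U_pt k x y)"
proof
  define a where "a = norm \<alpha>"
  have a: "0 < a" "a < 1" using \<alpha>_pos \<alpha>_less_1 by (auto simp: a_def)
  define d where "d = nat (int m * n)"
  have d: "d \<ge> 1" "int d = int m * n" using n m_pos
    by (auto simp: d_def nat_le_iff Suc_le_eq)
  define X where "X = (\<alpha> powi n) powi (-(k + int m * n)) * \<alpha> powi (int m * triangular n) * x"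
  assume eq: "U_pt k x' y' = gpow n (U_pt k x y)"
  then have e: "X * x' ^ (d - 1) * y' ^ d = 1"
    using U_pt_eq_U_pt[OF d(1), of k x' y' X] d(2) by (auto simp: gpow_def X_def)
  \<comment> \<open>Comparing w on both sides eliminates x' and leaves one monomial relation between
    x, y and y'.\<close>
  have "x' * y' = \<alpha> powi n * (x * y)"
    using arg_cong[OF eq, of w_of] by simp
  moreover have "x' ^ (d - 1) * y' ^ d = (x' * y') ^ (d - 1) * y'"
    using d(1) by (cases d) (auto simp: power_mult_distrib)
  ultimately have e': "X * ((\<alpha> powi n * (x * y)) ^ (d - 1) * y') = 1"
    using e by (simp add: mult.assoc)
  define F where "F = n * (-(k + int m * n)) + int m * triangular n + n * (int m * n - 1)"
  have "(\<alpha> powi n * (x * y)) ^ (d - 1) = \<alpha> powi (n * (int m * n - 1)) * (x * y) ^ (d - 1)"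
  proof -
    have "(\<alpha> powi n) ^ (d - 1) = \<alpha> powi (n * int (d - 1))"
      by (simp add: power_int_mult)
    also have "int (d - 1) = int m * n - 1" using d by simp
    finally show ?thesis by (simp add: power_mult_distrib)
  qed
  with e' have "\<alpha> powi F * (x * (x * y) ^ (d - 1) * y') = 1"
    unfolding F_def X_def power_int_mult[symmetric] by (simp add: power_int_add ac_simps)
  also have "x * (x * y) ^ (d - 1) * y' = x ^ d * y ^ (d - 1) * y'"
    using d(1) by (cases d) (auto simp: power_mult_distrib)
  finally have e2: "\<alpha> powi F * (x ^ d * y ^ (d - 1) * y') = 1" .
  then have "x \<noteq> 0" using d(1) by (auto simp: power_0_left)
  have "1 = a powi F * (norm x ^ d * (norm y ^ (d - 1) * norm y'))"
    using arg_cong[OF e2, of norm] by (simp add: norm_mult norm_power norm_power_int a_def mult.assoc)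
  also have "\<dots> < a powi F * (r ^ d * (R ^ (d - 1) * R))"
  proof (rule mult_strict_left_mono, rule mult_le_less_imp_less)
    show "norm x ^ d \<le> r ^ d" using b by (intro power_mono) auto
    have "norm y ^ (d - 1) * norm y' \<le> R ^ (d - 1) * norm y'"
      using b by (intro mult_right_mono power_mono) auto
    also have "\<dots> < R ^ (d - 1) * R" using b rR by (intro mult_strict_left_mono) auto
    finally show "norm y ^ (d - 1) * norm y' < R ^ (d - 1) * R" .
  qed (use \<open>x \<noteq> 0\<close> a in auto)
  also have "r ^ d * (R ^ (d - 1) * R) = (r * R) ^ d"
    using d(1) by (cases d) (auto simp: power_mult_distrib)
  also have "a powi F * (r * R) ^ d \<le> a powi F * (a ^ nat (\<bar>k\<bar> + 1)) ^ d"
    using rR a by (intro mult_left_mono power_mono) (auto simp: a_def)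
  also have "(a ^ nat (\<bar>k\<bar> + 1)) ^ d = a powi ((\<bar>k\<bar> + 1) * (int m * n))"
  proof -
    have "a powi ((\<bar>k\<bar> + 1) * int d) = (a ^ nat (\<bar>k\<bar> + 1)) ^ d"
      unfolding power_int_mult by (simp add: power_int_def)
    then show ?thesis using d(2) by simp
  qed
  also have "a powi F * a powi ((\<bar>k\<bar> + 1) * (int m * n)) = a powi (F + (\<bar>k\<bar> + 1) * (int m * n))"
    using a by (simp add: power_int_add)
  finally have *: "1 < a powi (F + (\<bar>k\<bar> + 1) * (int m * n))" .
  \<comment> \<open>This is the origin of the bound on \<open>r * R\<close>: the exponent
    \<open>(\<bar>k\<bar> + 1) * (int m * n)\<close> that it contributes outweighs
    \<open>n * (k + 1)\<close>, the only part that can make F negative.\<close>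
  have "F = int m * triangular n - n * (k + 1)"
    by (simp add: F_def algebra_simps)
  moreover have "n * (k + 1) \<le> (\<bar>k\<bar> + 1) * (int m * n)"
  proof -
    have "n * (k + 1) \<le> n * (\<bar>k\<bar> + 1)" using n by (intro mult_left_mono) auto
    also have "\<dots> \<le> int m * (n * (\<bar>k\<bar> + 1))"
      using m_pos n mult_right_mono[of 1 "int m" "n * (\<bar>k\<bar> + 1)"] by simp
    finally show ?thesis by (simp add: algebra_simps)
  qed
  moreover have "int m * triangular n \<ge> 0" using triangular_nonneg[of n] by simp
  ultimately have "F + (\<bar>k\<bar> + 1) * (int m * n) \<ge> 0" by linarith
  then have "a powi (F + (\<bar>k\<bar> + 1) * (int m * n)) \<le> 1"
    using a by (simp add: power_int_def power_le_one)
  with * show False by simp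
qed

lemma locally_injective_U:
  assumes xy: "x * y = 0"
  shows "\<exists>B. open B \<and> vec2 x y \<in> B \<and> inj_on (\<lambda>u. pr (U_param k u)) B"
proof -
  define e where "e = norm \<alpha> ^ nat (\<bar>k\<bar> + 1)"
  have e: "e > 0" using \<alpha>_pos by (simp add: e_def)
  \<comment> \<open>One of x and y is zero, so the radius in that direction can shrink until
    \<open>r * R\<close> is small enough.\<close>
  obtain r R where rR: "0 < r" "0 < R" "r * R \<le> e" "norm x < r" "norm y < R"
  proof (cases "y = 0")
    case True
    have "norm x + 1 > 0" by (simp add: add_nonneg_pos)
    with True e show ?thesis by (intro that[of "norm x + 1" "e / (norm x + 1)"]) auto
  next
    case False
    have "norm y + 1 > 0" by (simp add: add_nonneg_pos)
    with False e xy show ?thesis by (intro that[of "e / (norm y + 1)" "norm y + 1"]) auto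
  qed
  define B where "B = {u::complex^2. norm (u $ 1) < r \<and> norm (u $ 2) < R}"
  have "open B" unfolding B_def by (intro open_Collect_conj open_Collect_less continuous_intros)
  moreover have "vec2 x y \<in> B" using rR by (simp add: B_def)
  moreover have "inj_on (\<lambda>u. pr (U_param k u)) B"
  proof (rule inj_onI)
    fix u u' :: "complex^2" assume u: "u \<in> B" "u' \<in> B" "pr (U_param k u) = pr (U_param k u')"
    have *: "\<not> n \<ge> 1" if "U_pt k (v' $ 1) (v' $ 2) = gpow n (U_pt k (v $ 1) (v $ 2))"
      "v \<in> B" "v' \<in> B" for n and v v' :: "complex^2"
      using gpow_U_pt_disjoint[OF _ rR(1,2) rR(3)[unfolded e_def], of n "v $ 1" "v $ 2" "v' $ 1" "v' $ 2"] that
      by (auto simp: B_def)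
    obtain n where n: "U_pt k (u' $ 1) (u' $ 2) = gpow n (U_pt k (u $ 1) (u $ 2))"
      using u(3) by (auto simp: U_param_def pr_eq_iff)
    \<comment> \<open>\<open>gpow_U_pt_disjoint\<close> speaks of positive n; exchanging the two
      points covers negative n.\<close>
    then have "U_pt k (u $ 1) (u $ 2) = gpow (-n) (U_pt k (u' $ 1) (u' $ 2))" by simp
    with n * u have "\<not> n \<ge> 1" "\<not> -n \<ge> 1" by blast+
    then have "n = 0" by simp
    then show "u = u'" using n by (simp add: U_pt_inj vec_eq_iff forall_2)
  qed
  ultimately show ?thesis by blast
qed

lemma holo_at_w_of_chart:
  assumes "(D, \<phi>) \<in> charts W" "v \<in> D"
  shows "holo_at (\<lambda>u. w_of (\<phi> u)) v"
  using assms(1)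
  by (cases rule: charts_W_cases)
     (auto simp: U_param_def V_param_def intro!: holo_at_mult holo_at_nth)

lemma continuous_on_w_of_chart:
  assumes "(D, \<phi>) \<in> charts W"
  shows "continuous_on D (\<lambda>u. w_of (\<phi> u))"
  using holo_at_w_of_chart[OF assms] holo_at_continuous continuous_at_imp_continuous_on by blast

lemma locally_injective:
  assumes "(D, \<phi>) \<in> charts W" "v \<in> D"
  shows "\<exists>B. open B \<and> v \<in> B \<and> B \<subseteq> D \<and> inj_on (\<lambda>u. pr (\<phi> u)) B"
proof (cases "w_of (\<phi> v) = 0")
  case False
  then show ?thesis using locally_injective_V[OF assms _ continuous_on_w_of_chart[OF assms(1)]] by simp
next
  case True
  from assms(1) show ?thesis
  proof (cases rule: charts_W_cases)
    case V
    with True assms show ?thesis by (simp add: V_param_def)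
  next
    case (U k)
    with True have "v $ 1 * v $ 2 = 0" by (simp add: U_param_def)
    from locally_injective_U[OF this, of k] show ?thesis using U by simp
  qed
qed

lemma orbit_local:
  assumes "(D, \<phi>) \<in> charts W" "(D', \<psi>) \<in> charts W" "v \<in> D" "v' \<in> D'" "(\<phi> v, \<psi> v') \<in> orbit_rel m \<alpha>"
  shows "\<exists>B \<tau>. open B \<and> v \<in> B \<and> B \<subseteq> D \<and> holo_on \<tau> B \<and> \<tau> ` B \<subseteq> D' \<and> \<tau> v = v' \<and>
         (\<forall>u\<in>B. (\<phi> u, \<psi> (\<tau> u)) \<in> orbit_rel m \<alpha>)"
proof -
  obtain n where n: "gpow n (\<phi> v) = \<psi> v'" using assms(5) by (auto simp: orbit_rel_iff)
  have c: "\<alpha> powi n \<noteq> 0" "\<alpha> powi (int m * triangular n) \<noteq> 0" by auto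
  obtain B \<tau> where B: "open B" "v \<in> B" "B \<subseteq> D" "holo_on \<tau> B" "\<tau> ` B \<subseteq> D'" "\<tau> v = v'"
    "\<forall>u\<in>B. gpow n (\<phi> u) = \<psi> (\<tau> u)"
    using toric_local[OF c assms(1-4) n[unfolded gpow_def]] unfolding gpow_def[symmetric] by blast
  have "(\<phi> u, \<psi> (\<tau> u)) \<in> orbit_rel m \<alpha>" if "u \<in> B" for u
    unfolding orbit_rel_iff using charts_W_in[OF assms(1)] B(3,7) that by fastforce
  then show ?thesis using B by blast
qed

lemma compatible_atlas_S: "compatible_atlas S"
  unfolding parabolic_Inoue_def
proof (rule compatible_atlas_quotient[OF _ _ equiv_orbit_rel])
  show "open D \<and> \<phi> ` D \<subseteq> points W" if "(D, \<phi>) \<in> charts W" for D \<phi>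
    using that charts_W_open charts_W_in by blast
  show "\<exists>(D, \<phi>)\<in>charts W. p \<in> \<phi> ` D" if "p \<in> points W" for p
    using charts_W_cover[OF that] by (metis (mono_tags, lifting) case_prodI image_eqI)
  show "\<exists>B. open B \<and> v \<in> B \<and> B \<subseteq> D \<and> inj_on (\<lambda>u. pr (\<phi> u)) B"
    if "(D, \<phi>) \<in> charts W" "v \<in> D" for D \<phi> v using locally_injective[OF that] .
qed (use orbit_local in auto)

lemma charts_S: "(D, \<phi>) \<in> charts S \<longleftrightarrow>
  (\<exists>D0 \<phi>0. \<phi> = (\<lambda>v. pr (\<phi>0 v)) \<and> (D0, \<phi>0) \<in> charts W \<and> open D \<and> D \<subseteq> D0 \<and> inj_on (\<lambda>v. pr (\<phi>0 v)) D)"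
  by (auto simp: parabolic_Inoue_def quotient_mfd_def)

section \<open>The complement of the cycle\<close>

lemma w_of_Ctilde: "P \<in> Ctilde i \<Longrightarrow> P \<in> points W \<and> w_of P = 0"
  by (auto simp: Ctilde_def)

lemma Inoue_cycle_eq: "Inoue_cycle m \<alpha> = pr ` {P \<in> points W. w_of P = 0}"
proof
  show "Inoue_cycle m \<alpha> \<subseteq> pr ` {P \<in> points W. w_of P = 0}"
    using w_of_Ctilde by (fastforce simp: Inoue_cycle_def Inoue_C_def)
next
  show "pr ` {P \<in> points W. w_of P = 0} \<subseteq> Inoue_cycle m \<alpha>"
  proof clarify
    fix P assume P: "P \<in> points W" "w_of P = 0"
    obtain k x where k: "P = U_pt k x 0" using w_of_eq_0_cases[OF P] by blast
    \<comment> \<open>Shifts k into the range 1, ..., m; the offset \<open>k - 1\<close> accounts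
      for a numbering that starts at 1.\<close>
    define n where "n = - ((k - 1) div int m)"
    define l where "l = k + int m * n"
    have l: "l = (k - 1) mod int m + 1"
      unfolding l_def n_def by (simp add: minus_div_mult_eq_mod [symmetric] algebra_simps)
    have "0 \<le> (k - 1) mod int m" "(k - 1) mod int m < int m" using m_pos by simp_all
    then have "l \<in> {1..int m}" unfolding l by simp
    moreover have "gpow n P \<in> Ctilde l" by (auto simp: k gpow_def Ctilde_def l_def)
    moreover have "pr P = pr (gpow n P)" using P by simp
    ultimately show "pr P \<in> Inoue_cycle m \<alpha>"
      unfolding Inoue_cycle_def Inoue_C_def by blast
  qed
qed

lemma pr_in_cycle: "P \<in> points W \<Longrightarrow> pr P \<in> Inoue_cycle m \<alpha> \<longleftrightarrow> w_of P = 0"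
  unfolding Inoue_cycle_eq using pr_eq_iff by (fastforce simp: image_iff)

abbreviation U :: "(surface_point, 2) complex_mfd" where "U \<equiv> Inoue_U m \<alpha>"

lemma points_U: "points U = points S - Inoue_cycle m \<alpha>"
  by (simp add: Inoue_U_def open_submfd_def)

lemma pr_in_U: "P \<in> points W \<Longrightarrow> pr P \<in> points U \<longleftrightarrow> w_of P \<noteq> 0"
  using pr_in_cycle by (auto simp: points_U points_S)

section \<open>Bundle coordinates on U\<close>

abbreviation upt :: "complex \<Rightarrow> complex \<Rightarrow> surface_point" where "upt \<equiv> U_point m \<alpha>"

lemma upt_pr: "upt w x = pr (V_pt w x)"
  by (simp add: U_point_def)

lemma upt_in_U [simp]: "w \<noteq> 0 \<Longrightarrow> upt w x \<in> points U"
  and upt_in_S [simp]: "w \<noteq> 0 \<Longrightarrow> upt w x \<in> points S"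
  by (auto simp: upt_pr pr_in_U points_S)

lemma points_U_cases:
  assumes "p \<in> points U" obtains w x where "w \<noteq> 0" "p = upt w x"
proof -
  obtain P where P: "P \<in> points W" "p = pr P" using assms by (auto simp: points_U points_S)
  then have "w_of P \<noteq> 0" using assms pr_in_U by blast
  then show ?thesis using that V_pt_coordinates[OF P(1)] P(2) by (metis upt_pr)
qed

lemma upt_eq_iff:
  assumes "w \<noteq> 0" "w' \<noteq> 0"
  shows "upt w x = upt w' x' \<longleftrightarrow>
    (\<exists>n. w' = \<alpha> powi n * w \<and> x' = \<alpha> powi (int m * triangular n) * w powi (int m * n) * x)"
  using assms by (simp add: upt_pr pr_eq_iff gpow_V_pt)

lemma upt_eq_iff_same [simp]: "w \<noteq> 0 \<Longrightarrow> upt w x = upt w x' \<longleftrightarrow> x = x'"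
proof
  assume w: "w \<noteq> 0" and "upt w x = upt w x'"
  then obtain n where n: "w = \<alpha> powi n * w" "x' = \<alpha> powi (int m * triangular n) * w powi (int m * n) * x"
    using upt_eq_iff by blast
  then have "\<alpha> powi n = \<alpha> powi 0" using w by simp
  then have "n = 0" unfolding \<alpha>_powi_inj .
  then show "x = x'" using n by simp
qed simp

lemma upt_gamma: "w \<noteq> 0 \<Longrightarrow> upt (\<alpha> * w) (w ^ m * x) = upt w x"
  using upt_eq_iff[of w "\<alpha> * w" x "w ^ m * x"] by (auto intro!: exI[of _ 1])

lemma upt_gpow: "w \<noteq> 0 \<Longrightarrow> upt (\<alpha> powi n * w) (\<alpha> powi (int m * triangular n) * w powi (int m * n) * x) = upt w x"
  using upt_eq_iff[of w "\<alpha> powi n * w" x] by auto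

lemma openin_points_U: "openin (mfd_topology S) (points U)"
  unfolding openin_mfd_topology
proof (intro conjI; clarify?)
  show "p \<in> points S" if "p \<in> points U" for p using that by (simp add: points_U)
next
  fix D \<phi> assume "(D, \<phi>) \<in> charts S"
  then obtain D0 \<phi>0 where d: "\<phi> = (\<lambda>v. pr (\<phi>0 v))" "(D0, \<phi>0) \<in> charts W" "open D" "D \<subseteq> D0"
    by (auto simp: charts_S)
  have "{v \<in> D. \<phi> v \<in> points U} = {v\<in>D. w_of (\<phi>0 v) \<noteq> 0}"
    using d charts_W_in[OF d(2)] pr_in_U by auto
  moreover have "open ((\<lambda>v. w_of (\<phi>0 v)) -` (- {0}) \<inter> D)"
    using continuous_on_subset[OF continuous_on_w_of_chart[OF d(2)] d(4)] d(3)
    by (intro continuous_on_open_vimage[THEN iffD1, rule_format]) auto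
  moreover have "(\<lambda>v. w_of (\<phi>0 v)) -` (- {0}) \<inter> D = {v\<in>D. w_of (\<phi>0 v) \<noteq> 0}" by auto
  ultimately show "open {v \<in> D. \<phi> v \<in> points U}" by simp
qed

lemma compatible_atlas_U: "compatible_atlas U"
  using compatible_atlas_open_submfd[OF compatible_atlas_S openin_points_U]
  by (simp add: Inoue_U_def open_submfd_def)

lemma charts_U: "(D, \<phi>) \<in> charts U \<longleftrightarrow> (\<exists>D1. D = {v\<in>D1. \<phi> v \<in> points U} \<and> (D1, \<phi>) \<in> charts S)"
  by (auto simp: Inoue_U_def open_submfd_def)

section \<open>The elliptic curve\<close>

abbreviation E :: "(surface_point, 1) complex_mfd" where "E \<equiv> Inoue_E m \<alpha>"
abbreviation ept :: "complex \<Rightarrow> surface_point" where "ept \<equiv> E_point m \<alpha>"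

lemma ept_pr: "ept w = pr (V_pt w 0)"
  by (simp add: E_point_def upt_pr)

lemma points_E: "points E = {ept w | w. w \<noteq> 0}"
  by (auto simp: Inoue_E_def quotient_mfd_def quotient_def Etilde_def ept_pr)

lemma ept_eq_iff: "w \<noteq> 0 \<Longrightarrow> w' \<noteq> 0 \<Longrightarrow> ept w = ept w' \<longleftrightarrow> (\<exists>n. w' = \<alpha> powi n * w)"
  by (simp add: E_point_def upt_eq_iff)

lemma compatible_atlas_E: "compatible_atlas E"
  unfolding Inoue_E_def
proof (rule compatible_atlas_quotient[OF _ _ equiv_orbit_rel])
  have o: "open {v::complex^1. v $ 1 \<noteq> 0}" by (rule open_nth_neq_0)
  show "open D \<and> \<phi> ` D \<subseteq> points Etilde" if "(D, \<phi>) \<in> charts Etilde" for D \<phi>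
    using that o by (auto simp: Etilde_def)
  show "\<exists>(D, \<phi>)\<in>charts Etilde. p \<in> \<phi> ` D" if p: "p \<in> points Etilde" for p
  proof -
    obtain w where "p = V_pt w 0" "w \<noteq> 0" using p by (auto simp: Etilde_def)
    then have "p \<in> (\<lambda>v::complex^1. V_pt (v $ 1) 0) ` {v. v $ 1 \<noteq> 0}"
      by (intro image_eqI[of _ _ "\<chi> i. w"]) auto
    then show ?thesis by (auto simp: Etilde_def)
  qed
  show "points Etilde \<subseteq> points W" by (auto simp: Etilde_def)
  show "\<exists>B. open B \<and> v \<in> B \<and> B \<subseteq> D \<and> inj_on (\<lambda>u. pr (\<phi> u)) B"
    if "(D, \<phi>) \<in> charts Etilde" "v \<in> D" for D \<phi> v
  proof -
    have d: "D = {v::complex^1. v $ 1 \<noteq> 0}" "\<phi> = (\<lambda>v. V_pt (v $ 1) 0)"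
      using that by (auto simp: Etilde_def)
    let ?f = "\<lambda>v::complex^1. vec2 (v $ 1) 0"
    \<comment> \<open>Local injectivity on E is inherited from the chart V along the zero section w
      -> (w, 0).\<close>
    have "\<exists>B. open B \<and> ?f v \<in> B \<and> B \<subseteq> {v::complex^2. v $ 1 \<noteq> 0} \<and> inj_on (\<lambda>u. pr (V_param u)) B"
      by (rule locally_injective) (use that d in auto)
    then obtain B where B: "open B" "?f v \<in> B" "B \<subseteq> {v::complex^2. v $ 1 \<noteq> 0}" "inj_on (\<lambda>u. pr (V_param u)) B"
      by blast
    have "continuous_on UNIV ?f" by (intro continuous_intros)
    then have "open (?f -` B)" using B(1) by (simp add: continuous_on_open_vimage)
    moreover have "inj_on (\<lambda>u. pr (\<phi> u)) (?f -` B)"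
    proof (rule inj_onI)
      fix u u' assume "u \<in> ?f -` B" "u' \<in> ?f -` B" "pr (\<phi> u) = pr (\<phi> u')"
      then have "?f u = ?f u'" using inj_onD[OF B(4), of "?f u" "?f u'"] d by (simp add: V_param_def)
      then have "u $ 1 = u' $ 1" by (simp only: vec2_eq_iff)
      then show "u = u'" by (simp add: vec_eq_iff forall_1)
    qed
    ultimately show ?thesis using B d by (intro exI[of _ "?f -` B"]) auto
  qed
  show "\<exists>B \<tau>. open B \<and> v \<in> B \<and> B \<subseteq> D \<and> holo_on \<tau> B \<and> \<tau> ` B \<subseteq> D' \<and> \<tau> v = v' \<and>
         (\<forall>u\<in>B. (\<phi> u, \<psi> (\<tau> u)) \<in> orbit_rel m \<alpha>)"
    if a: "(D, \<phi>) \<in> charts Etilde" "(D', \<psi>) \<in> charts Etilde" "v \<in> D" "v' \<in> D'"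
      "(\<phi> v, \<psi> v') \<in> orbit_rel m \<alpha>" for D \<phi> D' \<psi> v v'
  proof -
    have d: "D = {v::complex^1. v $ 1 \<noteq> 0}" "\<phi> = (\<lambda>v. V_pt (v $ 1) 0)" "D' = D" "\<psi> = \<phi>"
      using a by (auto simp: Etilde_def)
    obtain n where n: "v' $ 1 = \<alpha> powi n * v $ 1"
      using a d by (auto simp: orbit_rel_iff gpow_V_pt)
    have "(\<phi> u, \<psi> (\<alpha> powi n *s u)) \<in> orbit_rel m \<alpha>" if "u \<in> D" for u
      using that d by (auto simp: orbit_rel_iff gpow_V_pt)
    then show ?thesis using d a(3) n o
      by (intro exI[of _ D] exI[of _ "(*s) (\<alpha> powi n)"]) (auto simp: holo_on_scale vec_eq_iff forall_1)
  qed
qed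

end

section \<open>Sections of torsors over a Euclidean space\<close>

text \<open>Sections are glued over a union of two convex sets, which need not be convex. The
  Minkowski sum of K and a small ball is convex and still fits inside.\<close>

lemma compact_convex_open_nbhd:
  fixes K :: "'a::euclidean_space set"
  assumes "compact K" "convex K" "open A" "K \<subseteq> A"
  obtains C where "open C" "convex C" "K \<subseteq> C" "C \<subseteq> A"
proof -
  obtain e where e: "e > 0" "(\<Union>x\<in>K. ball x e) \<subseteq> A"
    using compact_subset_open_imp_ball_epsilon_subset[OF assms(1,3,4)] .
  have eq: "(\<Union>x\<in>K. ball x e) = (\<Union>x\<in>K. \<Union>y\<in>ball 0 e. {x + y})"
  proof (intro equalityI subsetI)
    fix z assume "z \<in> (\<Union>x\<in>K. ball x e)"
    then obtain x where "x \<in> K" "dist x z < e" by auto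
    then have "z = x + (z - x)" "z - x \<in> ball 0 e" by (auto simp: dist_norm norm_minus_commute)
    with \<open>x \<in> K\<close> show "z \<in> (\<Union>x\<in>K. \<Union>y\<in>ball 0 e. {x + y})" by blast
  next
    fix z assume "z \<in> (\<Union>x\<in>K. \<Union>y\<in>ball 0 e. {x + y})"
    then obtain x y where "x \<in> K" "norm y < e" "z = x + y" by auto
    then have "z \<in> ball x e" by (simp add: dist_norm)
    then show "z \<in> (\<Union>x\<in>K. ball x e)" using \<open>x \<in> K\<close> by blast
  qed
  have "convex (\<Union>x\<in>K. ball x e)"
    unfolding eq by (rule convex_sums[OF assms(2)]) simp
  moreover have "K \<subseteq> (\<Union>x\<in>K. ball x e)" using e(1) by force
  ultimately show ?thesis using that[of "\<Union>x\<in>K. ball x e"] e(2) by blast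
qed

text \<open>A predicate \<open>lift L v\<close> on germs, on which \<open>\<int>\<close> acts freely and locally transitively, is a
  locally trivial \<open>\<int>\<close>-covering in disguise. Euclidean spaces are simply connected, so it
  has a global section. Sections are extended box by box.\<close>

locale germ_torsor =
  fixes lift :: "('a::euclidean_space \<Rightarrow> 'b) \<Rightarrow> 'a \<Rightarrow> bool" and g :: "int \<Rightarrow> 'b \<Rightarrow> 'b"
  assumes germ: "\<And>L L' v B. lift L v \<Longrightarrow> open B \<Longrightarrow> v \<in> B \<Longrightarrow> (\<And>u. u \<in> B \<Longrightarrow> L' u = L u) \<Longrightarrow> lift L' v"
    and local_section: "\<And>v. \<exists>L B. open B \<and> v \<in> B \<and> (\<forall>u\<in>B. lift L u)"
    and act: "\<And>L v n. lift L v \<Longrightarrow> lift (\<lambda>u. g n (L u)) v"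
    and uniq: "\<And>L L' v. lift L v \<Longrightarrow> lift L' v \<Longrightarrow> \<exists>n B. open B \<and> v \<in> B \<and> (\<forall>u\<in>B. L' u = g n (L u))"
    and free: "\<And>L v n n'. lift L v \<Longrightarrow> g n (L v) = g n' (L v) \<Longrightarrow> n = n'"
    and g_0: "\<And>P. g 0 P = P"
begin

text \<open>Freeness makes the integer between the two sections unique at each point, and
  \<open>uniq\<close> makes it locally constant.\<close>

lemma uniq_connected:
  assumes C: "open C" "connected C" and L: "\<And>v. v \<in> C \<Longrightarrow> lift L v" "\<And>v. v \<in> C \<Longrightarrow> lift L' v"
  shows "\<exists>n. \<forall>v\<in>C. L' v = g n (L v)"
proof -
  define N where "N v = (THE n. L' v = g n (L v))" for v
  have N: "N v = n" if "v \<in> C" "L' v = g n (L v)" for v n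
    unfolding N_def
  proof (rule the_equality[where P = "\<lambda>n. L' v = g n (L v)", OF that(2)])
    fix k assume "L' v = g k (L v)"
    then show "k = n" using that free[OF L(1)[OF that(1)], of k n] by simp
  qed
  have near: "\<exists>n B. open B \<and> v \<in> B \<and> (\<forall>u\<in>B. L' u = g n (L u))" if "v \<in> C" for v
    using uniq[OF L(1)[OF that] L(2)[OF that]] .
  have const: "N v = N u" if "v \<in> C" "u \<in> C" for v u
  proof (rule connected_local_const[OF C(2) that], intro ballI)
    fix v assume v: "v \<in> C"
    then obtain n B where B: "open B" "v \<in> B" "\<And>u. u \<in> B \<Longrightarrow> L' u = g n (L u)"
      using near by meson
    have "eventually (\<lambda>u. u \<in> B) (at v within C)"
      using B(1,2) by (auto simp: eventually_at_topological)
    moreover have "eventually (\<lambda>u. u \<in> C) (at v within C)"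
      by (simp add: eventually_at_filter)
    ultimately show "eventually (\<lambda>u. N v = N u) (at v within C)"
    proof eventually_elim
      case (elim u)
      have "N u = n" using N[OF elim(2) B(3)[OF elim(1)]] .
      moreover have "N v = n" using N[OF v B(3)[OF B(2)]] .
      ultimately show ?case by simp
    qed
  qed
  have "L' v = g (N v) (L v)" if "v \<in> C" for v
    using near[OF that] N[OF that] by metis
  then show ?thesis using const by metis
qed

text \<open>Neighbourhoods are convex so that their intersections are connected; two sections then
  differ there by a single integer.\<close>

definition has_section :: "'a set \<Rightarrow> bool" where
  "has_section K \<longleftrightarrow> (\<exists>C L. open C \<and> convex C \<and> K \<subseteq> C \<and> (\<forall>v\<in>C. lift L v))"

lemma has_section_subset: "has_section K \<Longrightarrow> K' \<subseteq> K \<Longrightarrow> has_section K'"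
  unfolding has_section_def by (meson order_trans)

lemma has_section_glue:
  assumes K: "compact K" "convex K" "K \<subseteq> K1 \<union> K2" "K1 \<inter> K2 \<noteq> {}"
    and "has_section K1" "has_section K2"
  shows "has_section K"
proof -
  obtain C1 L1 where 1: "open C1" "convex C1" "K1 \<subseteq> C1" "\<forall>v\<in>C1. lift L1 v"
    using assms by (auto simp: has_section_def)
  obtain C2 L2 where 2: "open C2" "convex C2" "K2 \<subseteq> C2" "\<forall>v\<in>C2. lift L2 v"
    using assms by (auto simp: has_section_def)
  have "connected (C1 \<inter> C2)" "open (C1 \<inter> C2)"
    using 1 2 by (auto intro: convex_connected convex_Int)
  then obtain n where n: "\<forall>v\<in>C1\<inter>C2. L2 v = g n (L1 v)"
    using uniq_connected[of "C1 \<inter> C2" L1 L2] 1 2 by blast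
  define L where "L v = (if v \<in> C1 then g n (L1 v) else L2 v)" for v
  have "lift L v" if "v \<in> C1 \<union> C2" for v
  proof (cases "v \<in> C1")
    case True
    then show ?thesis using germ[OF act[of L1 v n] 1(1)] 1 by (simp add: L_def)
  next
    case False
    then show ?thesis using germ[of L2 v C2 L] 2 that n by (simp add: L_def)
  qed
  moreover have "open (C1 \<union> C2)" "K \<subseteq> C1 \<union> C2" using 1 2 K(3) by auto
  from compact_convex_open_nbhd[OF K(1,2) this]
  obtain C where "open C" "convex C" "K \<subseteq> C" "C \<subseteq> C1 \<union> C2" .
  ultimately show ?thesis unfolding has_section_def by (meson subsetD)
qed

text \<open>The additivity that \<open>operative\<close> asks for, with conjunction as the monoid.
  Boxes without interior must carry the neutral value, hence the alternative in P.\<close>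

lemma has_section_split:
  assumes k: "k \<in> Basis"
  defines "P \<equiv> \<lambda>K. interior K = {} \<or> has_section K"
  shows "P (cbox a b) \<longleftrightarrow> P (cbox a b \<inter> {x. x \<bullet> k \<le> c}) \<and> P (cbox a b \<inter> {x. x \<bullet> k \<ge> c})"
    (is "P ?K \<longleftrightarrow> P ?K1 \<and> P ?K2")
proof
  assume K: "P ?K"
  have "P K'" if "K' \<subseteq> ?K" for K'
    using K interior_mono[OF that] has_section_subset[OF _ that] by (auto simp: P_def)
  then show "P ?K1 \<and> P ?K2" by blast
next
  assume *: "P ?K1 \<and> P ?K2"
  show "P ?K"
  proof (cases "interior ?K = {}")
    case False
    then have box: "box a b \<noteq> {}" by simp
    \<comment> \<open>If one half has empty interior, the other half is the whole box: an open
      half-space that misses the open box also misses its closure.\<close>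
    have flat: "?K \<inter> H = {}" if "open H" "interior (?K \<inter> H') = {}" "H \<subseteq> H'" for H H'
    proof -
      have "box a b \<inter> H \<subseteq> interior (?K \<inter> H')"
        using that box_subset_cbox[of a b] by (intro interior_maximal) auto
      then have "box a b \<inter> H = {}" using that by auto
      then have "closure (box a b) \<inter> H = {}"
        using open_Int_closure_eq_empty[OF that(1), of "box a b"] by (simp add: Int_commute)
      then show ?thesis using box by simp
    qed
    have o: "open {x. x \<bullet> k < c}" "open {x. x \<bullet> k > c}"
      by (simp_all add: open_halfspace_component_lt open_halfspace_component_gt)
    consider "interior ?K1 = {}" | "interior ?K2 = {}" | "has_section ?K1" "has_section ?K2"
      using * by (auto simp: P_def)
    then have "has_section ?K"
    proof cases
      case 1
      then have "?K \<inter> {x. x \<bullet> k < c} = {}" using flat[OF o(1) 1] by fastforce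
      then have "?K2 = ?K" by (auto simp: not_less disjoint_iff)
      then show ?thesis using * False by (simp add: P_def)
    next
      case 2
      then have "?K \<inter> {x. x \<bullet> k > c} = {}" using flat[OF o(2) 2] by fastforce
      then have "?K1 = ?K" by (auto simp: not_less disjoint_iff)
      then show ?thesis using * False by (simp add: P_def)
    next
      case 3
      show ?thesis
      proof (cases "?K1 = {} \<or> ?K2 = {}")
        case True
        moreover have "?K \<subseteq> ?K1 \<union> ?K2" by auto
        ultimately have "?K \<subseteq> ?K1 \<or> ?K \<subseteq> ?K2" by blast
        then show ?thesis using 3 has_section_subset by blast
      next
        case False
        then obtain y z where "y \<in> ?K" "z \<in> ?K" "y \<bullet> k \<le> c" "c \<le> z \<bullet> k" by auto
        then obtain x where "x \<in> ?K" "x \<bullet> k = c"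
          using connected_ivt_component[of ?K y z k c] by (auto simp: convex_connected)
        then have ne: "?K1 \<inter> ?K2 \<noteq> {}" by auto
        have "?K \<subseteq> ?K1 \<union> ?K2" by auto
        then show ?thesis by (rule has_section_glue[OF compact_cbox convex_box(1) _ ne 3])
      qed
    qed
    then show ?thesis by (simp add: P_def)
  qed (simp add: P_def)
qed

text \<open>Compactness enters through a fine tagged division: each piece lies in a ball that has a
  section, and additivity over the division assembles the pieces.\<close>

lemma has_section_cbox:
  assumes "box a b \<noteq> {}"
  shows "has_section (cbox a b)"
proof -
  have "\<exists>e>0. has_section (ball v e)" for v
  proof -
    obtain L B where "open B" "v \<in> B" "\<forall>u\<in>B. lift L u" using local_section by blast
    then obtain e where "e > 0" "ball v e \<subseteq> B" by (meson open_contains_ball)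
    with \<open>\<forall>u\<in>B. lift L u\<close> have "\<forall>u\<in>ball v e. lift L u" by blast
    then have "has_section (ball v e)"
      unfolding has_section_def by (intro exI[of _ "ball v e"]) auto
    with \<open>e > 0\<close> show ?thesis by blast
  qed
  then obtain e where e: "\<And>v. e v > 0" "\<And>v. has_section (ball v (e v))" by metis
  obtain p where p: "p tagged_division_of cbox a b" "(\<lambda>v. ball v (e v)) fine p"
    using fine_division_exists[OF gauge_ball_dependent, of e a b] e(1) by blast
  have *: "has_section K" if K: "K \<in> snd ` p" for K
  proof -
    obtain x where "(x, K) \<in> p" using K by auto
    then have "K \<subseteq> ball x (e x)" using p(2) by (auto simp: fine_def)
    then show ?thesis by (rule has_section_subset[OF e(2)])
  qed
  interpret operative HOL.conj True "\<lambda>K. interior K = {} \<or> has_section K"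
  proof (intro operative.intro comm_monoid_set_and operative_axioms.intro)
    show "(interior (cbox a b) = {} \<or> has_section (cbox a b)) = True" if "box a b = {}" for a b
      using that by simp
  qed (rule has_section_split)
  have "F (\<lambda>K. interior K = {} \<or> has_section K) (snd ` p) = (interior (cbox a b) = {} \<or> has_section (cbox a b))"
    using division[OF division_of_tagged_division[OF p(1)]] .
  moreover have "F (\<lambda>K. interior K = {} \<or> has_section K) (snd ` p) = True"
    by (rule neutral) (use * in blast)
  ultimately show ?thesis using assms by simp
qed

theorem global_section: "\<exists>L. \<forall>v. lift L v"
proof -
  define Q where "Q N = cbox (- (real (Suc N) *\<^sub>R One)) (real (Suc N) *\<^sub>R One :: 'a)" for N
  have mem_Q: "v \<in> Q N" if "norm v \<le> real (Suc N)" for v N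
  proof -
    have "\<bar>v \<bullet> i\<bar> \<le> real (Suc N)" if "i \<in> Basis" for i
      using Basis_le_norm[OF that, of v] \<open>norm v \<le> real (Suc N)\<close> by linarith
    then show ?thesis by (auto simp: Q_def mem_box abs_le_iff) (smt (verit))+
  qed
  have "has_section (Q N)" for N
    unfolding Q_def by (rule has_section_cbox) (auto simp: box_ne_empty)
  then have "\<forall>N. \<exists>C L. open C \<and> convex C \<and> Q N \<subseteq> C \<and> (\<forall>v\<in>C. lift L v)"
    by (simp add: has_section_def)
  then obtain C L where C: "\<And>N. open (C N)" "\<And>N. convex (C N)" "\<And>N. Q N \<subseteq> C N"
    "\<And>N v. v \<in> C N \<Longrightarrow> lift (L N) v" by metis
  have 0: "0 \<in> C N" for N using C(3) mem_Q[of 0 N] by auto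
  \<comment> \<open>The sections are normalised at the origin, which lies in all boxes. The integer
    between any two of them is then 0, so they agree on overlaps.\<close>
  have "\<forall>N. \<exists>n. L 0 0 = g n (L N 0)"
  proof
    fix N
    show "\<exists>n. L 0 0 = g n (L N 0)"
      using uniq[OF C(4)[OF 0[of N]] C(4)[OF 0[of 0]]] by blast
  qed
  then obtain n where n: "\<And>N. g (n N) (L N 0) = L 0 0" by metis
  define L' where "L' N v = g (n N) (L N v)" for N v
  have L': "lift (L' N) v" if "v \<in> C N" for N v
    unfolding L'_def using act C(4)[OF that] .
  have agree: "L' M v = L' N v" if "v \<in> C M" "v \<in> C N" for M N v
  proof -
    have "connected (C M \<inter> C N)" "open (C M \<inter> C N)"
      using C by (auto intro: convex_connected convex_Int)
    then obtain k where k: "\<forall>v\<in>C M\<inter>C N. L' N v = g k (L' M v)"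
      using uniq_connected[of "C M \<inter> C N" "L' M" "L' N"] L' by blast
    have "g 0 (L' M 0) = g k (L' M 0)"
      using bspec[OF k, of 0] 0[of M] 0[of N] n[of M] n[of N] unfolding L'_def by (simp add: g_0)
    then have "k = 0" using free[OF L'[OF 0[of M]]] by metis
    then show ?thesis using k that g_0 by simp
  qed
  define N where "N v = nat \<lceil>norm v\<rceil>" for v :: 'a
  have N: "v \<in> C (N v)" for v
  proof -
    have "norm v \<le> real (Suc (N v))" unfolding N_def by linarith
    then show ?thesis using mem_Q C(3) by blast
  qed
  have "lift (\<lambda>v. L' (N v) v) v" for v
    by (rule germ[OF L'[OF N[of v]] C(1) N]) (rule agree[OF N])
  then show ?thesis by blast
qed

end

section \<open>Lifting maps from \<open>\<complex>\<^sup>2\<close> to the surface\<close>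

context parabolic_Inoue_data
begin

text \<open>Only the germ of L at v is constrained, as \<open>germ_torsor\<close> requires; away
  from v the function is arbitrary.\<close>

definition hlift :: "(complex^2 \<Rightarrow> surface_point) \<Rightarrow> (complex^2 \<Rightarrow> patch_point set) \<Rightarrow> complex^2 \<Rightarrow> bool" where
  "hlift G L v \<longleftrightarrow> (\<exists>D \<psi> B \<tau>. (D, \<psi>) \<in> charts W \<and> open B \<and> v \<in> B \<and> holo_on \<tau> B \<and> \<tau> ` B \<subseteq> D \<and>
     (\<forall>u\<in>B. L u = \<psi> (\<tau> u)) \<and> (\<forall>u\<in>B. pr (L u) = G u))"

lemma hliftE:
  assumes "hlift G L v"
  obtains D \<psi> B \<tau> where "(D, \<psi>) \<in> charts W" "open B" "v \<in> B" "holo_on \<tau> B" "\<tau> ` B \<subseteq> D"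
     "\<forall>u\<in>B. L u = \<psi> (\<tau> u)" "\<forall>u\<in>B. pr (L u) = G u"
  using assms unfolding hlift_def by metis

lemma hliftD:
  assumes "hlift G L v"
  shows "L v \<in> points W" "pr (L v) = G v"
proof -
  obtain D \<psi> B \<tau> where B: "(D, \<psi>) \<in> charts W" "open B" "v \<in> B" "holo_on \<tau> B" "\<tau> ` B \<subseteq> D"
     "\<forall>u\<in>B. L u = \<psi> (\<tau> u)" "\<forall>u\<in>B. pr (L u) = G u"
    using hliftE[OF assms] .
  have "\<tau> v \<in> D" using B by auto
  then show "L v \<in> points W" "pr (L v) = G v"
    using B charts_W_in[OF B(1)] by auto
qed

lemma hlift_germ:
  assumes "hlift G L v" "open A" "v \<in> A" "\<And>u. u \<in> A \<Longrightarrow> L' u = L u"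
  shows "hlift G L' v"
proof -
  obtain D \<psi> B \<tau> where B: "(D, \<psi>) \<in> charts W" "open B" "v \<in> B" "holo_on \<tau> B" "\<tau> ` B \<subseteq> D"
     "\<forall>u\<in>B. L u = \<psi> (\<tau> u)" "\<forall>u\<in>B. pr (L u) = G u"
    using hliftE[OF assms(1)] .
  have "holo_on \<tau> (A \<inter> B)" using B(4) holo_on_subset by blast
  then show ?thesis unfolding hlift_def
    using B assms by (intro exI[of _ D] exI[of _ \<psi>] exI[of _ "A \<inter> B"] exI[of _ \<tau>]) auto
qed

lemma hlift_gpow:
  assumes "hlift G L v"
  shows "hlift G (\<lambda>u. gpow n (L u)) v"
proof -
  obtain D \<psi> B \<tau> where B: "(D, \<psi>) \<in> charts W" "open B" "v \<in> B" "holo_on \<tau> B" "\<tau> ` B \<subseteq> D"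
     "\<forall>u\<in>B. L u = \<psi> (\<tau> u)" "\<forall>u\<in>B. pr (L u) = G u"
    using hliftE[OF assms] .
  have c: "\<alpha> powi n \<noteq> 0" "\<alpha> powi (int m * triangular n) \<noteq> 0" by auto
  obtain \<psi>' \<delta> where d: "(D, \<psi>') \<in> charts W" "holo_on \<delta> D" "\<delta> ` D \<subseteq> D"
     "\<forall>v\<in>D. gpow n (\<psi> v) = \<psi>' (\<delta> v)"
    using toric_chart[OF c B(1), of "int m * n", folded gpow_def] by blast
  have h: "holo_on (\<delta> \<circ> \<tau>) B" using holo_on_compose[OF B(4) d(2) B(5)] .
  have in_W: "\<psi> (\<tau> u) \<in> points W" if "u \<in> B" for u
    using charts_W_in[OF B(1)] B(5) that by auto
  have "(\<delta> \<circ> \<tau>) ` B \<subseteq> D" using d(3) B(5) by auto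
  moreover have "\<forall>u\<in>B. gpow n (L u) = \<psi>' ((\<delta> \<circ> \<tau>) u)"
    using B(5,6) d(4) by (simp add: image_subset_iff)
  moreover have "\<forall>u\<in>B. pr (gpow n (L u)) = G u"
    using B(6,7) in_W by simp
  ultimately show ?thesis unfolding hlift_def using B(2,3) d(1) h by blast
qed

text \<open>At v the lifts differ by a deck transformation. Near v the corrected lift and the other
  one stay in a set where the projection is injective, so the same transformation works
  there.\<close>

lemma hlift_uniq:
  assumes "hlift G L v" "hlift G L' v"
  shows "\<exists>n B. open B \<and> v \<in> B \<and> (\<forall>u\<in>B. L' u = gpow n (L u))"
proof -
  obtain D \<psi> B \<tau> where B: "(D, \<psi>) \<in> charts W" "open B" "v \<in> B" "holo_on \<tau> B" "\<tau> ` B \<subseteq> D"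
     "\<forall>u\<in>B. L u = \<psi> (\<tau> u)" "\<forall>u\<in>B. pr (L u) = G u"
    using hliftE[OF assms(1)] .
  obtain D' \<psi>' B' \<tau>' where B': "(D', \<psi>') \<in> charts W" "open B'" "v \<in> B'" "holo_on \<tau>' B'" "\<tau>' ` B' \<subseteq> D'"
     "\<forall>u\<in>B'. L' u = \<psi>' (\<tau>' u)" "\<forall>u\<in>B'. pr (L' u) = G u"
    using hliftE[OF assms(2)] .
  have D: "\<tau> v \<in> D" "\<tau>' v \<in> D'" using B B' by auto
  obtain n where n: "L' v = gpow n (L v)"
    using pr_eq_iff hliftD[OF assms(1)] hliftD[OF assms(2)] by metis
  have c: "\<alpha> powi n \<noteq> 0" "\<alpha> powi (int m * triangular n) \<noteq> 0" by auto
  have "gpow n (\<psi> (\<tau> v)) = \<psi>' (\<tau>' v)" using n B(3,6) B'(3,6) by simp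
  then obtain B1 \<sigma> where 1: "open B1" "\<tau> v \<in> B1" "B1 \<subseteq> D" "holo_on \<sigma> B1" "\<sigma> ` B1 \<subseteq> D'" "\<sigma> (\<tau> v) = \<tau>' v"
     "\<forall>u\<in>B1. gpow n (\<psi> u) = \<psi>' (\<sigma> u)"
    using toric_local[OF c B(1) B'(1) D, of "int m * n", folded gpow_def] by blast
  obtain B2 where 2: "open B2" "\<tau>' v \<in> B2" "inj_on (\<lambda>u. pr (\<psi>' u)) B2"
    using locally_injective[OF B'(1) D(2)] by blast
  define A where "A = {u\<in>B. \<tau> u \<in> {b\<in>B1. \<sigma> b \<in> B2}} \<inter> {u\<in>B'. \<tau>' u \<in> B2}"
  have "open A" unfolding A_def
    by (intro open_Int holo_on_vimage_open B B' 1 2)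
  moreover have "v \<in> A" using B(3) B'(3) 1 2 by (simp add: A_def)
  moreover have "L' u = gpow n (L u)" if "u \<in> A" for u
  proof -
    have u: "u \<in> B" "u \<in> B'" "\<tau> u \<in> B1" "\<sigma> (\<tau> u) \<in> B2" "\<tau>' u \<in> B2" using that by (auto simp: A_def)
    have "pr (\<psi>' (\<sigma> (\<tau> u))) = pr (gpow n (\<psi> (\<tau> u)))" using 1(7) u by simp
    also have "\<dots> = pr (\<psi> (\<tau> u))"
      by (rule pr_gpow, rule charts_W_in[OF B(1)]) (use B(5) u in blast)
    also have "\<dots> = pr (\<psi>' (\<tau>' u))" using B(6,7) B'(6,7) u by metis
    finally have "\<sigma> (\<tau> u) = \<tau>' u" using inj_onD[OF 2(3)] u by blast
    then show ?thesis using B(6) B'(6) 1(7) u by simp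
  qed
  ultimately show ?thesis by blast
qed

lemma germ_torsor_hlift:
  assumes "\<And>v. \<exists>L. hlift G L v"
  shows "germ_torsor (hlift G) gpow"
proof
  show "\<exists>L B. open B \<and> v \<in> B \<and> (\<forall>u\<in>B. hlift G L u)" for v
  proof -
    obtain L where "hlift G L v" using assms by blast
    then obtain D \<psi> B \<tau> where B: "(D, \<psi>) \<in> charts W" "open B" "v \<in> B" "holo_on \<tau> B" "\<tau> ` B \<subseteq> D"
     "\<forall>u\<in>B. L u = \<psi> (\<tau> u)" "\<forall>u\<in>B. pr (L u) = G u" by (rule hliftE)
    then have "hlift G L u" if "u \<in> B" for u unfolding hlift_def using that by blast
    then show ?thesis using B by blast
  qed
  show "hlift G L' v" if "hlift G L v" "open B" "v \<in> B" "\<And>u. u \<in> B \<Longrightarrow> L' u = L u" for L L' v B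
    using hlift_germ that .
  show "hlift G (\<lambda>u. gpow n (L u)) v" if "hlift G L v" for L v n
    using hlift_gpow that .
  show "\<exists>n B. open B \<and> v \<in> B \<and> (\<forall>u\<in>B. L' u = gpow n (L u))" if "hlift G L v" "hlift G L' v" for L L' v
    using hlift_uniq that .
  show "n = n'" if "hlift G L v" "gpow n (L v) = gpow n' (L v)" for L v n n'
    using that gpow_inj[OF hliftD(1)[OF that(1)]] by simp
qed simp

lemma hlift_unique:
  assumes "\<And>v. hlift G L v" "\<And>v. hlift G L' v"
  shows "\<exists>n. \<forall>v. L' v = gpow n (L v)"
proof -
  interpret germ_torsor "hlift G" gpow using germ_torsor_hlift assms(1) by blast
  show ?thesis using uniq_connected[of UNIV L L'] assms by (simp add: connected_UNIV)
qed

lemma hlift_compose: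
  assumes "hlift G L (\<sigma> v)" "holo_on \<sigma> A" "open A" "v \<in> A"
  shows "hlift (\<lambda>u. G (\<sigma> u)) (\<lambda>u. L (\<sigma> u)) v"
proof -
  obtain D \<psi> B \<tau> where B: "(D, \<psi>) \<in> charts W" "open B" "\<sigma> v \<in> B" "holo_on \<tau> B" "\<tau> ` B \<subseteq> D"
     "\<forall>u\<in>B. L u = \<psi> (\<tau> u)" "\<forall>u\<in>B. pr (L u) = G u"
    using hliftE[OF assms(1)] .
  define T where "T = {u\<in>A. \<sigma> u \<in> B}"
  have T: "open T" "v \<in> T" unfolding T_def using holo_on_vimage_open assms B by auto
  have h: "holo_on (\<tau> \<circ> \<sigma>) T"
    by (rule holo_on_compose[OF holo_on_subset[OF assms(2)] B(4)]) (auto simp: T_def)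
  show ?thesis unfolding hlift_def
    using B T h
    by (intro exI[of _ D] exI[of _ \<psi>] exI[of _ T] exI[of _ "\<tau> \<circ> \<sigma>"]) (auto simp: T_def)
qed

lemma hlift_holo_at_w:
  assumes "hlift G L v"
  shows "holo_at (\<lambda>u. w_of (L u)) v"
proof -
  obtain D \<psi> B \<tau> where B: "(D, \<psi>) \<in> charts W" "open B" "v \<in> B" "holo_on \<tau> B" "\<tau> ` B \<subseteq> D"
     "\<forall>u\<in>B. L u = \<psi> (\<tau> u)" "\<forall>u\<in>B. pr (L u) = G u"
    using hliftE[OF assms] .
  have "holo_at (\<lambda>u. w_of (\<psi> (\<tau> u))) v"
    by (rule holo_on_compose_holo_at[OF B(4,3) holo_at_w_of_chart[OF B(1)]]) (use B in auto)
  then show ?thesis by (rule holo_at_cong_open[OF _ B(2,3)]) (simp add: B(6))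
qed

lemma holo_at_x_of_chart:
  assumes "(D, \<phi>) \<in> charts W" "v \<in> D" "w_of (\<phi> v) \<noteq> 0"
  shows "holo_at (\<lambda>u. x_of (\<phi> u)) v"
  using assms(1)
proof (cases rule: charts_W_cases)
  case V
  then show ?thesis by (simp add: V_param_def holo_at_nth)
next
  case (U k)
  have nz: "v $ 1 \<noteq> 0" "v $ 2 \<noteq> 0" using assms U by (auto simp: U_param_def)
  have "holo_at (\<lambda>u::complex^2. (u $ 1 * u $ 2) powi k * u $ 1) v"
    using nz by (intro holo_at_mult holo_at_power_int holo_at_nth) auto
  then show ?thesis
    by (rule holo_at_cong_open[of _ _ "{u::complex^2. u $ 1 \<noteq> 0 \<and> u $ 2 \<noteq> 0}"])
       (use nz U in \<open>auto simp: U_param_def intro!: open_Collect_conj open_nth_neq_0\<close>)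
qed

lemma hlift_holo_at_x:
  assumes "hlift G L v" "w_of (L v) \<noteq> 0"
  shows "holo_at (\<lambda>u. x_of (L u)) v"
proof -
  obtain D \<psi> B \<tau> where B: "(D, \<psi>) \<in> charts W" "open B" "v \<in> B" "holo_on \<tau> B" "\<tau> ` B \<subseteq> D"
     "\<forall>u\<in>B. L u = \<psi> (\<tau> u)" "\<forall>u\<in>B. pr (L u) = G u"
    using hliftE[OF assms(1)] .
  have "holo_at (\<lambda>u. x_of (\<psi> (\<tau> u))) v"
    by (rule holo_on_compose_holo_at[OF B(4,3) holo_at_x_of_chart[OF B(1)]]) (use B assms(2) in auto)
  then show ?thesis by (rule holo_at_cong_open[OF _ B(2,3)]) (simp add: B(6))
qed

text \<open>The parametrization \<sigma> by all of \<complex>^2 is there for the chart V, whose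
  domain is not simply connected and is entered through exp.\<close>

theorem hlift_exists:
  assumes f: "holomorphic_map S S f" and c: "(D, \<phi>) \<in> charts W"
    and \<sigma>: "holo_on \<sigma> UNIV" "range \<sigma> \<subseteq> D"
  shows "\<exists>L. \<forall>v. hlift (\<lambda>u. f (pr (\<phi> (\<sigma> u)))) L v"
proof -
  let ?G = "\<lambda>u. f (pr (\<phi> (\<sigma> u)))"
  have "\<exists>L. hlift ?G L v" for v
  proof -
    have \<sigma>v: "\<sigma> v \<in> D" using \<sigma> by auto
    have "pr (\<phi> (\<sigma> v)) \<in> points S" using charts_W_in[OF c \<sigma>v] by (simp add: points_S)
    then have "?G v \<in> points S"
      using holomorphic_map_points[OF f compatible_atlas_S compatible_atlas_S] by blast
    then obtain P where P: "P \<in> points W" "?G v = pr P" by (auto simp: points_S)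
    obtain D' \<psi> v' where d: "(D', \<psi>) \<in> charts W" "v' \<in> D'" "P = \<psi> v'"
      using charts_W_cover[OF P(1)] .
    obtain B' where B': "open B'" "v' \<in> B'" "B' \<subseteq> D'" "inj_on (\<lambda>u. pr (\<psi> u)) B'"
      using locally_injective[OF d(1,2)] by blast
    obtain B where B: "open B" "\<sigma> v \<in> B" "B \<subseteq> D" "inj_on (\<lambda>u. pr (\<phi> u)) B"
      using locally_injective[OF c \<sigma>v] by blast
    have ch: "(B, \<lambda>u. pr (\<phi> u)) \<in> charts S" "(B', \<lambda>u. pr (\<psi> u)) \<in> charts S"
      using B B' c d by (auto simp: charts_S)
    define T where "T = {u\<in>B. f (pr (\<phi> u)) \<in> (\<lambda>u. pr (\<psi> u)) ` B'}"
    define \<tau> where "\<tau> = inv_into B' (\<lambda>u. pr (\<psi> u)) \<circ> f \<circ> (\<lambda>u. pr (\<phi> u))"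
    have T: "open T" "holo_on \<tau> T"
      unfolding T_def \<tau>_def using holomorphic_mapD[OF f compatible_atlas_S compatible_atlas_S ch] by auto
    have \<tau>: "\<tau> u \<in> B'" "pr (\<psi> (\<tau> u)) = f (pr (\<phi> u))" if "u \<in> T" for u
      using that inv_into_into[of "f (pr (\<phi> u))" "\<lambda>u. pr (\<psi> u)" B']
        f_inv_into_f[of "f (pr (\<phi> u))" "\<lambda>u. pr (\<psi> u)" B'] by (auto simp: T_def \<tau>_def)
    define A where "A = {u. \<sigma> u \<in> T}"
    have A: "open A" using holo_on_vimage_open[OF \<sigma>(1) open_UNIV T(1)] by (simp add: A_def)
    have h: "holo_on (\<tau> \<circ> \<sigma>) A"
      by (rule holo_on_compose[OF holo_on_subset[OF \<sigma>(1)] T(2)]) (auto simp: A_def)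
    have "v \<in> A" using B B' P d by (auto simp: A_def T_def)
    then have "hlift ?G (\<lambda>u. \<psi> (\<tau> (\<sigma> u))) v"
      unfolding hlift_def using d(1) A h \<tau> B'(3)
      by (intro exI[of _ D'] exI[of _ \<psi>] exI[of _ A] exI[of _ "\<tau> \<circ> \<sigma>"]) (auto simp: A_def)
    then show ?thesis by blast
  qed
  then interpret germ_torsor "hlift ?G" gpow by (rule germ_torsor_hlift)
  show ?thesis by (rule global_section)
qed

end

section \<open>Entire functions and functions on the punctured plane\<close>

lemma compact_norm_bound:
  fixes f :: "'a::topological_space \<Rightarrow> 'b::real_normed_vector"
  assumes "compact K" "continuous_on K f"
  obtains M where "\<And>x. x \<in> K \<Longrightarrow> norm (f x) \<le> M"
proof -
  have "bounded (f ` K)" using compact_continuous_image[OF assms(2,1)] compact_imp_bounded by blast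
  then obtain M where "\<forall>y\<in>f ` K. norm y \<le> M" unfolding bounded_iff by blast
  then show ?thesis by (intro that[of M]) auto
qed

lemma entire_continuous_on: "f holomorphic_on UNIV \<Longrightarrow> continuous_on K f"
  by (meson continuous_on_subset holomorphic_on_imp_continuous_on subset_UNIV)

lemma bounded_entire_constant:
  assumes "f holomorphic_on UNIV" "\<And>z. norm (f z) \<le> M"
  shows "f z = f z'"
proof -
  have "bounded (range f)" using assms(2) by (auto simp: bounded_iff)
  then show ?thesis using Liouville_theorem[OF assms(1)] by (auto simp: constant_on_def)
qed

text \<open>Up to the constant c, A and B are the two affine expressions of one function on the
  projective line; compactness bounds it and Liouville applies.\<close>

lemma entire_reciprocal_constant:
  fixes A B :: "complex \<Rightarrow> complex"
  assumes A: "A holomorphic_on UNIV" and B: "B holomorphic_on UNIV"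
    and AB: "\<And>y. y \<noteq> 0 \<Longrightarrow> A y = c * B (inverse y)"
  shows "A y = A y'"
proof -
  obtain M where M: "\<And>z. z \<in> cball 0 1 \<Longrightarrow> norm (A z) \<le> M"
    using compact_norm_bound[OF compact_cball entire_continuous_on[OF A]] by blast
  obtain N where N: "\<And>z. z \<in> cball 0 1 \<Longrightarrow> norm (B z) \<le> N"
    using compact_norm_bound[OF compact_cball entire_continuous_on[OF B]] by blast
  have "norm (A z) \<le> max M (norm c * N)" for z
  proof (cases "norm z \<le> 1")
    case True then show ?thesis using M[of z] by simp
  next
    case False
    then have "z \<noteq> 0" "norm (inverse z) \<le> 1" by (auto simp: norm_inverse inverse_le_1_iff)
    then have "norm (A z) \<le> norm c * N"
      using AB[of z] N[of "inverse z"] by (simp add: norm_mult mult_left_mono)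
    then show ?thesis by simp
  qed
  then show ?thesis using bounded_entire_constant[OF A] by blast
qed

text \<open>Properness makes f a polynomial, injectivity makes its derivative zero-free, and a
  zero-free polynomial is constant.\<close>

lemma entire_injective_proper_affine:
  assumes f: "f holomorphic_on UNIV" "inj f" and proper: "\<And>M. bounded {x. norm (f x) \<le> M}"
  obtains a b :: complex where "a \<noteq> 0" "\<And>x. f x = a * x + b"
proof -
  have "compact {z. f z \<in> K}" if "compact K" for K
  proof -
    obtain M where M: "\<forall>x\<in>K. norm x \<le> M"
      using compact_imp_bounded[OF \<open>compact K\<close>] unfolding bounded_iff by blast
    have "bounded {z. f z \<in> K}"
      by (rule bounded_subset[OF proper[of M]]) (use M in auto)
    moreover have "closed (f -` K)"
      using that entire_continuous_on[OF f(1), of UNIV]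
      by (intro continuous_closed_vimage compact_imp_closed) (auto simp: continuous_on_eq_continuous_at)
    ultimately show ?thesis by (simp add: compact_eq_bounded_closed vimage_def)
  qed
  then obtain c n where c: "f = (\<lambda>z. \<Sum>i\<le>n. c i * z ^ i)"
    using proper_map_polyfun_eq[OF f(1)] by blast
  define p where "p = (\<Sum>i\<le>n. monom (c i) i)"
  have p: "poly p z = f z" for z
    by (simp add: p_def c poly_sum poly_monom)
  have fp: "f = poly p" using p by auto
  have "poly (pderiv p) z \<noteq> 0" for z
    using holomorphic_injective_imp_regular[OF f(1) open_UNIV f(2), of z] poly_DERIV[of p z]
    by (simp add: DERIV_imp_deriv fp)
  then have "constant (poly (pderiv p))"
    using Fundamental_Theorem_Algebra.fundamental_theorem_of_algebra by blast
  then have "degree (pderiv p) = 0" by (simp add: constant_degree)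
  then have "degree p \<le> 1" by (simp add: degree_pderiv)
  then have eq: "f x = coeff p 1 * x + coeff p 0" for x
    unfolding p[symmetric] poly_altdef
    by (cases "degree p") (auto simp: coeff_eq_0)
  have "f 1 \<noteq> f 0" using f(2) by (metis inj_eq zero_neq_one)
  then have "coeff p 1 \<noteq> 0" using eq[of 1] eq[of 0] by auto
  then show ?thesis using eq that by blast
qed

text \<open>The condition on \<eta> makes the two periods independent over the reals, so every value
  is attained on the compact period parallelogram.\<close>

lemma doubly_periodic_constant:
  fixes q :: "complex \<Rightarrow> complex"
  assumes q: "q holomorphic_on UNIV" and \<eta>: "Re \<eta> \<noteq> 0"
    and p1: "\<And>z. q (z + \<eta>) = q z" and p2: "\<And>z. q (z + 2 * of_real pi * \<i>) = q z"
  shows "q z = q z'"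
proof -
  have per: "q (z + of_int n * \<omega>) = q z" if "\<And>z. q (z + \<omega>) = q z" for \<omega> z n
  proof (induction n arbitrary: z rule: int_induct[where k = 0])
    case base then show ?case by simp
  next
    case (step1 i)
    then show ?case using that[of "z + of_int i * \<omega>"] by (simp add: algebra_simps)
  next
    case (step2 i)
    then show ?case using that[of "z + of_int (i - 1) * \<omega>"] by (simp add: algebra_simps)
  qed
  define F where "F p = of_real (fst p) * \<eta> + of_real (snd p) * (2 * of_real pi * \<i>)" for p :: "real \<times> real"
  let ?K = "cbox (0, 0) (1, 1) :: (real \<times> real) set"
  have "continuous_on ?K (\<lambda>p. q (F p))"
    unfolding F_def by (intro continuous_on_compose2[OF entire_continuous_on[OF q, of UNIV]] continuous_intros) auto
  then obtain M where M: "\<And>p. p \<in> ?K \<Longrightarrow> norm (q (F p)) \<le> M"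
    using compact_norm_bound[OF compact_cbox] by blast
  have "norm (q z) \<le> M" for z
  proof -
    define s where "s = Re z / Re \<eta>"
    define t where "t = (Im z - s * Im \<eta>) / (2 * pi)"
    have z: "z = F (s, t)"
      using \<eta> by (simp add: complex_eq_iff F_def s_def t_def)
    have "z = (F (frac s, frac t) + of_int \<lfloor>s\<rfloor> * \<eta>) + of_int \<lfloor>t\<rfloor> * (2 * of_real pi * \<i>)"
      unfolding z by (simp add: F_def frac_def algebra_simps)
    then have "q z = q (F (frac s, frac t))"
      using per[OF p1] per[OF p2] by metis
    moreover have "(frac s, frac t) \<in> ?K"
      by (simp add: cbox_Pair_eq frac_ge_0 frac_lt_1 less_imp_le)
    ultimately show ?thesis using M by simp
  qed
  then show ?thesis using bounded_entire_constant[OF q] by blast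
qed

text \<open>In z = log w the logarithmic derivative of a is entire and doubly periodic, hence a
  constant \<beta>; since a is single-valued around 0, \<beta> is an integer.\<close>

lemma automorphic_nonvanishing_is_monomial:
  fixes a :: "complex \<Rightarrow> complex"
  assumes a: "a holomorphic_on (- {0})" "\<And>w. w \<noteq> 0 \<Longrightarrow> a w \<noteq> 0"
    and \<alpha>: "0 < norm \<alpha>" "norm \<alpha> < 1"
    and aut: "\<And>w. w \<noteq> 0 \<Longrightarrow> a (\<alpha> * w) = \<mu> * a w"
  obtains A j where "A \<noteq> 0" "\<mu> = \<alpha> powi j" "\<And>w. w \<noteq> 0 \<Longrightarrow> a w = A * w powi j"
proof -
  have \<alpha>0: "\<alpha> \<noteq> 0" using \<alpha> by auto
  have \<mu>0: "\<mu> \<noteq> 0" using aut[of 1] a(2)[of \<alpha>] \<alpha>0 by auto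
  define b where "b z = a (exp z)" for z
  have b: "b holomorphic_on UNIV"
    unfolding b_def by (rule holomorphic_on_compose_gen[OF _ a(1), unfolded o_def]) (auto intro: holomorphic_intros)
  have b0: "b z \<noteq> 0" for z by (simp add: b_def a)
  define q where "q z = deriv b z / b z" for z
  have q: "q holomorphic_on UNIV"
    unfolding q_def using b b0 by (intro holomorphic_intros) auto
  have der: "(b has_field_derivative q z * b z) (at z)" for z
    using holomorphic_derivI[OF b open_UNIV, of z] b0[of z] by (simp add: q_def)
  have shift: "q (z + \<omega>) = q z" if "\<And>z. b (z + \<omega>) = \<nu> * b z" "\<nu> \<noteq> 0" for \<omega> \<nu> z
  proof -
    have "((\<lambda>z. b (z + \<omega>)) has_field_derivative q (z + \<omega>) * b (z + \<omega>)) (at z)"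
      using DERIV_shift der by blast
    moreover have "((\<lambda>z. b (z + \<omega>)) has_field_derivative \<nu> * (q z * b z)) (at z)"
      unfolding that(1) by (rule DERIV_cmult[OF der])
    ultimately have "q (z + \<omega>) * b (z + \<omega>) = \<nu> * (q z * b z)" by (rule DERIV_unique)
    then show ?thesis using that b0[of z] by simp
  qed
  have "q (z + Ln \<alpha>) = q z" for z
    by (rule shift[of _ \<mu>]) (use aut \<alpha>0 \<mu>0 in \<open>auto simp: b_def exp_add mult.commute[of _ \<alpha>]\<close>)
  moreover have per: "b (z + 2 * of_real pi * \<i>) = b z" for z
    by (simp add: b_def exp_add)
  then have "q (z + 2 * of_real pi * \<i>) = q z" for z
    by (intro shift[of _ 1]) auto
  moreover have "Re (Ln \<alpha>) \<noteq> 0" using \<alpha> by (simp add: Re_Ln)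
  ultimately obtain \<beta> where \<beta>: "\<And>z. q z = \<beta>"
    using doubly_periodic_constant[OF q, of "Ln \<alpha>"] by metis
  have "\<exists>A. \<forall>z\<in>UNIV. b z * exp (- (\<beta> * z)) = A"
  proof (rule has_field_derivative_zero_constant)
    show "((\<lambda>z. b z * exp (- (\<beta> * z))) has_field_derivative 0) (at z within UNIV)" for z
      using der[of z] unfolding \<beta> by (auto intro!: derivative_eq_intros simp: algebra_simps)
  qed simp
  then obtain A where A: "\<And>z. b z * exp (- (\<beta> * z)) = A" by blast
  have bA: "b z = A * exp (\<beta> * z)" for z
    using A[of z] by (simp add: exp_minus field_simps)
  have A0: "A \<noteq> 0" using bA[of 0] b0[of 0] by auto
  have "exp (\<beta> * (2 * of_real pi * \<i>)) = 1"
    using per[of 0] A0 bA[of 0] bA[of "2 * of_real pi * \<i>"] by simp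
  then obtain n :: int where n: "Re (\<beta> * (2 * of_real pi * \<i>)) = 0" "Im (\<beta> * (2 * of_real pi * \<i>)) = of_int (2 * n) * pi"
    unfolding exp_eq_1 by blast
  then have "\<beta> = of_int n" by (simp add: complex_eq_iff)
  then have eq: "a w = A * w powi n" if "w \<noteq> 0" for w
    using bA[of "Ln w"] that by (simp add: b_def exp_power_int[symmetric] mult.commute)
  have "A * \<alpha> powi n = \<mu> * A" using aut[of 1] eq[of \<alpha>] eq[of 1] \<alpha>0 by simp
  then have "\<mu> = \<alpha> powi n" using A0 by simp
  then show ?thesis using that A0 eq by blast
qed

text \<open>Near 0 the factor C w^m has norm at most 1, so the maximum over one fundamental annulus
  bounds d and the singularity is removable. A zero of finite order at 0 is impossible: scaling by
  \<alpha> keeps the order while w^m raises it.\<close>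

lemma automorphic_of_negative_degree_vanishes:
  fixes d :: "complex \<Rightarrow> complex"
  assumes d: "d holomorphic_on (- {0})" and \<alpha>: "0 < norm \<alpha>" "norm \<alpha> < 1" and m: "m > 0"
    and aut: "\<And>w. w \<noteq> 0 \<Longrightarrow> d (\<alpha> * w) = C * w ^ m * d w"
    and w: "w \<noteq> 0"
  shows "d w = 0"
proof -
  have \<alpha>0: "\<alpha> \<noteq> 0" using \<alpha> by auto
  \<comment> \<open>Gives \<delta> \<le> 1 and |C| \<delta> \<le> 1; as m is at least 1, |C w^m|
    \<le> 1 follows for |w| \<le> \<delta>.\<close>
  define \<delta> where "\<delta> = 1 / (norm C + 1)"
  have \<delta>: "0 < \<delta>" "\<delta> \<le> 1" "norm C * \<delta> \<le> 1"
    by (auto simp: \<delta>_def field_simps add_pos_nonneg)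
  have contr: "norm (d (\<alpha> * w)) \<le> norm (d w)" if "w \<noteq> 0" "norm w \<le> \<delta>" for w
  proof -
    have "norm w ^ m \<le> norm w" using power_decreasing[of 1 m "norm w"] m that \<delta> by simp
    then have "norm w ^ m \<le> \<delta>" using that by simp
    then have "norm (C * w ^ m) \<le> 1"
      using \<delta> mult_left_mono[of "norm w ^ m" \<delta> "norm C"] by (simp add: norm_mult norm_power)
    then show ?thesis
      using mult_right_mono[of "norm (C * w ^ m)" 1 "norm (d w)"] that by (simp add: aut norm_mult)
  qed
  let ?K = "cball 0 \<delta> - ball (0::complex) (norm \<alpha> * \<delta>)"
  have "compact ?K" by (intro compact_diff) auto
  moreover have "?K \<subseteq> - {0}" using \<alpha> \<delta> by auto
  ultimately obtain M where M: "\<And>w. w \<in> ?K \<Longrightarrow> norm (d w) \<le> M"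
    using compact_norm_bound[of ?K d] holomorphic_on_imp_continuous_on[OF d] continuous_on_subset by blast
  have M': "norm (d w) \<le> M" if "w \<noteq> 0" "norm w \<le> \<delta>" "norm \<alpha> ^ n * \<delta> \<le> norm w" for w n
    using that
  proof (induction n arbitrary: w)
    case 0
    have "norm \<alpha> * \<delta> \<le> 1 * \<delta>" using \<alpha> \<delta> by (intro mult_right_mono) auto
    with 0 show ?case by (intro M) auto
  next
    case (Suc n)
    show ?case
    proof (cases "norm \<alpha> * \<delta> \<le> norm w")
      case True then show ?thesis using Suc by (intro M) auto
    next
      case False
      have "norm (d (\<alpha> * (w / \<alpha>))) \<le> norm (d (w / \<alpha>))"
        using Suc False \<alpha>0 \<alpha> by (intro contr) (auto simp: norm_divide field_simps)
      also have "\<dots> \<le> M"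
        using Suc False \<alpha>0 \<alpha> by (intro Suc.IH) (auto simp: norm_divide field_simps)
      finally show ?thesis using \<alpha>0 by simp
    qed
  qed
  have bound: "norm (d w) \<le> M" if "w \<noteq> 0" "norm w \<le> \<delta>" for w
  proof -
    have "(\<lambda>n. norm \<alpha> ^ n * \<delta>) \<longlonglongrightarrow> 0 * \<delta>"
      using \<alpha> by (intro tendsto_intros LIMSEQ_power_zero) auto
    then have "eventually (\<lambda>n. norm \<alpha> ^ n * \<delta> < norm w) sequentially"
      using that by (intro order_tendstoD) auto
    then obtain n where "norm \<alpha> ^ n * \<delta> < norm w" by (auto simp: eventually_sequentially)
    then show ?thesis using M'[OF that, of n] by simp
  qed
  have "d \<in> O[at 0](\<lambda>_. 1)"
  proof (rule bigoI)
    show "eventually (\<lambda>w. norm (d w) \<le> M * norm (1::complex)) (at 0)"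
      using \<delta> bound by (auto simp: eventually_at dist_norm intro!: exI[of _ \<delta>])
  qed
  then obtain g where g: "g holomorphic_on UNIV" "\<And>w. w \<noteq> 0 \<Longrightarrow> g w = d w"
    using removable_singularities[of "{0}" UNIV d] d by (auto simp: Compl_eq_Diff_UNIV)
  have isCont: "isCont g 0"
    using g(1) by (simp add: holomorphic_on_imp_continuous_on continuous_on_eq_continuous_at open_UNIV[THEN continuous_on_eq_continuous_at, THEN iffD1, rule_format])
  have "g w = 0"
  proof (rule ccontr)
    assume nz: "g w \<noteq> 0"
    have scale: "filterlim (\<lambda>z. \<alpha> * z) (nhds 0) (at 0)"
      by (rule tendsto_eq_rhs[OF tendsto_mult[OF tendsto_const tendsto_ident_at]]) simp
    have gaut: "g (\<alpha> * z) = C * z ^ m * g z" if "z \<noteq> 0" for z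
      using that \<alpha>0 by (simp add: g(2) aut)
    \<comment> \<open>The limit z -> 0 is taken twice: here to get \<open>g 0 = 0\<close>, which the
      factorization of a zero presupposes, and below for the nonvanishing cofactor u.\<close>
    have "((\<lambda>z. g (\<alpha> * z)) \<longlongrightarrow> g 0) (at 0)"
      using isCont_tendsto_compose[OF isCont scale] .
    have t2: "((\<lambda>z. C * z ^ m * g z) \<longlongrightarrow> C * 0 ^ m * g 0) (at 0)"
      using isCont by (intro tendsto_intros) (auto simp: isCont_def)
    have ev: "eventually (\<lambda>z. C * z ^ m * g z = g (\<alpha> * z)) (at 0)"
      using gaut by (auto simp: eventually_at_filter)
    have "((\<lambda>z. g (\<alpha> * z)) \<longlongrightarrow> 0) (at 0)"
      using Lim_transform_eventually[OF t2 ev] m by (simp add: zero_power)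
    with \<open>((\<lambda>z. g (\<alpha> * z)) \<longlongrightarrow> g 0) (at 0)\<close> have g0: "g 0 = 0"
      using tendsto_unique[OF at_neq_bot] by blast
    have "\<not> g constant_on UNIV" using nz g0 by (auto simp: constant_on_def) (metis)
    then obtain u r n where u: "0 < n" "0 < r" "u holomorphic_on ball 0 r"
        "\<And>z. z \<in> ball 0 r \<Longrightarrow> g z = (z - 0) ^ n * u z" "\<And>z. z \<in> ball 0 r \<Longrightarrow> u z \<noteq> 0"
      using holomorphic_factor_zero_nonconstant[OF g(1) open_UNIV connected_UNIV UNIV_I g0] by metis
    have uc: "isCont u 0"
      using u(2,3) by (intro continuous_on_interior[OF holomorphic_on_imp_continuous_on]) auto
    have ueq: "\<alpha> ^ n * u (\<alpha> * z) = C * z ^ m * u z" if "z \<noteq> 0" "norm z < r" for z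
    proof -
      have "norm (\<alpha> * z) < r"
        using that mult_right_mono[OF less_imp_le[OF \<alpha>(2)] norm_ge_zero[of z]] unfolding norm_mult by linarith
      then have "z ^ n * (\<alpha> ^ n * u (\<alpha> * z)) = z ^ n * (C * z ^ m * u z)"
        using gaut[OF that(1)] u(4)[of z] u(4)[of "\<alpha> * z"] that by (simp add: power_mult_distrib algebra_simps)
      then show ?thesis using that by simp
    qed
    have "((\<lambda>z. \<alpha> ^ n * u (\<alpha> * z)) \<longlongrightarrow> \<alpha> ^ n * u 0) (at 0)"
      by (intro tendsto_intros isCont_tendsto_compose[OF uc scale])
    have t2: "((\<lambda>z. C * z ^ m * u z) \<longlongrightarrow> C * 0 ^ m * u 0) (at 0)"
      using uc by (intro tendsto_intros) (auto simp: isCont_def)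
    have ev: "eventually (\<lambda>z. C * z ^ m * u z = \<alpha> ^ n * u (\<alpha> * z)) (at 0)"
      using ueq u(2) by (auto simp: eventually_at dist_norm intro!: exI[of _ r])
    have "((\<lambda>z. \<alpha> ^ n * u (\<alpha> * z)) \<longlongrightarrow> 0) (at 0)"
      using Lim_transform_eventually[OF t2 ev] m by (simp add: zero_power)
    with \<open>((\<lambda>z. \<alpha> ^ n * u (\<alpha> * z)) \<longlongrightarrow> \<alpha> ^ n * u 0) (at 0)\<close> have "\<alpha> ^ n * u 0 = 0"
      using tendsto_unique[OF at_neq_bot] by blast
    then show False using \<alpha>0 u(2) u(5)[of 0] by simp
  qed
  then show ?thesis using g(2) w by simp
qed

section \<open>Functions vanishing on the coordinate axes\<close>

lemma Schwarz_bound: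
  fixes f :: "complex \<Rightarrow> complex"
  assumes f: "f holomorphic_on UNIV" "f 0 = 0" and b: "\<And>z. norm z < r \<Longrightarrow> norm (f z) < M"
    and z: "norm z < r"
  shows "norm (f z) \<le> M / r * norm z"
proof -
  have r: "r > 0" using z by (meson norm_ge_zero order_le_less_trans)
  have M: "M > 0" using b[OF z] by (meson norm_ge_zero order_le_less_trans)
  define h where "h z = f (of_real r * z) / of_real M" for z
  have "h holomorphic_on UNIV" unfolding h_def
    using M by (intro holomorphic_intros holomorphic_on_compose_gen[OF _ f(1), unfolded o_def]) auto
  then have "h holomorphic_on ball 0 1" by (rule holomorphic_on_subset) simp
  moreover have "norm (h z) < 1" if "norm z < 1" for z
    using b[of "of_real r * z"] that r M by (simp add: h_def norm_divide norm_mult)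
  moreover have "norm (z / of_real r) < 1" using z r by (simp add: norm_divide)
  ultimately have "norm (h (z / of_real r)) \<le> norm (z / of_real r)"
    using Schwarz_Lemma(1)[of h "z / of_real r"] f(2) by (simp add: h_def)
  then show ?thesis using r M by (simp add: h_def norm_divide field_simps)
qed

text \<open>The Schwarz lemma in each variable in turn. Radius 2 leaves room for the closed unit
  polydisc, and \<open>\<bar>M\<bar> + 1\<close> makes the bound strict.\<close>

lemma vanishing_on_axes_bound:
  fixes A :: "complex \<Rightarrow> complex \<Rightarrow> complex"
  assumes cont: "continuous_on UNIV (\<lambda>p. A (fst p) (snd p))"
    and hol: "\<And>y. (\<lambda>x. A x y) holomorphic_on UNIV" "\<And>x. A x holomorphic_on UNIV"
    and zero: "\<And>y. A 0 y = 0" "\<And>x. A x 0 = 0"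
  obtains M where "\<And>x y. norm x \<le> 1 \<Longrightarrow> norm y \<le> 1 \<Longrightarrow> norm (A x y) \<le> M * norm (x * y)"
proof -
  obtain M where M: "\<And>p. p \<in> cball 0 2 \<times> cball 0 2 \<Longrightarrow> norm (A (fst p) (snd p)) \<le> M"
    using compact_norm_bound[OF compact_Times[OF compact_cball compact_cball] continuous_on_subset[OF cont subset_UNIV]]
    by blast
  have M2: "norm (A x y) < \<bar>M\<bar> + 1" if "norm x < 2" "norm y < 2" for x y
    using M[of "(x, y)"] that by simp
  have 1: "norm (A x y) \<le> (\<bar>M\<bar> + 1) / 2 * norm x" if "norm x < 2" "norm y < 2" for x y
    by (rule Schwarz_bound[OF hol(1) zero(1) _ that(1)]) (use M2 that in auto)
  have "norm (A x y) \<le> (\<bar>M\<bar> + 1) * norm (x * y)" if "norm x \<le> 1" "norm y \<le> 1" for x y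
  proof (cases "x = 0")
    case False
    then have pos: "(\<bar>M\<bar> + 1) * norm x > 0" by (simp add: add_nonneg_pos)
    have "norm (A x y) \<le> ((\<bar>M\<bar> + 1) * norm x) / 2 * norm y"
    proof (rule Schwarz_bound[OF hol(2) zero(2)])
      show "norm (A x z) < (\<bar>M\<bar> + 1) * norm x" if "norm z < 2" for z
        using 1[of x z] that \<open>norm x \<le> 1\<close> pos by simp
    qed (use that in auto)
    also have "\<dots> \<le> (\<bar>M\<bar> + 1) * norm x * norm y"
      using pos by (intro mult_right_mono) auto
    finally show ?thesis by (simp add: norm_mult)
  qed (simp add: zero)
  then show ?thesis using that by blast
qed

section \<open>Automorphisms preserve the cycle\<close>

context parabolic_Inoue_data
begin

lemma hlift_w_holomorphic:
  assumes "\<And>v. hlift G L v"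
  shows "(\<lambda>x. w_of (L (vec2 x y))) holomorphic_on UNIV" "(\<lambda>y. w_of (L (vec2 x y))) holomorphic_on UNIV"
  unfolding holomorphic_on_def
  using holo_at_curve[OF hlift_holo_at_w[OF assms]] by auto

lemma hlift_x_holomorphic:
  assumes "\<And>v. hlift G L v"
  shows "(\<And>x. w_of (L (vec2 x y)) \<noteq> 0) \<Longrightarrow> (\<lambda>x. x_of (L (vec2 x y))) holomorphic_on UNIV"
    "(\<And>y. w_of (L (vec2 x y)) \<noteq> 0) \<Longrightarrow> (\<lambda>y. x_of (L (vec2 x y))) holomorphic_on UNIV"
  unfolding holomorphic_on_def
  using holo_at_curve[OF hlift_holo_at_x[OF assms]] by auto

lemma pr_in_S: "P \<in> points W \<Longrightarrow> pr P \<in> points S"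
  unfolding points_S by (rule imageI)

lemma U_hlift_exists:
  assumes "holomorphic_map S S f"
  shows "\<exists>L. \<forall>v. hlift (\<lambda>u. f (pr (U_param k u))) L v"
  using hlift_exists[OF assms U_chart[of k], of "\<lambda>v. v"] by simp

text \<open>This includes m = 1, where C has a node: its preimages on the rational curve are y = 0
  and y = infinity, and the axis contains only the first.\<close>

lemma pr_U_pt_0_inj:
  assumes "pr (U_pt k 0 y) = pr (U_pt k 0 y')"
  shows "y = y'"
proof -
  obtain n where n: "U_pt k 0 y' = gpow n (U_pt k 0 y)"
    using assms pr_eq_iff[of "U_pt k 0 y" "U_pt k 0 y'"] by auto
  consider "y = 0" "y' = 0" | "y \<noteq> 0" "y' \<noteq> 0" | "(y = 0) \<noteq> (y' = 0)" by blast
  then show ?thesis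
  proof cases
    case 2
    then have "int m * n = 0" using n by (simp add: gpow_def W_point_eq_iff)
    then show ?thesis using n m_pos by (simp add: U_pt_inj)
  next
    case 3
    then show ?thesis using n by (auto simp: gpow_def W_point_eq_iff split: if_splits)
  qed simp
qed

text \<open>The curve through the point consists of the axes x = 0 of U_k and y = 0 of U_(k+1),
  glued by y -> 1/y. Lifts over the two charts differ by one deck transformation, so
  \<open>entire_reciprocal_constant\<close> applies to w and, if w is nonzero, to x.\<close>

lemma automorphism_cycle:
  assumes f: "holomorphic_map S S f" "inj_on f (points S)" and p: "p \<in> Inoue_cycle m \<alpha>"
  shows "f p \<in> Inoue_cycle m \<alpha>"
proof -
  obtain P where P: "P \<in> points W" "w_of P = 0" "p = pr P" using p by (auto simp: Inoue_cycle_eq)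
  obtain k y0 where k: "P = U_pt k 0 y0" using w_of_eq_0_cases'[OF P(1,2)] .
  obtain L where L: "\<And>v. hlift (\<lambda>u. f (pr (U_param k u))) L v" using U_hlift_exists[OF f(1)] by blast
  obtain L' where L': "\<And>v. hlift (\<lambda>u. f (pr (U_param (k + 1) u))) L' v" using U_hlift_exists[OF f(1)] by blast
  \<comment> \<open>Both maps parametrize the overlap of the two charts, where y is nonzero; with y
    replaced by exp the source is all of \<complex>^2, so that \<open>hlift_unique\<close>
    applies.\<close>
  define \<sigma> where "\<sigma> v = vec2 (v $ 1) (exp (v $ 2))" for v :: "complex^2"
  define \<sigma>' where "\<sigma>' v = vec2 (inverse (exp (v $ 2))) (v $ 1 * (exp (v $ 2) * exp (v $ 2)))" for v :: "complex^2"
  have \<sigma>: "holo_on \<sigma> UNIV" "holo_on \<sigma>' UNIV"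
    unfolding \<sigma>_def \<sigma>'_def
    by (intro holo_on_vec2 holo_at_nth holo_at_exp holo_at_mult holo_at_inverse; simp)+
  have eq: "U_param k (\<sigma> v) = U_param (k + 1) (\<sigma>' v)" for v
    using U_pt_Suc[of "exp (v $ 2)" k "v $ 1"] by (simp add: U_param_def \<sigma>_def \<sigma>'_def power2_eq_square)
  have 1: "hlift (\<lambda>u. f (pr (U_param k (\<sigma> u)))) (\<lambda>u. L (\<sigma> u)) v" for v
    by (rule hlift_compose[OF L \<sigma>(1)]) auto
  have 2: "hlift (\<lambda>u. f (pr (U_param k (\<sigma> u)))) (\<lambda>u. L' (\<sigma>' u)) v" for v
    unfolding eq by (rule hlift_compose[OF L' \<sigma>(2)]) auto
  obtain n where n: "\<And>v. L' (\<sigma>' v) = gpow n (L (\<sigma> v))"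
    using hlift_unique[OF 1 2] by blast
  have rel: "L' (vec2 (inverse y) 0) = gpow n (L (vec2 0 y))" if "y \<noteq> 0" for y
    using n[of "vec2 0 (Ln y)"] that by (simp add: \<sigma>_def \<sigma>'_def)
  have LW: "L v \<in> points W" "pr (L v) = f (pr (U_param k v))" for v using hliftD[OF L] by auto
  have LW': "L' v \<in> points W" for v using hliftD[OF L'] by auto
  define A where "A y = w_of (L (vec2 0 y))" for y
  define A' where "A' x = w_of (L' (vec2 x 0))" for x
  have A: "A holomorphic_on UNIV" "A' holomorphic_on UNIV"
    unfolding A_def A'_def using hlift_w_holomorphic[OF L] hlift_w_holomorphic[OF L'] by auto
  have relA: "A' (inverse y) = \<alpha> powi n * A y" if "y \<noteq> 0" for y
    using rel[OF that] LW by (simp add: A_def A'_def)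
  have constA: "A y = A y'" for y y'
    by (rule entire_reciprocal_constant[OF A, of "inverse (\<alpha> powi n)"]) (simp add: relA)
  have constA': "A' y = A' y'" for y y'
    by (rule entire_reciprocal_constant[OF A(2,1), of "\<alpha> powi n"]) (use relA[of "inverse _"] in simp)
  have "A 1 = 0"
  proof (rule ccontr)
    assume nz: "A 1 \<noteq> 0"
    have c: "w_of (L (vec2 0 y)) = A 1" for y using constA[of y 1] by (simp add: A_def)
    have c': "w_of (L' (vec2 x 0)) \<noteq> 0" for x
      using constA'[of x 1] relA[of 1] nz by (simp add: A'_def)
    define B where "B y = x_of (L (vec2 0 y))" for y
    define B' where "B' x = x_of (L' (vec2 x 0))" for x
    have B: "B holomorphic_on UNIV" "B' holomorphic_on UNIV"
      unfolding B_def B'_def using hlift_x_holomorphic(2)[OF L, of 0] hlift_x_holomorphic(1)[OF L', of 0] c c' nz by auto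
    have Lc: "L (vec2 0 y) = V_pt (A 1) (B y)" for y
      using V_pt_coordinates[OF LW(1), of "vec2 0 y"] nz unfolding c B_def by simp
    define K where "K = \<alpha> powi (int m * triangular n) * A 1 powi (int m * n)"
    have K: "K \<noteq> 0" using nz by (simp add: K_def)
    have "B y = inverse K * B' (inverse y)" if "y \<noteq> 0" for y
    proof -
      have "B' (inverse y) = K * B y" using rel[OF that] nz by (simp add: B'_def Lc gpow_V_pt K_def)
      then show ?thesis using K by simp
    qed
    \<comment> \<open>The whole curve would collapse to one point; two of its points suffice to
      contradict injectivity.\<close>
    then have "B 1 = B 2" by (rule entire_reciprocal_constant[OF B])
    then have "f (pr (U_pt k 0 1)) = f (pr (U_pt k 0 2))"
      using Lc[of 1] Lc[of 2] LW(2)[of "vec2 0 1"] LW(2)[of "vec2 0 2"] by (simp add: U_param_def)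
    then have "pr (U_pt k 0 1) = pr (U_pt k 0 2)"
      by (rule inj_onD[OF f(2)]) (rule pr_in_S[OF U_pt_in_W])+
    then show False using pr_U_pt_0_inj[of k 1 2] by simp
  qed
  then have "w_of (L (vec2 0 y0)) = 0" using constA[of y0 1] by (simp add: A_def)
  then have "pr (L (vec2 0 y0)) \<in> Inoue_cycle m \<alpha>" using pr_in_cycle LW(1) by blast
  then show ?thesis using LW(2)[of "vec2 0 y0"] by (simp add: P(3) k U_param_def)
qed

section \<open>Lifting automorphisms to \<open>V\<close>\<close>

text \<open>The last conjunct of \<open>V_lift\<close> retains from the extension of \<open>f\<close> over the cycle that \<open>w \<circ> \<Psi>\<close>
  vanishes along it.\<close>

definition V_lift :: "(surface_point \<Rightarrow> surface_point) \<Rightarrow> (patch_point set \<Rightarrow> patch_point set) \<Rightarrow> int \<Rightarrow> bool" where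
  "V_lift f \<Psi> n \<longleftrightarrow>
     (\<forall>w x. w \<noteq> 0 \<longrightarrow> \<Psi> (V_pt w x) \<in> points W \<and> w_of (\<Psi> (V_pt w x)) \<noteq> 0 \<and> pr (\<Psi> (V_pt w x)) = f (upt w x)) \<and>
     (\<forall>v. v $ 1 \<noteq> 0 \<longrightarrow> holo_at (\<lambda>v. w_of (\<Psi> (V_param v))) v \<and> holo_at (\<lambda>v. x_of (\<Psi> (V_param v))) v) \<and>
     (\<forall>w x. w \<noteq> 0 \<longrightarrow> \<Psi> (gpow 1 (V_pt w x)) = gpow n (\<Psi> (V_pt w x))) \<and>
     (\<exists>M. \<forall>x y. x \<noteq> 0 \<longrightarrow> y \<noteq> 0 \<longrightarrow> norm x \<le> 1 \<longrightarrow> norm y \<le> 1 \<longrightarrow>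
        norm (w_of (\<Psi> (U_pt 0 x y))) \<le> M * norm (x * y))"

text \<open>The lift L is built over (log w, x) and depends a priori on the branch of the logarithm.
  A second lift, over U_0, removes this dependence and supplies the bound near the crossing
  point.\<close>

lemma V_lift_exists:
  assumes f: "holomorphic_map S S f" and fU: "\<And>p. p \<in> points U \<Longrightarrow> f p \<in> points U"
    and fC: "\<And>p. p \<in> Inoue_cycle m \<alpha> \<Longrightarrow> f p \<in> Inoue_cycle m \<alpha>"
  shows "\<exists>\<Psi> n. V_lift f \<Psi> n"
proof -
  define \<epsilon> where "\<epsilon> v = vec2 (exp (v $ 1)) (v $ 2)" for v :: "complex^2"
  have \<epsilon>: "holo_on \<epsilon> UNIV" unfolding \<epsilon>_def by (intro holo_on_vec2 holo_at_nth holo_at_exp)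
  obtain L where L: "\<And>v. hlift (\<lambda>u. f (pr (V_param (\<epsilon> u)))) L v"
  proof -
    have "range \<epsilon> \<subseteq> {v. v $ 1 \<noteq> 0}" by (auto simp: \<epsilon>_def)
    then show thesis using hlift_exists[OF f V_chart \<epsilon>] that by blast
  qed
  have pr\<epsilon>: "pr (V_param (\<epsilon> v)) = upt (exp (v $ 1)) (v $ 2)" for v
    by (simp add: V_param_def \<epsilon>_def upt_pr)
  have LW: "L v \<in> points W" "pr (L v) = f (upt (exp (v $ 1)) (v $ 2))" for v
    using hliftD[OF L, of v] by (auto simp: pr\<epsilon>)
  have Lw: "w_of (L v) \<noteq> 0" for v
    using fU[OF upt_in_U[of "exp (v $ 1)" "v $ 2"]] LW pr_in_U[OF LW(1)] by simp

  obtain L0 where L0: "\<And>v. hlift (\<lambda>u. f (pr (U_param 0 u))) L0 v" using U_hlift_exists[OF f] by blast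
  \<comment> \<open>Both maps describe the torus where w and x are nonzero: w = exp v_1 and x = exp
    v_2, hence x_0 = x and y_0 = w / x.\<close>
  define \<sigma> where "\<sigma> v = vec2 (v $ 1) (exp (v $ 2))" for v :: "complex^2"
  define \<sigma>' where "\<sigma>' v = vec2 (exp (v $ 2)) (exp (v $ 1 + - 1 * v $ 2))" for v :: "complex^2"
  have \<sigma>: "holo_on \<sigma> UNIV" "holo_on \<sigma>' UNIV"
    unfolding \<sigma>_def \<sigma>'_def by (intro holo_on_vec2 holo_at_nth holo_at_exp holo_at_mult holo_at_add holo_at_const)+
  have eq: "V_param (\<epsilon> (\<sigma> v)) = U_param 0 (\<sigma>' v)" for v
    by (simp add: V_param_def \<epsilon>_def U_param_def \<sigma>_def \<sigma>'_def U_pt_eq_V_pt exp_diff)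
  have 1: "hlift (\<lambda>u. f (pr (V_param (\<epsilon> (\<sigma> u))))) (\<lambda>u. L (\<sigma> u)) v" for v
    by (rule hlift_compose[OF L \<sigma>(1)]) auto
  have 2: "hlift (\<lambda>u. f (pr (V_param (\<epsilon> (\<sigma> u))))) (\<lambda>u. L0 (\<sigma>' u)) v" for v
    unfolding eq by (rule hlift_compose[OF L0 \<sigma>(2)]) auto
  obtain n0 where n0: "\<And>v. L (\<sigma> v) = gpow n0 (L0 (\<sigma>' v))"
    using hlift_unique[OF 2 1] by blast
  have LL0: "L (vec2 z x) = gpow n0 (L0 (vec2 x (exp z / x)))" if "x \<noteq> 0" for z x
    using n0[of "vec2 z (Ln x)"] that by (simp add: \<sigma>_def \<sigma>'_def exp_diff)

  have per1: "L (vec2 (z + 2 * of_int l * of_real pi * \<i>) x) = L (vec2 z x)" for z x l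
  proof -
    define s where "s v = vec2 (v $ 1 + 2 * of_int l * of_real pi * \<i>) (v $ 2)" for v :: "complex^2"
    have s: "holo_on s UNIV" unfolding s_def by (intro holo_on_vec2 holo_at_nth holo_at_add holo_at_const)
    have e: "exp (z + 2 * of_int l * of_real pi * \<i>) = exp z" for z
      by (simp add: exp_eq)
    then have "\<epsilon> (s v) = \<epsilon> v" for v by (simp add: \<epsilon>_def s_def)
    then have "hlift (\<lambda>u. f (pr (V_param (\<epsilon> u)))) (\<lambda>u. L (s u)) v" for v
      using hlift_compose[OF L s open_UNIV UNIV_I, of v] by simp
    then obtain n where n: "\<And>v. L (s v) = gpow n (L v)" using hlift_unique[OF L] by blast
    \<comment> \<open>The monodromy is tested on the loop x = 1 around w = 0. That it bounds a disc
      in U_0 shows in \<open>LL0\<close>, whose right-hand side depends on z only through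
      \<open>exp z\<close>.\<close>
    have "L (s (vec2 0 1)) = L (vec2 0 1)"
      unfolding s_def using LL0[of 1 "0 + 2 * of_int l * of_real pi * \<i>"] LL0[of 1 0] e[of 0] by simp
    then have "gpow 0 (L (vec2 0 1)) = gpow n (L (vec2 0 1))" using n by simp
    then have "n = 0" using gpow_inj[OF LW(1)] by metis
    then show ?thesis using n[of "vec2 z x"] by (simp add: s_def)
  qed
  have per: "L (vec2 z x) = L (vec2 z' x)" if "exp z = exp z'" for z z' x
  proof -
    obtain l :: int where "z = z' + of_real (of_int (2 * l) * pi) * \<i>"
      using \<open>exp z = exp z'\<close> unfolding exp_eq by blast
    then have "z = z' + 2 * of_int l * of_real pi * \<i>" by simp
    then show ?thesis using per1[of z' l x] by simp
  qed
  define \<Psi> where "\<Psi> P = L (vec2 (Ln (w_of P)) (x_of P))" for P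
  have \<Psi>: "\<Psi> (V_pt (exp z) x) = L (vec2 z x)" for z x
    unfolding \<Psi>_def using per[of "Ln (exp z)" z x] by simp
  have a: "\<Psi> (V_pt w x) \<in> points W \<and> w_of (\<Psi> (V_pt w x)) \<noteq> 0 \<and> pr (\<Psi> (V_pt w x)) = f (upt w x)"
    if "w \<noteq> 0" for w x
    using LW[of "vec2 (Ln w) x"] Lw[of "vec2 (Ln w) x"] \<open>w \<noteq> 0\<close> by (simp add: \<Psi>_def)

  have b: "holo_at (\<lambda>v. w_of (\<Psi> (V_param v))) v0 \<and> holo_at (\<lambda>v. x_of (\<Psi> (V_param v))) v0"
    if v0: "v0 $ 1 \<noteq> 0" for v0 :: "complex^2"
  proof -
    \<comment> \<open>A branch of the logarithm that is holomorphic near \<open>v0\<close>; the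
      principal branch in the definition of \<Psi> may jump there.\<close>
    define t where "t v = vec2 (Ln (v $ 1 * inverse (v0 $ 1)) + Ln (v0 $ 1)) (v $ 2)" for v :: "complex^2"
    define B where "B = (\<lambda>v::complex^2. v $ 1 * inverse (v0 $ 1)) -` ball 1 1"
    have B: "open B" unfolding B_def by (intro open_vimage continuous_intros) auto
    have v0B: "v0 \<in> B" using v0 by (simp add: B_def)
    have pos: "Re u > 0" if "u \<in> ball 1 1" for u :: complex
    proof -
      have "norm (1 - u) < 1" using that by (simp add: dist_norm)
      then show ?thesis using complex_Re_le_cmod[of "1 - u"] by simp
    qed
    have Ln_v: "holo_at (\<lambda>v. Ln (v $ 1 * inverse (v0 $ 1))) v" if "v \<in> B" for v
    proof (rule holo_at_compose[OF holo_at_mult[OF holo_at_nth holo_at_const] field_differentiable_at_Ln])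
      have "Re (v $ 1 * inverse (v0 $ 1)) > 0" using that pos by (simp only: B_def vimage_eq)
      then show "v $ 1 * inverse (v0 $ 1) \<notin> \<real>\<^sub>\<le>\<^sub>0" by (auto simp only: complex_nonpos_Reals_iff not_le)
    qed
    have t: "holo_on t B" unfolding t_def
      by (intro holo_on_vec2 holo_at_nth holo_at_add holo_at_const Ln_v)
    have eq: "\<Psi> (V_param v) = L (t v)" if "v \<in> B" for v
    proof -
      have "v $ 1 * inverse (v0 $ 1) \<noteq> 0" using pos[of "v $ 1 * inverse (v0 $ 1)"] that by (auto simp: B_def)
      then have "exp (t v $ 1) = v $ 1" using v0 by (simp add: t_def exp_add)
      then show ?thesis using \<Psi>[of "t v $ 1" "v $ 2"] by (simp add: V_param_def t_def)
    qed
    have h: "holo_at (\<lambda>v. w_of (L (t v))) v0" "holo_at (\<lambda>v. x_of (L (t v))) v0"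
      by (rule holo_on_compose_holo_at[OF t v0B], rule hlift_holo_at_w[OF L],
          rule holo_on_compose_holo_at[OF t v0B], rule hlift_holo_at_x[OF L Lw])
    show ?thesis
      using holo_at_cong_open[OF h(1) B v0B] holo_at_cong_open[OF h(2) B v0B] eq by simp
  qed

  \<comment> \<open>The lift of \<gamma> to the coordinates (log w, x).\<close>
  define s where "s v = vec2 (v $ 1 + Ln \<alpha>) (exp (of_nat m * v $ 1) * v $ 2)" for v :: "complex^2"
  have s: "holo_on s UNIV"
    unfolding s_def by (intro holo_on_vec2 holo_at_nth holo_at_add holo_at_const holo_at_mult holo_at_exp)
  have "pr (V_param (\<epsilon> (s v))) = pr (V_param (\<epsilon> v))" for v
    using upt_gamma[of "exp (v $ 1)" "v $ 2"]
    by (simp add: V_param_def \<epsilon>_def s_def upt_pr exp_add exp_of_nat_mult mult.commute)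
  then have "hlift (\<lambda>u. f (pr (V_param (\<epsilon> u)))) (\<lambda>u. L (s u)) v" for v
    using hlift_compose[OF L s open_UNIV UNIV_I, of v] by simp
  then obtain n where n: "\<And>v. L (s v) = gpow n (L v)" using hlift_unique[OF L] by blast
  have c: "\<Psi> (gpow 1 (V_pt w x)) = gpow n (\<Psi> (V_pt w x))" if "w \<noteq> 0" for w x
  proof -
    have "gpow 1 (V_pt w x) = V_pt (exp (Ln w + Ln \<alpha>)) (exp (of_nat m * Ln w) * x)"
      using that by (simp add: gpow_V_pt exp_add exp_of_nat_mult mult.commute)
    then have "\<Psi> (gpow 1 (V_pt w x)) = L (s (vec2 (Ln w) x))"
      unfolding \<Psi>[symmetric] s_def by simp
    also have "\<dots> = gpow n (L (vec2 (Ln w) x))" by (rule n)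
    also have "L (vec2 (Ln w) x) = \<Psi> (V_pt w x)" using \<Psi>[of "Ln w" x] that by simp
    finally show ?thesis .
  qed

  \<comment> \<open>f maps the axes of U_0 into the cycle, so w of the lift vanishes on them; this
    yields the last conjunct of \<open>V_lift\<close>.\<close>
  define A where "A x y = w_of (L0 (vec2 x y))" for x y
  have A0: "A x y = 0" if "x * y = 0" for x y
  proof -
    have "pr (U_pt 0 x y) \<in> Inoue_cycle m \<alpha>" using that by (simp add: pr_in_cycle)
    then have "pr (L0 (vec2 x y)) \<in> Inoue_cycle m \<alpha>"
      using fC hliftD[OF L0, of "vec2 x y"] by (simp add: U_param_def)
    then show ?thesis using pr_in_cycle hliftD(1)[OF L0] by (simp add: A_def)
  qed
  have "continuous_on UNIV (\<lambda>v. w_of (L0 v))"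
    using holo_at_continuous hlift_holo_at_w[OF L0] continuous_at_imp_continuous_on by blast
  then have "continuous_on UNIV (\<lambda>p. A (fst p) (snd p))"
    unfolding A_def by (rule continuous_on_compose2) (auto intro!: continuous_intros)
  then obtain M where M: "\<And>x y. norm x \<le> 1 \<Longrightarrow> norm y \<le> 1 \<Longrightarrow> norm (A x y) \<le> M * norm (x * y)"
  proof (rule vanishing_on_axes_bound)
    show "(\<lambda>x. A x y) holomorphic_on UNIV" "A x holomorphic_on UNIV" for x y
      unfolding A_def using hlift_w_holomorphic[OF L0] by auto
  qed (use A0 in auto)
  have "norm (w_of (\<Psi> (U_pt 0 x y))) \<le> (norm (\<alpha> powi n0) * M) * norm (x * y)"
    if "x \<noteq> 0" "y \<noteq> 0" "norm x \<le> 1" "norm y \<le> 1" for x y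
  proof -
    have "U_pt 0 x y = V_pt (exp (Ln (x * y))) x" using that by (simp add: U_pt_eq_V_pt)
    then have "\<Psi> (U_pt 0 x y) = gpow n0 (L0 (vec2 x y))"
      using \<Psi>[of "Ln (x * y)" x] LL0[OF that(1), of "Ln (x * y)"] that by simp
    then have "norm (w_of (\<Psi> (U_pt 0 x y))) = norm (\<alpha> powi n0) * norm (A x y)"
      using hliftD(1)[OF L0] by (simp add: A_def norm_mult)
    then show ?thesis
      using mult_left_mono[OF M[OF that(3,4)], of "norm (\<alpha> powi n0)"] by (simp add: mult.assoc)
  qed
  then have "V_lift f \<Psi> n" unfolding V_lift_def using a b c by blast
  then show ?thesis by blast
qed

lemma V_liftD:
  assumes "V_lift f \<Psi> n" "w \<noteq> 0"
  shows "\<Psi> (V_pt w x) \<in> points W" "w_of (\<Psi> (V_pt w x)) \<noteq> 0" "pr (\<Psi> (V_pt w x)) = f (upt w x)"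
    "\<Psi> (gpow 1 (V_pt w x)) = gpow n (\<Psi> (V_pt w x))"
  using assms unfolding V_lift_def by blast+

lemma V_lift_holo_at:
  assumes "V_lift f \<Psi> n" "(v::complex^2) $ 1 \<noteq> 0"
  shows "holo_at (\<lambda>v. w_of (\<Psi> (V_param v))) v" "holo_at (\<lambda>v. x_of (\<Psi> (V_param v))) v"
  using assms unfolding V_lift_def by blast+

lemma V_lift_coordinates:
  assumes "V_lift f \<Psi> n" "w \<noteq> 0"
  shows "\<Psi> (V_pt w x) = V_pt (w_of (\<Psi> (V_pt w x))) (x_of (\<Psi> (V_pt w x)))"
  using V_pt_coordinates V_liftD(1,2)[OF assms] by blast

lemma V_lift_entire:
  assumes "V_lift f \<Psi> n"
  shows "w \<noteq> 0 \<Longrightarrow> (\<lambda>x. w_of (\<Psi> (V_pt w x))) holomorphic_on UNIV"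
    "w \<noteq> 0 \<Longrightarrow> (\<lambda>x. x_of (\<Psi> (V_pt w x))) holomorphic_on UNIV"
    "(\<lambda>w. w_of (\<Psi> (V_pt w x))) holomorphic_on - {0}"
    "(\<lambda>w. x_of (\<Psi> (V_pt w x))) holomorphic_on - {0}"
proof -
  have *: "(\<lambda>x. w_of (\<Psi> (V_pt w x))) field_differentiable (at x)" "(\<lambda>x. x_of (\<Psi> (V_pt w x))) field_differentiable (at x)"
     "(\<lambda>w. w_of (\<Psi> (V_pt w x))) field_differentiable (at w)" "(\<lambda>w. x_of (\<Psi> (V_pt w x))) field_differentiable (at w)"
    if "w \<noteq> 0" for w x
    using holo_at_curve[OF V_lift_holo_at(1)[OF assms], of "\<lambda>_. w" x "\<lambda>x. x"]
      holo_at_curve[OF V_lift_holo_at(2)[OF assms], of "\<lambda>_. w" x "\<lambda>x. x"]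
      holo_at_curve[OF V_lift_holo_at(1)[OF assms], of "\<lambda>w. w" w "\<lambda>_. x"]
      holo_at_curve[OF V_lift_holo_at(2)[OF assms], of "\<lambda>w. w" w "\<lambda>_. x"] that
    by (simp_all add: V_param_def)
  show "(\<lambda>x. w_of (\<Psi> (V_pt w x))) holomorphic_on UNIV" "(\<lambda>x. x_of (\<Psi> (V_pt w x))) holomorphic_on UNIV"
    if "w \<noteq> 0" using *(1,2)[OF that] by (simp_all add: holomorphic_on_def)
  show "(\<lambda>w. w_of (\<Psi> (V_pt w x))) holomorphic_on - {0}" "(\<lambda>w. x_of (\<Psi> (V_pt w x))) holomorphic_on - {0}"
    unfolding holomorphic_on_def
    by (rule ballI, rule field_differentiable_at_within, rule *(3), simp)
       (rule ballI, rule field_differentiable_at_within, rule *(4), simp)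
qed

lemma V_lift_gpow:
  assumes "V_lift f \<Psi> n" "w \<noteq> 0"
  shows "\<Psi> (gpow k (V_pt w x)) = gpow (n * k) (\<Psi> (V_pt w x))"
proof (induction k rule: int_induct[where k = 0])
  case base then show ?case by simp
next
  have step: "\<Psi> (gpow (i + 1) (V_pt w x)) = gpow n (\<Psi> (gpow i (V_pt w x)))" for i
  proof -
    obtain w' x' where e: "gpow i (V_pt w x) = V_pt w' x'" "w' \<noteq> 0"
      using gpow_V_pt[OF assms(2), of i x] assms(2) by simp
    have "gpow (i + 1) (V_pt w x) = gpow 1 (gpow i (V_pt w x))"
      using assms(2) by (simp add: add.commute)
    then show ?thesis unfolding e(1) using V_liftD(4)[OF assms(1) e(2)] by simp
  qed
  {
    case (step1 i)
    then show ?case using step[of i] V_liftD(1)[OF assms] by (simp add: algebra_simps)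
  next
    case (step2 i)
    have "gpow i (V_pt w x) = gpow (i - 1 + 1) (V_pt w x)" by simp
    then have "gpow n (\<Psi> (gpow (i - 1) (V_pt w x))) = gpow (n * i) (\<Psi> (V_pt w x))"
      using step[of "i - 1"] step2 by simp
    then have "gpow (-n) (gpow n (\<Psi> (gpow (i - 1) (V_pt w x)))) = gpow (-n) (gpow (n * i) (\<Psi> (V_pt w x)))"
      by simp
    moreover have "\<Psi> (gpow (i - 1) (V_pt w x)) \<in> points W"
      using V_liftD(1)[OF assms(1), of "\<alpha> powi (i - 1) * w"] assms(2) by (simp add: gpow_V_pt)
    ultimately show ?case using V_liftD(1)[OF assms] by (simp add: algebra_simps)
  }
qed

text \<open>The composition \<open>\<Psi>' \<circ> \<Psi>\<close> of the two lifts is a deck transformation \<open>\<gamma>\<^sup>j\<close>, where \<open>j\<close> is constant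
  because it is read off continuously from \<open>|w|\<close>.\<close>

lemma V_lift_degree_inverse:
  assumes \<Psi>: "V_lift f \<Psi> n" and \<Psi>': "V_lift f' \<Psi>' n'"
    and inv: "\<And>p. p \<in> points U \<Longrightarrow> f' (f p) = p"
  shows "n' * n = 1"
proof -
  define \<epsilon> where "\<epsilon> v = vec2 (exp (v $ 1)) (v $ 2)" for v :: "complex^2"
  define t where "t v = vec2 (w_of (\<Psi> (V_param v))) (x_of (\<Psi> (V_param v)))" for v
  have \<epsilon>: "holo_on \<epsilon> UNIV" unfolding \<epsilon>_def by (intro holo_on_vec2 holo_at_nth holo_at_exp)
  have t: "holo_on t {v::complex^2. v $ 1 \<noteq> 0}"
    unfolding t_def by (intro holo_on_vec2 V_lift_holo_at[OF \<Psi>]) auto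
  have t\<epsilon>: "holo_on (t \<circ> \<epsilon>) UNIV"
    by (rule holo_on_compose[OF \<epsilon> t]) (auto simp: \<epsilon>_def)
  have nz: "t (\<epsilon> v) $ 1 \<noteq> 0" for v
    using V_liftD(2)[OF \<Psi>, of "exp (v $ 1)"] by (simp add: t_def \<epsilon>_def V_param_def)
  define Q where "Q v = \<Psi>' (V_param (t (\<epsilon> v)))" for v
  have Q: "Q v = \<Psi>' (\<Psi> (V_param (\<epsilon> v)))" for v
    unfolding Q_def using V_lift_coordinates[OF \<Psi>, of "exp (v $ 1)" "v $ 2"]
    by (simp add: t_def \<epsilon>_def V_param_def)
  have "\<exists>j. Q v = gpow j (V_param (\<epsilon> v))" for v
  proof -
    let ?w = "exp (v $ 1)" and ?x = "v $ 2"
    let ?w' = "w_of (\<Psi> (V_pt ?w ?x))" and ?x' = "x_of (\<Psi> (V_pt ?w ?x))"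
    have w': "?w' \<noteq> 0" using V_liftD(2)[OF \<Psi>] by simp
    have "pr (\<Psi>' (V_pt ?w' ?x')) = f' (upt ?w' ?x')" using V_liftD(3)[OF \<Psi>' w'] .
    also have "upt ?w' ?x' = f (upt ?w ?x)"
      using V_liftD(3)[OF \<Psi>, of ?w ?x] V_lift_coordinates[OF \<Psi>, of ?w ?x] by (simp add: upt_pr)
    also have "f' (f (upt ?w ?x)) = upt ?w ?x" by (rule inv) simp
    finally have "pr (V_pt ?w ?x) = pr (\<Psi>' (V_pt ?w' ?x'))" by (simp add: upt_pr)
    then show ?thesis
      using pr_eq_iff[of "V_pt ?w ?x" "\<Psi>' (V_pt ?w' ?x')"] V_liftD(1)[OF \<Psi>' w']
      by (simp add: Q_def t_def \<epsilon>_def V_param_def)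
  qed
  then obtain j where j: "\<And>v. Q v = gpow (j v) (V_param (\<epsilon> v))" by metis
  have VW: "V_param (\<epsilon> v) \<in> points W" for v by (simp add: V_param_def \<epsilon>_def)
  have ln_powi: "ln (t powi k) = of_int k * ln t" if "t > 0" for t :: real and k
    using that by (simp add: powr_real_of_int'[symmetric] ln_powr)
  have wQ: "norm (w_of (Q v)) = norm \<alpha> powi j v * norm (exp (v $ 1))" for v
    using VW unfolding j by (simp add: norm_mult norm_power_int) (simp add: V_param_def \<epsilon>_def)
  have "j v = j u" for u v
  proof -
    define q where "q v = ln (norm (w_of (Q v)) / norm (exp (v $ 1))) / ln (norm \<alpha>)" for v
    have q: "q v = of_int (j v)" for v
      using \<alpha>_pos \<alpha>_less_1 unfolding q_def wQ by (simp add: ln_powi)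
    have "holo_at (\<lambda>v. w_of (Q v)) v" for v
      unfolding Q_def
      using holo_on_compose_holo_at[OF t\<epsilon> UNIV_I, of "\<lambda>v. w_of (\<Psi>' (V_param v))" v]
        V_lift_holo_at(1)[OF \<Psi>', of "t (\<epsilon> v)"] nz by simp
    then have "continuous_on UNIV (\<lambda>v. w_of (Q v))"
      by (simp add: continuous_at_imp_continuous_on holo_at_continuous)
    moreover have "w_of (Q v) \<noteq> 0" for v using wQ[of v] \<alpha>_pos by auto
    ultimately have "continuous_on UNIV q"
      unfolding q_def using \<alpha>_pos \<alpha>_less_1 by (intro continuous_intros) auto
    then have "q constant_on UNIV"
    proof (rule continuous_discrete_range_constant[OF connected_UNIV])
      fix x
      have "1 \<le> norm (q y - q x)" if "q y \<noteq> q x" for y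
        using that unfolding q by (simp flip: of_int_diff of_int_abs)
      then show "\<exists>e>0. \<forall>y. y \<in> UNIV \<and> q y \<noteq> q x \<longrightarrow> e \<le> norm (q y - q x)"
        by (intro exI[of _ 1]) auto
    qed
    then have "q v = q u" by (auto simp: constant_on_def)
    then show ?thesis by (simp add: q)
  qed
  then obtain j0 where j0: "\<And>v. Q v = gpow j0 (V_param (\<epsilon> v))" using j by metis
  have Qw: "\<Psi>' (\<Psi> (V_pt w x)) = gpow j0 (V_pt w x)" if "w \<noteq> 0" for w x
    using j0[of "vec2 (Ln w) x"] that unfolding Q by (simp add: V_param_def \<epsilon>_def)
  \<comment> \<open>The image of (\<alpha>, 0) = \<gamma>(1, 0) under \<Psi>' \<circ> \<Psi> is
    computed in two ways; freeness then compares the exponents n' n + j0 and j0 + 1.\<close>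
  have "gpow (n' * n) (\<Psi>' (\<Psi> (V_pt 1 0))) = \<Psi>' (gpow n (\<Psi> (V_pt 1 0)))"
    using V_lift_gpow[OF \<Psi>', of "w_of (\<Psi> (V_pt 1 0))" n "x_of (\<Psi> (V_pt 1 0))"] V_liftD(2)[OF \<Psi>, of 1 0]
    unfolding V_lift_coordinates[OF \<Psi> one_neq_zero, symmetric] by simp
  also have "\<dots> = \<Psi>' (\<Psi> (V_pt \<alpha> 0))"
    using V_liftD(4)[OF \<Psi>, of 1 0] by (simp add: gpow_V_pt)
  also have "\<dots> = gpow j0 (gpow 1 (V_pt 1 0))" using Qw[of \<alpha> 0] by (simp add: gpow_V_pt)
  finally have "gpow (n' * n + j0) (V_pt 1 0) = gpow (j0 + 1) (V_pt 1 0)"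
    using Qw[of 1 0] by simp
  then show ?thesis using gpow_inj[of "V_pt 1 0"] by simp
qed

section \<open>Rigidity of w \<circ> \<Psi>\<close>

lemma exists_small_power:
  assumes "e > 0"
  obtains k :: nat where "norm (\<alpha> ^ k * w) < e"
proof -
  have "(\<lambda>k. norm \<alpha> ^ k * norm w) \<longlonglongrightarrow> 0 * norm w"
    using \<alpha>_less_1 by (intro tendsto_intros LIMSEQ_power_zero) auto
  then have "eventually (\<lambda>k. norm \<alpha> ^ k * norm w < e) sequentially"
    using assms by (intro order_tendstoD) auto
  then obtain k where "norm \<alpha> ^ k * norm w < e" by (auto simp: eventually_sequentially)
  then show ?thesis using that by (simp add: norm_mult norm_power)
qed

text \<open>The quotient \<open>w\<^sup>-\<^sup>n (w \<circ> \<Psi>)\<close> is invariant under the deck group and, for \<open>n \<le> 1\<close>, bounded near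
  the cycle. On the fiber over \<open>w\<close>, points of \<open>U\<^sub>0\<close> with \<open>|x\<^sub>0| = 1\<close> occur, up to the deck
  group, along circles of arbitrarily large radius, so the maximum principle applies.\<close>

lemma V_lift_translation:
  assumes \<Psi>: "V_lift f \<Psi> n" and n: "n \<le> 1"
  obtains c where "c \<noteq> 0" "n = 1" "\<And>w x. w \<noteq> 0 \<Longrightarrow> w_of (\<Psi> (V_pt w x)) = c * w"
proof -
  define a where "a = norm \<alpha>"
  have a: "0 < a" "a < 1" using \<alpha>_pos \<alpha>_less_1 by (auto simp: a_def)
  define R where "R P = w_of (\<Psi> P) * w_of P powi (-n)" for P
  have "\<exists>M. \<forall>x y. x \<noteq> 0 \<longrightarrow> y \<noteq> 0 \<longrightarrow> norm x \<le> 1 \<longrightarrow> norm y \<le> 1 \<longrightarrow>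
        norm (w_of (\<Psi> (U_pt 0 x y))) \<le> M * norm (x * y)"
    using \<Psi> unfolding V_lift_def by (elim conjE)
  then obtain M0 where M0: "\<forall>x y. x \<noteq> 0 \<longrightarrow> y \<noteq> 0 \<longrightarrow> norm x \<le> 1 \<longrightarrow> norm y \<le> 1 \<longrightarrow>
        norm (w_of (\<Psi> (U_pt 0 x y))) \<le> M0 * norm (x * y)" ..
  define M where "M = \<bar>M0\<bar>"
  have M: "norm (w_of (\<Psi> (U_pt 0 x y))) \<le> M * norm (x * y)"
    if "x \<noteq> 0" "y \<noteq> 0" "norm x \<le> 1" "norm y \<le> 1" for x y
    using M0[rule_format, OF that] mult_right_mono[OF abs_ge_self[of M0] norm_ge_zero[of "x * y"]] unfolding M_def by linarith
  have RU: "norm (R (U_pt 0 x y)) \<le> M" if "x \<noteq> 0" "y \<noteq> 0" "norm x \<le> 1" "norm y \<le> 1" for x y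
  proof -
    have p: "norm (x * y) > 0" "norm (x * y) \<le> 1"
      using that by (auto simp: norm_mult mult_le_one)
    have "norm (R (U_pt 0 x y)) \<le> M * norm (x * y) * norm (x * y) powi (-n)"
      unfolding R_def norm_mult[of "w_of _"] norm_power_int w_of_simps
      by (intro mult_right_mono M that) auto
    also have "\<dots> = M * norm (x * y) powi (1 + - n)"
      using p by (subst power_int_add) auto
    \<comment> \<open>The exponent 1 - n is nonnegative; this is where n \<le> 1 enters.\<close>
    also have "\<dots> \<le> M * 1"
      using p n by (intro mult_left_mono) (auto simp: M_def power_int_def power_le_one)
    finally show ?thesis by simp
  qed
  have Rg: "R (gpow k (V_pt w x)) = R (V_pt w x)" if "w \<noteq> 0" for k w x
  proof -
    have "R (gpow k (V_pt w x)) = \<alpha> powi (n * k) * w_of (\<Psi> (V_pt w x)) * (\<alpha> powi k * w) powi (-n)"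
      using that V_lift_gpow[OF \<Psi> that] V_liftD(1)[OF \<Psi> that] by (simp add: R_def)
    also have "(\<alpha> powi k * w) powi (-n) = inverse (\<alpha> powi (n * k)) * w powi (-n)"
      by (simp add: power_int_mult_distrib power_int_minus power_int_mult[symmetric] mult.commute)
    finally show ?thesis by (simp add: R_def)
  qed
  have Rx: "(\<lambda>x. R (V_pt w x)) holomorphic_on UNIV" if "w \<noteq> 0" for w
    unfolding R_def using V_lift_entire(1)[OF \<Psi> that] by (auto intro: holomorphic_intros)
  have bound1: "norm (R (V_pt w x)) \<le> M" if w: "w \<noteq> 0" "norm w \<le> 1" for w x
  proof -
    \<comment> \<open>\<gamma>^l scales the norm on the fiber over w by the factor \<open>s\<close>
      below, and l is so large that the circle of radius 1/s, which lands on |x_0| = 1, encloses x.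
      Taking l = l0 + 1 ensures \<open>triangular l\<close> \<ge> l0.\<close>
    obtain l0 where l0: "norm (\<alpha> ^ l0 * of_real (norm x + 1)) < 1"
      using exists_small_power[of 1 "of_real (norm x + 1)"] by auto
    define l where "l = int l0 + 1"
    define s where "s = a powi (int m * triangular l) * norm w powi (int m * l)"
    have s: "s > 0" using a w by (simp add: s_def)
    have "triangular l \<ge> int l0"
    proof -
      have "2 * triangular l = l * (l - 1)" unfolding triangular_def by simp
      moreover have "l * (l - 1) \<ge> 2 * int l0"
        by (cases l0) (auto simp: l_def algebra_simps)
      ultimately show ?thesis by linarith
    qed
    also have "triangular l \<le> int m * triangular l"
      using m_pos triangular_nonneg[of l] mult_right_mono[of 1 "int m" "triangular l"] by simp
    finally have "nat (int m * triangular l) \<ge> l0" "int m * triangular l \<ge> 0" by auto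
    then have "a powi (int m * triangular l) \<le> a ^ l0"
      using a by (simp add: power_int_def power_decreasing)
    moreover have "norm w powi (int m * l) \<le> 1"
      using w by (simp add: power_int_def l_def power_le_one)
    ultimately have "s \<le> a ^ l0 * 1" unfolding s_def using a w by (intro mult_mono) auto
    then have "s * (norm x + 1) < 1"
      using l0 mult_right_mono[of s "a ^ l0" "norm x + 1"] by (simp add: norm_mult norm_power a_def)
    then have xs: "norm x < inverse s"
      using s by (simp add: field_simps)
    show ?thesis
    proof (rule maximum_modulus_frontier[of "\<lambda>x. R (V_pt w x)" "ball 0 (inverse s)"])
      show "(\<lambda>x. R (V_pt w x)) holomorphic_on interior (ball 0 (inverse s))"
        using Rx[OF w(1)] holomorphic_on_subset by blast
      show "continuous_on (closure (ball 0 (inverse s))) (\<lambda>x. R (V_pt w x))"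
        by (rule entire_continuous_on[OF Rx[OF w(1)]])
      show "norm (R (V_pt w y)) \<le> M" if "y \<in> frontier (ball 0 (inverse s))" for y
      proof -
        have ny: "norm y = inverse s" using that s by (simp add: frontier_ball)
        then have y0: "y \<noteq> 0" using s by auto
        define w' where "w' = \<alpha> powi l * w"
        define y' where "y' = \<alpha> powi (int m * triangular l) * w powi (int m * l) * y"
        have nz: "w' \<noteq> 0" "y' \<noteq> 0" using w y0 by (auto simp: w'_def y'_def)
        have "norm y' = s * norm y" by (simp add: y'_def s_def norm_mult norm_power_int a_def)
        then have y'1: "norm y' = 1" using s ny by simp
        have "norm (\<alpha> powi l) \<le> 1" using norm_\<alpha>_powi(1)[of l] \<alpha>_less_1 by (simp add: l_def)
        then have "norm w' \<le> 1" using w by (simp add: w'_def norm_mult mult_le_one)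
        then have w'y': "norm (w' * inverse y') \<le> 1" using y'1 by (simp add: norm_mult norm_inverse)
        have "R (V_pt w y) = R (V_pt w' y')"
          using Rg[OF w(1), of l y] w by (simp add: gpow_V_pt w'_def y'_def)
        also have "V_pt w' y' = U_pt 0 y' (w' * inverse y')"
          using V_pt_eq_U_pt[OF nz, of 0] by simp
        finally show ?thesis using RU[of y' "w' * inverse y'"] nz y'1 w'y' by simp
      qed
      show "x \<in> ball 0 (inverse s)" using xs by simp
    qed auto
  qed
  have bound: "norm (R (V_pt w x)) \<le> M" if w: "w \<noteq> 0" for w x
  proof -
    obtain k where "norm (\<alpha> ^ k * w) < 1" using exists_small_power[of 1 w] by auto
    then have "norm (R (gpow (int k) (V_pt w x))) \<le> M"
      using w bound1[of "\<alpha> ^ k * w"] by (simp add: gpow_V_pt)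
    then show ?thesis using Rg[OF w] by simp
  qed
  define c where "c = R (V_pt 1 0)"
  \<comment> \<open>Liouville is used twice: along the fiber, and on the zero section in the
    variable log w.\<close>
  have R_const: "R (V_pt w x) = c" if w: "w \<noteq> 0" for w x
  proof -
    have "R (V_pt w x) = R (V_pt w 0)"
      using bounded_entire_constant[OF Rx[OF w]] bound[OF w] by blast
    also have "\<dots> = R (V_pt (exp (Ln w)) 0)" using w by simp
    also have "\<dots> = R (V_pt (exp 0) 0)"
    proof (rule bounded_entire_constant[where f = "\<lambda>z. R (V_pt (exp z) 0)"])
      have "(\<lambda>z. w_of (\<Psi> (V_pt (exp z) 0))) holomorphic_on UNIV"
        by (rule holomorphic_on_compose_gen[OF _ V_lift_entire(3)[OF \<Psi>], unfolded o_def])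
           (auto intro: holomorphic_intros)
      then show "(\<lambda>z. R (V_pt (exp z) 0)) holomorphic_on UNIV"
        unfolding R_def by (auto intro!: holomorphic_intros)
    qed (rule bound, simp)
    finally show ?thesis by (simp add: c_def)
  qed
  have eq: "w_of (\<Psi> (V_pt w x)) = c * w powi n" if "w \<noteq> 0" for w x
    using R_const[OF that, of x] that by (simp add: R_def power_int_minus field_simps)
  have c0: "c \<noteq> 0" using V_liftD(2)[OF \<Psi>, of 1 0] eq[of 1 0] by auto
  have "\<not> n \<le> 0"
  proof
    assume n0: "n \<le> 0"
    \<comment> \<open>At the point x = 1, w = r the bound along the cycle is \<open>M * r\<close>,
      less than |c|, while for n \<le> 0 the value c w^n has norm at least |c|.\<close>
    define r where "r = min 1 (norm c / (2 * (M + 1)))"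
    have M0: "M \<ge> 0" by (simp add: M_def)
    have r: "0 < r" "r \<le> 1" "M * r < norm c"
    proof -
      show "0 < r" "r \<le> 1" using c0 M0 by (auto simp: r_def)
      have "M * r \<le> M * (norm c / (2 * (M + 1)))" using M0 by (intro mult_left_mono) (auto simp: r_def)
      also have "\<dots> < norm c" using M0 c0 by (simp add: field_simps) (smt (verit) mult_nonneg_nonneg norm_ge_zero zero_less_norm_iff)
      finally show "M * r < norm c" .
    qed
    have "norm (w_of (\<Psi> (U_pt 0 1 (of_real r)))) \<le> M * r"
      using M[of 1 "of_real r"] r by simp
    moreover have "U_pt 0 1 (of_real r) = V_pt (of_real r) 1" using r by (simp add: U_pt_eq_V_pt)
    ultimately have "norm c * r powi n \<le> M * r"
      using eq[of "of_real r" 1] r by (simp add: norm_mult norm_power_int)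
    moreover have "r powi n \<ge> 1"
      using n0 r by (auto simp: power_int_def power_inverse[symmetric] one_le_inverse power_le_one intro!: one_le_power)
    then have "norm c * 1 \<le> norm c * r powi n" by (intro mult_left_mono) auto
    ultimately show False using r by linarith
  qed
  with n have "n = 1" by simp
  then show ?thesis using that c0 eq by simp
qed

end

section \<open>Automorphisms are determined on the complement of the cycle\<close>

context parabolic_Inoue_data
begin

text \<open>Approaches v from off the axes: shifting by the distinct numbers 1/(i+1), each
  coordinate vanishes for at most one i.\<close>

definition generic_seq :: "complex^2 \<Rightarrow> nat \<Rightarrow> complex^2" where
  "generic_seq v i = vec2 (v $ 1 + of_real (inverse (of_nat (Suc i)))) (v $ 2 + of_real (inverse (of_nat (Suc i))))"

lemma generic_seq_tendsto: "generic_seq v \<longlonglongrightarrow> v"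
proof -
  have 1: "(\<lambda>i. c + of_real (inverse (of_nat (Suc i)))) \<longlonglongrightarrow> c + of_real 0" for c :: complex
    by (intro tendsto_intros LIMSEQ_inverse_real_of_nat)
  have "(\<lambda>i. (generic_seq v i) $ k) \<longlonglongrightarrow> v $ k" for k
    using 1[of "v $ 1"] 1[of "v $ 2"] exhaust_2[of k] by (auto simp: generic_seq_def)
  then show ?thesis by (rule vec_tendstoI)
qed

lemma generic_seq_generic:
  "eventually (\<lambda>i. (generic_seq v i) $ 1 \<noteq> 0 \<and> (generic_seq v i) $ 2 \<noteq> 0) sequentially"
proof -
  have *: "eventually (\<lambda>i. c + complex_of_real (inverse (of_nat (Suc i))) \<noteq> 0) sequentially" for c
  proof (cases "c = 0")
    case True
    have "complex_of_real (inverse (of_nat (Suc i))) \<noteq> 0" for i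
      by (simp del: of_nat_Suc)
    then show ?thesis unfolding True by simp
  next
    case False
    have "(\<lambda>i. c + complex_of_real (inverse (of_nat (Suc i)))) \<longlonglongrightarrow> c + of_real 0"
      by (intro tendsto_intros LIMSEQ_inverse_real_of_nat)
    then show ?thesis using False tendsto_imp_eventually_ne[of _ "c + of_real 0" sequentially 0] by simp
  qed
  show ?thesis using *[of "v $ 1"] *[of "v $ 2"] by eventually_elim (simp add: generic_seq_def)
qed

text \<open>The Hausdorff property of W in sequential form, for limits in U-charts; it rests on the
  closed equations of \<open>U_pt_eq_U_pt\<close>.\<close>

lemma U_pt_limit_unique:
  assumes lim: "x \<longlonglongrightarrow> x0" "y \<longlonglongrightarrow> y0" "x' \<longlonglongrightarrow> x0'" "y' \<longlonglongrightarrow> y0'"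
    and eq: "eventually (\<lambda>i. U_pt k (x i) (y i) = U_pt l (x' i) (y' i)) sequentially"
  shows "U_pt k x0 y0 = U_pt l x0' y0'"
proof -
  have *: "U_pt k x0 y0 = U_pt (k + int d) x0' y0'"
    if lim: "x \<longlonglongrightarrow> x0" "y \<longlonglongrightarrow> y0" "x' \<longlonglongrightarrow> x0'" "y' \<longlonglongrightarrow> y0'"
      and eq: "eventually (\<lambda>i. U_pt k (x i) (y i) = U_pt (k + int d) (x' i) (y' i)) sequentially"
    for k d x y x' y' x0 y0 x0' y0'
  proof (cases "d = 0")
    case True
    then have "eventually (\<lambda>i. x i = x' i) sequentially" "eventually (\<lambda>i. y i = y' i) sequentially"
      using eq by (auto simp: U_pt_inj elim: eventually_mono)
    then have "x' \<longlonglongrightarrow> x0" "y' \<longlonglongrightarrow> y0" using lim(1,2) Lim_transform_eventually by blast+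
    then have "x0 = x0'" "y0 = y0'" using lim LIMSEQ_unique by blast+
    then show ?thesis using True by simp
  next
    case False
    then have d: "d \<ge> 1" by simp
    have "eventually (\<lambda>i. x' i * x i ^ (d - 1) * y i ^ d = 1) sequentially"
      using eq by eventually_elim (use U_pt_eq_U_pt[OF d] in blast)
    moreover have "(\<lambda>i. x' i * x i ^ (d - 1) * y i ^ d) \<longlonglongrightarrow> x0' * x0 ^ (d - 1) * y0 ^ d"
      by (intro tendsto_intros lim)
    ultimately have "(\<lambda>i. 1) \<longlonglongrightarrow> x0' * x0 ^ (d - 1) * y0 ^ d"
      by (rule Lim_transform_eventually[rotated])
    then have 1: "x0' * x0 ^ (d - 1) * y0 ^ d = 1" using LIMSEQ_unique tendsto_const by blast
    have "eventually (\<lambda>i. x i ^ d * y i ^ Suc d = y' i) sequentially"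
      using eq by eventually_elim (use U_pt_eq_U_pt[OF d] in metis)
    moreover have "(\<lambda>i. x i ^ d * y i ^ Suc d) \<longlonglongrightarrow> x0 ^ d * y0 ^ Suc d"
      by (intro tendsto_intros lim)
    ultimately have "y' \<longlonglongrightarrow> x0 ^ d * y0 ^ Suc d"
      by (rule Lim_transform_eventually[rotated])
    then have "y0' = x0 ^ d * y0 ^ Suc d" using lim(4) LIMSEQ_unique by blast
    with 1 show ?thesis using U_pt_eq_U_pt[OF d] by blast
  qed
  show ?thesis
  proof (cases "k \<le> l")
    case True
    then have l: "l = k + int (nat (l - k))" by simp
    show ?thesis by (subst l, rule *[OF lim]) (use eq l in simp)
  next
    case False
    then have k: "k = l + int (nat (k - l))" by simp
    have "U_pt l x0' y0' = U_pt k x0 y0"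
      by (subst k, rule *[OF lim(3,4,1,2)]) (use eq k in \<open>auto elim: eventually_mono\<close>)
    then show ?thesis by simp
  qed
qed

text \<open>Where w = 0 the local expression of a lift cannot use the chart V, so convergence can be
  read in the coordinates of one U_k.\<close>

lemma hlift_near_cycle:
  assumes "hlift G L v" "w_of (L v) = 0" "X \<longlonglongrightarrow> v"
  obtains k \<tau> where "L v = U_param k (\<tau> v)" "(\<lambda>i. \<tau> (X i)) \<longlonglongrightarrow> \<tau> v"
    "eventually (\<lambda>i. L (X i) = U_param k (\<tau> (X i))) sequentially"
proof -
  obtain D \<psi> B \<tau> where B: "(D, \<psi>) \<in> charts W" "open B" "v \<in> B" "holo_on \<tau> B" "\<tau> ` B \<subseteq> D"
     "\<forall>u\<in>B. L u = \<psi> (\<tau> u)" "\<forall>u\<in>B. pr (L u) = G u"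
    using hliftE[OF assms(1)] .
  have "continuous (at v) \<tau>"
    using holo_on_continuous[OF B(4)] B(2,3) by (simp add: continuous_on_eq_continuous_at)
  then have t: "(\<lambda>i. \<tau> (X i)) \<longlonglongrightarrow> \<tau> v" using assms(3) isCont_tendsto_compose by blast
  have e: "eventually (\<lambda>i. X i \<in> B) sequentially" using topological_tendstoD[OF assms(3) B(2,3)] .
  from B(1) show ?thesis
  proof (cases rule: charts_W_cases)
    case V
    have "\<tau> v $ 1 \<noteq> 0" using B(3,5) V by auto
    moreover have "w_of (\<psi> (\<tau> v)) = 0" using B(3,6) assms(2) by simp
    ultimately show ?thesis using V by (simp add: V_param_def)
  next
    case (U k)
    have "eventually (\<lambda>i. L (X i) = U_param k (\<tau> (X i))) sequentially"
      using e by eventually_elim (use B(6) U in simp)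
    moreover have "L v = U_param k (\<tau> v)" using B(3,6) U by simp
    ultimately show ?thesis using that t by blast
  qed
qed

text \<open>On the torus in U_k the lifts of f and f' differ by a fixed power of \<gamma>; once this
  is corrected, their limits on the axes agree too. The hypothesis on the cycle puts both limits on
  w = 0, where \<open>hlift_near_cycle\<close> applies.\<close>

lemma holomorphic_eq_on_U_imp_eq:
  assumes f: "holomorphic_map S S f" "holomorphic_map S S f'"
    and cycle: "\<And>p. p \<in> Inoue_cycle m \<alpha> \<Longrightarrow> f p \<in> Inoue_cycle m \<alpha> \<and> f' p \<in> Inoue_cycle m \<alpha>"
    and eq: "\<And>p. p \<in> points U \<Longrightarrow> f p = f' p" and p: "p \<in> points S"
  shows "f p = f' p"
proof (cases "p \<in> points U")
  case False
  then have pC: "p \<in> Inoue_cycle m \<alpha>" using p by (simp add: points_U)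
  then obtain P where P: "P \<in> points W" "w_of P = 0" "p = pr P" by (auto simp: Inoue_cycle_eq)
  obtain k y0 where k: "P = U_pt k 0 y0" using w_of_eq_0_cases'[OF P(1,2)] .
  define v where "v = vec2 0 y0"
  have pv: "p = pr (U_param k v)" by (simp add: P(3) k v_def U_param_def)
  obtain L where L: "\<And>v. hlift (\<lambda>u. f (pr (U_param k u))) L v" using U_hlift_exists[OF f(1)] by blast
  obtain L' where L': "\<And>v. hlift (\<lambda>u. f' (pr (U_param k u))) L' v" using U_hlift_exists[OF f(2)] by blast
  define \<sigma> where "\<sigma> v = vec2 (exp (v $ 1)) (exp (v $ 2))" for v :: "complex^2"
  have \<sigma>: "holo_on \<sigma> UNIV" unfolding \<sigma>_def by (intro holo_on_vec2 holo_at_nth holo_at_exp)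
  have "pr (U_param k (\<sigma> v)) \<in> points U" for v
    using pr_in_U[of "U_param k (\<sigma> v)"] by (simp add: U_param_def \<sigma>_def)
  then have G: "f' (pr (U_param k (\<sigma> v))) = f (pr (U_param k (\<sigma> v)))" for v using eq by simp
  have 1: "hlift (\<lambda>u. f (pr (U_param k (\<sigma> u)))) (\<lambda>u. L (\<sigma> u)) v" for v
    by (rule hlift_compose[OF L \<sigma>]) auto
  have 2: "hlift (\<lambda>u. f (pr (U_param k (\<sigma> u)))) (\<lambda>u. L' (\<sigma> u)) v" for v
    unfolding G[symmetric] by (rule hlift_compose[OF L' \<sigma>]) auto
  obtain n where n: "\<And>v. L' (\<sigma> v) = gpow n (L (\<sigma> v))" using hlift_unique[OF 1 2] by blast
  define L1 where "L1 v = gpow n (L v)" for v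
  have L1: "hlift (\<lambda>u. f (pr (U_param k u))) L1 v" for v
    unfolding L1_def by (rule hlift_gpow[OF L])
  have agree: "L1 u = L' u" if "u $ 1 \<noteq> 0" "u $ 2 \<noteq> 0" for u :: "complex^2"
    using n[of "vec2 (Ln (u $ 1)) (Ln (u $ 2))"] that by (simp add: \<sigma>_def L1_def)
  have fp: "pr (L1 v) = f p" "pr (L' v) = f' p"
    using hliftD(2)[OF L1, of v] hliftD(2)[OF L', of v] by (simp_all add: pv)
  have w0: "w_of (L1 v) = 0" "w_of (L' v) = 0"
    using pr_in_cycle[OF hliftD(1)[OF L1], of v] pr_in_cycle[OF hliftD(1)[OF L'], of v] fp cycle[OF pC]
    by simp_all
  obtain j \<tau> where \<tau>: "L1 v = U_param j (\<tau> v)" "(\<lambda>i. \<tau> (generic_seq v i)) \<longlonglongrightarrow> \<tau> v"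
    "eventually (\<lambda>i. L1 (generic_seq v i) = U_param j (\<tau> (generic_seq v i))) sequentially"
    using hlift_near_cycle[OF L1 w0(1) generic_seq_tendsto] .
  obtain l \<tau>' where \<tau>': "L' v = U_param l (\<tau>' v)" "(\<lambda>i. \<tau>' (generic_seq v i)) \<longlonglongrightarrow> \<tau>' v"
    "eventually (\<lambda>i. L' (generic_seq v i) = U_param l (\<tau>' (generic_seq v i))) sequentially"
    using hlift_near_cycle[OF L' w0(2) generic_seq_tendsto] .
  have "U_pt j (\<tau> v $ 1) (\<tau> v $ 2) = U_pt l (\<tau>' v $ 1) (\<tau>' v $ 2)"
  proof (rule U_pt_limit_unique)
    show "eventually (\<lambda>i. U_pt j (\<tau> (generic_seq v i) $ 1) (\<tau> (generic_seq v i) $ 2) =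
        U_pt l (\<tau>' (generic_seq v i) $ 1) (\<tau>' (generic_seq v i) $ 2)) sequentially"
      using \<tau>(3) \<tau>'(3) generic_seq_generic[of v]
      by eventually_elim (use agree in \<open>simp add: U_param_def\<close>)
  qed (intro tendsto_vec_nth \<tau>(2) \<tau>'(2))+
  then have "L1 v = L' v" using \<tau>(1) \<tau>'(1) by (simp add: U_param_def)
  then show ?thesis using fp by simp
qed (use eq in simp)

section \<open>Classification of the automorphisms\<close>

lemma mem_Aut:
  "f \<in> carrier (Aut M) \<longleftrightarrow> f \<in> Bij (points M) \<and> holomorphic_map M M f \<and> holomorphic_map M M (inv_into (points M) f)"
  by (simp add: Aut_def)

lemma Aut_inverse:
  assumes "f \<in> carrier (Aut M)" "p \<in> points M"
  shows "inv_into (points M) f (f p) = p" "f (inv_into (points M) f p) = p"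
  using assms by (auto simp: mem_Aut Bij_def bij_betw_def f_inv_into_f)

lemma Aut_cycle:
  assumes "f \<in> carrier (Aut S)" "p \<in> Inoue_cycle m \<alpha>"
  shows "f p \<in> Inoue_cycle m \<alpha>" "inv_into (points S) f p \<in> Inoue_cycle m \<alpha>"
proof -
  have b: "inj_on f (points S)" "inj_on (inv_into (points S) f) (points S)"
    using assms(1) bij_betw_inv_into by (auto simp: mem_Aut Bij_def bij_betw_def)
  show "f p \<in> Inoue_cycle m \<alpha>" "inv_into (points S) f p \<in> Inoue_cycle m \<alpha>"
    using automorphism_cycle b assms by (auto simp: mem_Aut)
qed

lemma Aut_U:
  assumes f: "f \<in> carrier (Aut S)" and p: "p \<in> points U"
  shows "f p \<in> points U" "inv_into (points S) f p \<in> points U"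
proof -
  have pS: "p \<in> points S" "p \<notin> Inoue_cycle m \<alpha>" using p by (auto simp: points_U)
  have "f p \<in> points S" "inv_into (points S) f p \<in> points S"
    using f pS(1) by (auto simp: mem_Aut Bij_def bij_betw_def inv_into_into)
  moreover have "f p \<notin> Inoue_cycle m \<alpha>" "inv_into (points S) f p \<notin> Inoue_cycle m \<alpha>"
    using Aut_cycle[OF f] Aut_inverse[OF f pS(1)] pS(2) by metis+
  ultimately show "f p \<in> points U" "inv_into (points S) f p \<in> points U"
    by (auto simp: points_U)
qed

theorem automorphism_classification:
  assumes f: "f \<in> carrier (Aut S)"
  obtains c A j where "c \<noteq> 0" "A \<noteq> 0" "\<alpha> powi j = c ^ m"
    "\<And>w x. w \<noteq> 0 \<Longrightarrow> f (upt w x) = upt (c * w) (A * w powi j * x)"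
proof -
  define f' where "f' = inv_into (points S) f"
  have hol: "holomorphic_map S S f" "holomorphic_map S S f'" using f by (auto simp: mem_Aut f'_def)
  have inv: "f' (f p) = p" "f (f' p) = p" if "p \<in> points U" for p
    using Aut_inverse[OF f, of p] that by (auto simp: f'_def points_U)
  obtain \<Psi> n where \<Psi>: "V_lift f \<Psi> n"
    using V_lift_exists[OF hol(1)] Aut_U[OF f] Aut_cycle[OF f] by blast
  obtain \<Psi>' n' where \<Psi>': "V_lift f' \<Psi>' n'"
    using V_lift_exists[OF hol(2)] Aut_U[OF f] Aut_cycle[OF f] unfolding f'_def by blast
  have "n' * n = 1" using V_lift_degree_inverse[OF \<Psi> \<Psi>'] inv by blast
  \<comment> \<open>Integers with product 1 are 1 or -1; \<open>V_lift_translation\<close> excludes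
    the latter.\<close>
  then have le: "n \<le> 1" "n' \<le> 1" using zmult_eq_1_iff by fastforce+
  obtain c where c: "c \<noteq> 0" "n = 1" "\<And>w x. w \<noteq> 0 \<Longrightarrow> w_of (\<Psi> (V_pt w x)) = c * w"
    using V_lift_translation[OF \<Psi> le(1)] by metis
  obtain c' where c': "c' \<noteq> 0" "n' = 1" "\<And>w x. w \<noteq> 0 \<Longrightarrow> w_of (\<Psi>' (V_pt w x)) = c' * w"
    using V_lift_translation[OF \<Psi>' le(2)] by metis
  define b where "b w x = x_of (\<Psi> (V_pt w x))" for w x
  define b' where "b' w x = x_of (\<Psi>' (V_pt w x))" for w x
  have \<Psi>b: "\<Psi> (V_pt w x) = V_pt (c * w) (b w x)" if "w \<noteq> 0" for w x
    using V_lift_coordinates[OF \<Psi> that, of x] c(3)[OF that, of x] by (simp add: b_def)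
  have \<Psi>b': "\<Psi>' (V_pt w x) = V_pt (c' * w) (b' w x)" if "w \<noteq> 0" for w x
    using V_lift_coordinates[OF \<Psi>' that, of x] c'(3)[OF that, of x] by (simp add: b'_def)
  have fb: "f (upt w x) = upt (c * w) (b w x)" if "w \<noteq> 0" for w x
    using V_liftD(3)[OF \<Psi> that, of x] \<Psi>b[OF that, of x] by (simp add: upt_pr)
  have fb': "f' (upt w x) = upt (c' * w) (b' w x)" if "w \<noteq> 0" for w x
    using V_liftD(3)[OF \<Psi>' that, of x] \<Psi>b'[OF that, of x] by (simp add: upt_pr)
  have bx: "b w holomorphic_on UNIV" if "w \<noteq> 0" for w
    using V_lift_entire(2)[OF \<Psi> that] unfolding b_def .
  have bx': "b' w holomorphic_on UNIV" if "w \<noteq> 0" for w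
    using V_lift_entire(2)[OF \<Psi>' that] unfolding b'_def .
  have bw: "(\<lambda>w. b w x) holomorphic_on - {0}" for x
    unfolding b_def by (rule V_lift_entire(4)[OF \<Psi>])

  have affine: "\<exists>s t. s \<noteq> 0 \<and> (\<forall>x. b w x = s * x + t)" if w: "w \<noteq> 0" for w
  proof -
    \<comment> \<open>On a fiber b' inverts b up to a deck factor K. It does not depend on x,
      because the deck index is determined by the base coordinates w and c' c w. Injectivity and
      properness of b follow.\<close>
    have "\<exists>K. \<forall>x. x = K * b' (c * w) (b w x)"
    proof -
      have cw: "c * w \<noteq> 0" "c' * (c * w) \<noteq> 0" using c(1) c'(1) w by auto
      have e: "upt (c' * (c * w)) (b' (c * w) (b w x)) = upt w x" for x
        using inv(1)[OF upt_in_U[OF w, of x]] fb[OF w, of x] fb'[OF cw(1), of "b w x"] by simp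
      obtain j where j: "w = \<alpha> powi j * (c' * (c * w))"
        using e[of 0] upt_eq_iff[OF cw(2) w] by blast
      have "x = (\<alpha> powi (int m * triangular j) * (c' * (c * w)) powi (int m * j)) * b' (c * w) (b w x)" for x
      proof -
        obtain i where i: "w = \<alpha> powi i * (c' * (c * w))"
          "x = \<alpha> powi (int m * triangular i) * (c' * (c * w)) powi (int m * i) * b' (c * w) (b w x)"
          using e[of x] upt_eq_iff[OF cw(2) w] by blast
        have "\<alpha> powi i * (c' * (c * w)) = \<alpha> powi j * (c' * (c * w))" using i(1) j by metis
        then have "\<alpha> powi i = \<alpha> powi j" using cw(2) by (metis mult_right_cancel)
        then have "i = j" by (simp only: \<alpha>_powi_inj)
        then show ?thesis using i(2) by simp
      qed
      then show ?thesis by blast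
    qed
    then obtain K where K: "\<And>x. x = K * b' (c * w) (b w x)" by blast
    have "inj (b w)"
      by (rule injI) (metis K)
    moreover have "bounded {x. norm (b w x) \<le> M}" for M
    proof -
      have "c * w \<noteq> 0" using c w by simp
      then obtain N where N: "\<And>y. y \<in> cball 0 M \<Longrightarrow> norm (b' (c * w) y) \<le> N"
        using compact_norm_bound[OF compact_cball entire_continuous_on[OF bx']] by blast
      have "norm x \<le> norm K * N" if "norm (b w x) \<le> M" for x
      proof -
        have "norm (K * b' (c * w) (b w x)) \<le> norm K * N"
          using N[of "b w x"] that by (simp add: norm_mult mult_left_mono)
        then show ?thesis using K[of x] by simp
      qed
      then show ?thesis unfolding bounded_iff by blast
    qed
    ultimately show ?thesis using entire_injective_proper_affine[OF bx[OF w]] by metis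
  qed
  define a where "a w = b w 1 - b w 0" for w
  define d where "d w = b w 0" for w
  have ad: "b w x = a w * x + d w" "a w \<noteq> 0" if "w \<noteq> 0" for w x
    using affine[OF that] by (auto simp: a_def d_def)
  have a_hol: "a holomorphic_on - {0}" unfolding a_def by (intro holomorphic_intros bw)
  have d_hol: "d holomorphic_on - {0}" unfolding d_def by (rule bw)
  \<comment> \<open>Equivariance of \<Psi> in the fiber coordinate; x = 0 gives the equation for the
    constant term, x = 1 the one for the slope.\<close>
  have equi: "b (\<alpha> * w) (w ^ m * x) = c ^ m * w ^ m * b w x" if w: "w \<noteq> 0" for w x
  proof -
    have "\<Psi> (gpow 1 (V_pt w x)) = gpow 1 (\<Psi> (V_pt w x))" using V_liftD(4)[OF \<Psi> w] c(2) by simp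
    then show ?thesis using w c(1) \<Psi>b[of w x] \<Psi>b[of "\<alpha> * w" "w ^ m * x"]
      by (simp add: gpow_V_pt power_mult_distrib)
  qed
  have "d (\<alpha> * w) = c ^ m * w ^ m * d w" if "w \<noteq> 0" for w
    using equi[OF that, of 0] by (simp add: d_def)
  then have d0: "d w = 0" if "w \<noteq> 0" for w
    using automorphic_of_negative_degree_vanishes[OF d_hol \<alpha>_pos \<alpha>_less_1 m_pos _ that, of "c ^ m"] by blast
  have b_eq: "b w x = a w * x" if "w \<noteq> 0" for w x using ad(1)[OF that, of x] d0[OF that] by simp
  have a_aut: "a (\<alpha> * w) = c ^ m * a w" if w: "w \<noteq> 0" for w
  proof -
    have "a (\<alpha> * w) * (w ^ m * 1) = c ^ m * w ^ m * (a w * 1)"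
      using equi[OF w, of 1] b_eq[OF w, of 1] b_eq[of "\<alpha> * w" "w ^ m * 1"] w by simp
    then show ?thesis using w by simp
  qed
  obtain A j where A: "A \<noteq> 0" "c ^ m = \<alpha> powi j" "\<And>w. w \<noteq> 0 \<Longrightarrow> a w = A * w powi j"
    using automorphic_nonvanishing_is_monomial[OF a_hol ad(2) \<alpha>_pos \<alpha>_less_1 a_aut] by blast
  have "f (upt w x) = upt (c * w) (A * w powi j * x)" if "w \<noteq> 0" for w x
    using fb[OF that, of x] b_eq[OF that, of x] A(3)[OF that] by simp
  then show ?thesis using that[OF c(1) A(1) A(2)[symmetric]] by blast
qed

end

section \<open>Automorphisms induced by toric maps\<close>

lemma AutI:
  assumes M: "compatible_atlas M"
    and F: "holomorphic_map M M F" "F \<in> extensional (points M)" and G: "holomorphic_map M M G"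
    and inv: "\<And>p. p \<in> points M \<Longrightarrow> G (F p) = p" "\<And>p. p \<in> points M \<Longrightarrow> F (G p) = p"
  shows "F \<in> carrier (Aut M)"
proof -
  have b: "bij_betw F (points M) (points M)"
    by (rule bij_betw_byWitness[where f' = G])
       (use inv holomorphic_map_points[OF F(1) M M] holomorphic_map_points[OF G M M] in auto)
  have "inv_into (points M) F p = G p" if "p \<in> points M" for p
    using inv_into_f_f[OF bij_betw_imp_inj_on[OF b], of "G p"] inv(2)[OF that]
      holomorphic_map_points[OF G M M that] by simp
  then have "holomorphic_map M M (inv_into (points M) F)"
    by (rule holomorphic_map_cong[OF M M G])
  then show ?thesis using F b by (simp add: Aut_def Bij_def)
qed

lemma holomorphic_map_open_submfd:
  assumes M: "compatible_atlas M" and G: "openin (mfd_topology M) G"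
    and f: "holomorphic_map M M f" and fG: "\<And>p. p \<in> G \<Longrightarrow> f p \<in> G"
  shows "holomorphic_map (open_submfd M G) (open_submfd M G) f"
proof (rule holomorphic_mapI)
  show "compatible_atlas (open_submfd M G)" "compatible_atlas (open_submfd M G)"
    using compatible_atlas_open_submfd[OF M G] by auto
next
  fix D \<phi> v assume a: "(D, \<phi>) \<in> charts (open_submfd M G)" and v: "v \<in> D"
  then obtain D0 where d: "D = {v\<in>D0. \<phi> v \<in> G}" "(D0, \<phi>) \<in> charts M"
    by (auto simp: open_submfd_def)
  have oD: "open D" using d G by (auto simp: openin_mfd_topology)
  have "f (\<phi> v) \<in> points M" using v d fG G by (auto simp: openin_mfd_topology)
  then obtain D' \<psi> v' where d': "(D', \<psi>) \<in> charts M" "v' \<in> D'" "f (\<phi> v) = \<psi> v'"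
    by (rule compatible_atlas_cover[OF M])
  define B where "B = {v \<in> D0. f (\<phi> v) \<in> \<psi> ` D'} \<inter> D"
  define \<tau> where "\<tau> = inv_into D' \<psi> \<circ> f \<circ> \<phi>"
  have B: "open B" "holo_on \<tau> B"
    using holomorphic_mapD[OF f M M d(2) d'(1)] oD
    by (auto simp: B_def \<tau>_def intro: holo_on_subset)
  have \<tau>: "\<tau> u \<in> D'" "f (\<phi> u) = \<psi> (\<tau> u)" "f (\<phi> u) \<in> G" if "u \<in> B" for u
    using that inv_into_into[of "f (\<phi> u)" \<psi> D'] f_inv_into_f[of "f (\<phi> u)" \<psi> D'] d fG
    by (auto simp: B_def \<tau>_def)
  have "({v\<in>D'. \<psi> v \<in> G}, \<psi>) \<in> charts (open_submfd M G)"
    using d' by (auto simp: open_submfd_def)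
  moreover have "v \<in> B" using v d d' by (auto simp: B_def)
  moreover have "\<tau> ` B \<subseteq> {v\<in>D'. \<psi> v \<in> G}" using \<tau> by auto
  moreover have "B \<subseteq> D" by (simp add: B_def)
  ultimately show "\<exists>D' \<psi> B \<tau>. (D', \<psi>) \<in> charts (open_submfd M G) \<and> open B \<and> v \<in> B \<and> B \<subseteq> D \<and>
      holo_on \<tau> B \<and> \<tau> ` B \<subseteq> D' \<and> (\<forall>u\<in>B. f (\<phi> u) = \<psi> (\<tau> u))"
    using B \<tau>(2) by blast
qed

context parabolic_Inoue_data
begin

text \<open>Applying \<gamma> first multiplies x by
  \<open>a * (\<alpha> * w) powi j * w ^ m\<close>, applying it second by
  \<open>(c * w) ^ m * a * w powi j\<close>; these agree exactly under the last condition.\<close>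

definition admissible :: "complex \<Rightarrow> complex \<Rightarrow> int \<Rightarrow> bool" where
  "admissible c a j \<longleftrightarrow> c \<noteq> 0 \<and> a \<noteq> 0 \<and> \<alpha> powi j = c ^ m"

lemma admissible_nonzero: "admissible c a j \<Longrightarrow> c \<noteq> 0" "admissible c a j \<Longrightarrow> a \<noteq> 0"
  by (auto simp: admissible_def)

lemma admissible_inverse:
  assumes "admissible c a j"
  shows "admissible (inverse c) (inverse a * c powi j) (-j)"
  using assms by (simp add: admissible_def power_int_minus power_inverse)

lemma toric_gpow:
  assumes "admissible c a j" "P \<in> points W"
  shows "toric c a j (gpow n P) = gpow n (toric c a j P)"
proof -
  have ca: "c \<noteq> 0" "a \<noteq> 0" "\<alpha> powi j = c ^ m" using assms by (auto simp: admissible_def)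
  have "(\<alpha> powi n) powi j = (\<alpha> powi j) powi n"
    by (simp add: power_int_mult[symmetric] mult.commute)
  also have "\<dots> = c powi (int m * n)" by (simp add: ca(3) power_int_mult)
  finally show ?thesis
    unfolding gpow_def using ca assms(2)
    by (simp add: toric_compose mult.commute add.commute)
qed

text \<open>The choice of a representative is harmless by \<open>toric_gpow\<close>, and the
  restriction to \<open>points S\<close> makes the map extensional, as \<open>Aut\<close>
  demands.\<close>

definition toric_map :: "complex \<Rightarrow> complex \<Rightarrow> int \<Rightarrow> surface_point \<Rightarrow> surface_point" where
  "toric_map c a j = (\<lambda>p\<in>points S. pr (toric c a j (SOME P. P \<in> points W \<and> p = pr P)))"

lemma toric_map_pr:
  assumes "admissible c a j" "P \<in> points W"
  shows "toric_map c a j (pr P) = pr (toric c a j P)"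
proof -
  define Q where "Q = (SOME Q. Q \<in> points W \<and> pr P = pr Q)"
  have Q: "Q \<in> points W \<and> pr P = pr Q"
    unfolding Q_def by (rule someI[of _ P]) (use assms in simp)
  then obtain n where n: "Q = gpow n P" using pr_eq_iff assms(2) by blast
  have "toric_map c a j (pr P) = pr (toric c a j Q)"
    using pr_in_S[OF assms(2)] by (simp only: toric_map_def restrict_apply' Q_def)
  also have "\<dots> = pr (gpow n (toric c a j P))" unfolding n toric_gpow[OF assms] ..
  also have "\<dots> = pr (toric c a j P)"
    by (rule pr_gpow[OF toric_in_W[OF admissible_nonzero[OF assms(1)] assms(2)]])
  finally show ?thesis .
qed

lemma toric_map_upt:
  assumes "admissible c a j" "w \<noteq> 0"
  shows "toric_map c a j (upt w x) = upt (c * w) (a * w powi j * x)"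
  unfolding upt_pr using toric_map_pr[OF assms(1) V_pt_in_W[OF assms(2), of x]]
  by (simp only: toric_V_pt[OF admissible_nonzero[OF assms(1)] assms(2)])

lemma toric_map_inverse:
  assumes "admissible c a j" "p \<in> points S"
  shows "toric_map (inverse c) (inverse a * c powi j) (-j) (toric_map c a j p) = p"
    "toric_map c a j (toric_map (inverse c) (inverse a * c powi j) (-j) p) = p"
proof -
  obtain P where P: "P \<in> points W" "p = pr P" using assms(2) unfolding points_S by blast
  note ca = admissible_nonzero[OF assms(1)] and i = admissible_inverse[OF assms(1)]
  have one: "inverse c * c = 1" "c * inverse c = 1" "inverse a * c powi j * a * c powi (-j) = 1"
      "a * (inverse a * c powi j) * inverse c powi j = 1"
    using ca by (simp_all add: power_int_minus power_int_inverse field_simps)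
  have "toric (inverse c) (inverse a * c powi j) (-j) (toric c a j P) = P"
    using ca P(1) one by (subst toric_compose) auto
  moreover have "toric c a j (toric (inverse c) (inverse a * c powi j) (-j) P) = P"
    using ca P(1) one by (subst toric_compose) auto
  ultimately show "toric_map (inverse c) (inverse a * c powi j) (-j) (toric_map c a j p) = p"
    "toric_map c a j (toric_map (inverse c) (inverse a * c powi j) (-j) p) = p"
    using toric_map_pr[OF assms(1)] toric_map_pr[OF i] toric_in_W[OF ca] toric_in_W[OF admissible_nonzero[OF i]] P
    by (simp_all only:)
qed

lemma holomorphic_toric_map:
  assumes adm: "admissible c a j"
  shows "holomorphic_map S S (toric_map c a j)"
proof (rule holomorphic_mapI[OF compatible_atlas_S compatible_atlas_S])
  note ca = admissible_nonzero[OF adm]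
  fix D \<phi> v assume "(D, \<phi>) \<in> charts S" and v: "v \<in> D"
  then obtain D0 \<phi>0 where d: "\<phi> = (\<lambda>v. pr (\<phi>0 v))" "(D0, \<phi>0) \<in> charts W" "open D" "D \<subseteq> D0"
    by (auto simp: charts_S)
  have vD: "v \<in> D0" using v d by blast
  have "toric c a j (\<phi>0 v) \<in> points W" using toric_in_W[OF ca charts_W_in[OF d(2) vD]] .
  then obtain D' \<psi> v' where d': "(D', \<psi>) \<in> charts W" "v' \<in> D'" "toric c a j (\<phi>0 v) = \<psi> v'"
    by (rule charts_W_cover)
  obtain B' where B': "open B'" "v' \<in> B'" "B' \<subseteq> D'" "inj_on (\<lambda>u. pr (\<psi> u)) B'"
    using locally_injective[OF d'(1,2)] by blast
  obtain B \<tau> where B: "open B" "v \<in> B" "B \<subseteq> D0" "holo_on \<tau> B" "\<tau> v = v'"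
     "\<forall>u\<in>B. toric c a j (\<phi>0 u) = \<psi> (\<tau> u)"
    using toric_local[OF ca d(2) d'(1) vD d'(2,3)] by blast
  define T where "T = {u\<in>B. \<tau> u \<in> B'} \<inter> D"
  have "open T" unfolding T_def using holo_on_vimage_open[OF B(4,1) B'(1)] d(3) by auto
  moreover have "v \<in> T" using B B' v by (simp add: T_def)
  moreover have "T \<subseteq> D" by (simp add: T_def)
  moreover have "holo_on \<tau> T" by (rule holo_on_subset[OF B(4)]) (auto simp: T_def)
  moreover have "\<tau> ` T \<subseteq> B'" by (auto simp: T_def)
  moreover have "\<forall>u\<in>T. toric_map c a j (\<phi> u) = pr (\<psi> (\<tau> u))"
  proof
    fix u assume "u \<in> T"
    then have u: "u \<in> B" "u \<in> D0" using d(4) by (auto simp: T_def)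
    then show "toric_map c a j (\<phi> u) = pr (\<psi> (\<tau> u))"
      using toric_map_pr[OF adm charts_W_in[OF d(2) u(2)]] B(6) by (simp only: d(1))
  qed
  moreover have "(B', \<lambda>u. pr (\<psi> u)) \<in> charts S" using B' d' by (auto simp: charts_S)
  ultimately show "\<exists>D' \<psi> B \<tau>. (D', \<psi>) \<in> charts S \<and> open B \<and> v \<in> B \<and> B \<subseteq> D \<and>
      holo_on \<tau> B \<and> \<tau> ` B \<subseteq> D' \<and> (\<forall>u\<in>B. toric_map c a j (\<phi> u) = \<psi> (\<tau> u))"
    by (intro exI[of _ B'] exI[of _ "\<lambda>u. pr (\<psi> u)"] exI[of _ T] exI[of _ \<tau>] conjI) assumption+
qed

lemma toric_map_Aut:
  assumes "admissible c a j"
  shows "toric_map c a j \<in> carrier (Aut S)"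
  by (rule AutI[OF compatible_atlas_S holomorphic_toric_map[OF assms] _
        holomorphic_toric_map[OF admissible_inverse[OF assms]]])
     (auto simp only: toric_map_inverse[OF assms], simp add: toric_map_def)

section \<open>Bundle automorphisms over translations\<close>

lemma holomorphic_map_U:
  assumes "holomorphic_map S S f" "\<And>p. p \<in> points U \<Longrightarrow> f p \<in> points U"
  shows "holomorphic_map U U f"
  using holomorphic_map_open_submfd[OF compatible_atlas_S openin_points_U assms]
  by (simp add: Inoue_U_def points_U[unfolded Inoue_U_def])

lemma toric_map_in_U: "admissible c a j \<Longrightarrow> p \<in> points U \<Longrightarrow> toric_map c a j p \<in> points U"
  using toric_map_upt admissible_nonzero by (elim points_U_cases) simp

lemma toric_map_Aut_U:
  assumes adm: "admissible c a j"
  shows "restrict (toric_map c a j) (points U) \<in> carrier (Aut U)"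
proof -
  have h: "holomorphic_map U U (restrict (toric_map c a j) (points U))" if "admissible c a j" for c a j
    by (rule holomorphic_map_cong[OF compatible_atlas_U compatible_atlas_U
          holomorphic_map_U[OF holomorphic_toric_map[OF that] toric_map_in_U[OF that]]]) simp_all
  note i = admissible_inverse[OF adm]
  have US: "p \<in> points S" if "p \<in> points U" for p using that by (simp add: points_U)
  show ?thesis
    by (rule AutI[OF compatible_atlas_U h[OF adm] _ h[OF i]])
       (use toric_map_in_U[OF adm] toric_map_in_U[OF i] toric_map_inverse[OF adm] US in simp_all)
qed

section \<open>Toric maps on the elliptic curve and on fibers\<close>

lemma charts_E:
  "(D, \<phi>) \<in> charts E \<longleftrightarrow> \<phi> = (\<lambda>v. ept (v $ 1)) \<and> open D \<and> D \<subseteq> {v. v $ 1 \<noteq> 0} \<and> inj_on (\<lambda>v. ept (v $ 1)) D"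
  by (auto simp: Inoue_E_def quotient_mfd_def Etilde_def ept_pr)

lemma toric_map_ept: "admissible c a j \<Longrightarrow> w \<noteq> 0 \<Longrightarrow> toric_map c a j (ept w) = ept (c * w)"
  unfolding E_point_def by (simp add: toric_map_upt)

lemma ept_mult_cancel:
  assumes "c \<noteq> 0" "w \<noteq> 0" "w' \<noteq> 0" "ept (c * w) = ept (c * w')"
  shows "ept w = ept w'"
proof -
  obtain n where "c * w' = \<alpha> powi n * (c * w)" using assms ept_eq_iff[of "c * w" "c * w'"] by auto
  then have "w' = \<alpha> powi n * w" using assms(1) by simp
  then show ?thesis using ept_eq_iff assms by blast
qed

lemma holomorphic_map_E:
  assumes adm: "admissible c a j"
  shows "holomorphic_map E E (restrict (toric_map c a j) (points E))"
proof (rule holomorphic_mapI[OF compatible_atlas_E compatible_atlas_E])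
  note ca = admissible_nonzero[OF adm]
  fix D \<phi> v assume "(D, \<phi>) \<in> charts E" and v: "v \<in> D"
  then have d: "\<phi> = (\<lambda>v. ept (v $ 1))" "open D" "D \<subseteq> {v. v $ 1 \<noteq> 0}" "inj_on (\<lambda>v. ept (v $ 1)) D"
    unfolding charts_E by blast+
  \<comment> \<open>This is the domain c D. The chart stays injective on it because multiplication
    by c is injective on the quotient.\<close>
  define D' where "D' = {u. inverse c *s u \<in> D}"
  have "open D'"
    using holo_on_vimage_open[OF holo_on_scale open_UNIV d(2)] by (simp add: D'_def)
  moreover have "D' \<subseteq> {v. v $ 1 \<noteq> 0}" using d(3) ca by (auto simp: D'_def)
  moreover have "inj_on (\<lambda>v. ept (v $ 1)) D'"
  proof (rule inj_onI)
    fix u u' :: "complex^1" assume u: "u \<in> D'" "u' \<in> D'" "ept (u $ 1) = ept (u' $ 1)"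
    have "ept (inverse c * u $ 1) = ept (inverse c * u' $ 1)"
      by (rule ept_mult_cancel[OF ca(1)]) (use u d(3) ca in \<open>auto simp: D'_def mult.assoc[symmetric]\<close>)
    then have "inverse c *s u = inverse c *s u'"
      using inj_onD[OF d(4), of "inverse c *s u" "inverse c *s u'"] u by (simp add: D'_def)
    then show "u = u'" using ca by (simp add: vec_eq_iff)
  qed
  ultimately have "(D', \<phi>) \<in> charts E" unfolding charts_E d(1) by blast
  moreover have "(*s) c ` D \<subseteq> D'" using ca by (auto simp: D'_def)
  moreover have "restrict (toric_map c a j) (points E) (\<phi> u) = \<phi> (c *s u)" if "u \<in> D" for u :: "complex^1"
  proof -
    have "u $ 1 \<noteq> 0" using that d(3) by auto
    moreover from this have "ept (u $ 1) \<in> points E" by (auto simp: points_E)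
    ultimately show ?thesis using toric_map_ept[OF adm] by (simp add: d(1))
  qed
  ultimately show "\<exists>D' \<psi> B \<tau>. (D', \<psi>) \<in> charts E \<and> open B \<and> v \<in> B \<and> B \<subseteq> D \<and> holo_on \<tau> B \<and> \<tau> ` B \<subseteq> D' \<and>
      (\<forall>u\<in>B. restrict (toric_map c a j) (points E) (\<phi> u) = \<psi> (\<tau> u))"
    using v d(2) holo_on_scale by (intro exI[of _ D'] exI[of _ \<phi>] exI[of _ D] exI[of _ "(*s) c"]) auto
qed

lemma toric_map_Aut_E:
  assumes adm: "admissible c a j"
  shows "restrict (toric_map c a j) (points E) \<in> carrier (Aut E)"
proof -
  note i = admissible_inverse[OF adm]
  have E: "toric_map c a j p \<in> points E" if "admissible c a j" "p \<in> points E" for c a j p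
    using that toric_map_ept admissible_nonzero(1)[OF that(1)] by (auto simp: points_E)
  have ES: "p \<in> points S" if "p \<in> points E" for p using that by (auto simp: points_E E_point_def)
  show ?thesis
    by (rule AutI[OF compatible_atlas_E holomorphic_map_E[OF adm] _ holomorphic_map_E[OF i]])
       (use E[OF adm] E[OF i] toric_map_inverse[OF adm] ES in simp_all)
qed

lemma bundle_proj_upt: "w \<noteq> 0 \<Longrightarrow> bundle_proj m \<alpha> (upt w x) = ept w"
  unfolding bundle_proj_def
proof (rule the_equality)
  fix e assume w: "w \<noteq> 0" and "\<exists>w' x'. w' \<noteq> 0 \<and> upt w x = upt w' x' \<and> e = ept w'"
  then obtain w' x' where "w' \<noteq> 0" "upt w x = upt w' x'" "e = ept w'" by blast
  moreover from this obtain n where "w' = \<alpha> powi n * w" using upt_eq_iff w by blast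
  ultimately show "e = ept w" using ept_eq_iff[OF w, of w'] by auto
qed blast

lemma linear_complex_iff:
  "Vector_Spaces.linear (*) (*) (T :: complex \<Rightarrow> complex) \<longleftrightarrow> (\<exists>k. T = (\<lambda>x. k * x))"
proof
  assume "Vector_Spaces.linear (*) (*) T"
  then interpret Vector_Spaces.linear "(*)" "(*)" T .
  have "T x = T 1 * x" for x using scale[of x 1] by (simp add: mult.commute)
  then show "\<exists>k. T = (\<lambda>x. k * x)" by blast
next
  assume "\<exists>k. T = (\<lambda>x. k * x)"
  then show "Vector_Spaces.linear (*) (*) T"
    by (auto simp: Vector_Spaces.linear_iff vector_space_def algebra_simps)
qed

lemma toric_map_bundle_automorphism:
  assumes adm: "admissible c a j"
  shows "restrict (toric_map c a j) (points U) \<in> carrier (translation_bundle_Aut m \<alpha>)"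
proof -
  note ca = admissible_nonzero[OF adm]
  let ?F = "restrict (toric_map c a j) (points U)" and ?g = "restrict (toric_map c a j) (points E)"
  have F: "?F (upt w x) = upt (c * w) (a * w powi j * x)" if "w \<noteq> 0" for w x
    using toric_map_upt[OF adm that] that by simp
  have g: "?g (ept w) = ept (c * w)" if "w \<noteq> 0" for w
    using toric_map_ept[OF adm that] that by (auto simp: points_E)
  have proj: "bundle_proj m \<alpha> (?F p) = ?g (bundle_proj m \<alpha> p)" if p: "p \<in> points U" for p
  proof -
    obtain w x where "w \<noteq> 0" "p = upt w x" using points_U_cases[OF p] .
    then show ?thesis using F g ca(1) bundle_proj_upt by simp
  qed
  have lin: "linear_on_fibers m \<alpha> ?g ?F"
    unfolding linear_on_fibers_def
  proof (intro allI impI)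
    fix w w' assume w: "w \<noteq> 0" "w' \<noteq> 0" "?g (ept w) = ept w'"
    have cw: "c * w \<noteq> 0" using ca w by simp
    have "ept (c * w) = ept w'" using w(3) g[OF w(1)] by simp
    then obtain n where n: "w' = \<alpha> powi n * (c * w)" using ept_eq_iff[OF cw w(2)] by blast
    \<comment> \<open>\<open>linear_on_fibers\<close> admits every representative w' of the image
      point, so \<gamma>^n has to carry the fiber coordinate from c w to w'; this contributes a
      factor independent of x.\<close>
    have "?F (upt w x) = upt w' (\<alpha> powi (int m * triangular n) * (c * w) powi (int m * n) * (a * w powi j) * x)" for x
      using F[OF w(1), of x] upt_gpow[OF cw, of n "a * w powi j * x"] by (simp add: n mult.assoc)
    then show "\<exists>T. Vector_Spaces.linear (*) (*) T \<and> (\<forall>x. ?F (upt w x) = upt w' (T x))"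
      unfolding linear_complex_iff by blast
  qed
  have "bundle_automorphism_over m \<alpha> ?g ?F"
    unfolding bundle_automorphism_over_def
    using toric_map_Aut_U[OF adm] toric_map_Aut_E[OF adm] proj lin by blast
  moreover have "E_translation m \<alpha> ?g"
    unfolding E_translation_def using ca(1) g by blast
  ultimately show ?thesis unfolding translation_bundle_Aut_def by auto
qed

text \<open>In charts of the quotient F is holomorphic, but its expression agrees with (c w, a(w))
  only up to a deck transformation that might vary with w; this has to be excluded near each
  point.\<close>

lemma fiber_coefficient_holomorphic:
  assumes F: "holomorphic_map U U F" and c: "c \<noteq> 0"
    and eq: "\<And>w x. w \<noteq> 0 \<Longrightarrow> F (upt w x) = upt (c * w) (a w * x)"
  shows "a holomorphic_on - {0}"
  unfolding holomorphic_on_def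
proof (rule ballI, rule field_differentiable_at_within)
  fix w0 :: complex assume "w0 \<in> - {0}"
  then have w0: "w0 \<noteq> 0" by simp
  let ?v = "vec2 w0 1" and ?v' = "vec2 (c * w0) (a w0)"
  obtain B where B: "open B" "?v \<in> B" "B \<subseteq> {v::complex^2. v $ 1 \<noteq> 0}" "inj_on (\<lambda>u. pr (V_param u)) B"
    using locally_injective[OF V_chart, of ?v] w0 by auto
  obtain B' where B': "open B'" "?v' \<in> B'" "B' \<subseteq> {v::complex^2. v $ 1 \<noteq> 0}" "inj_on (\<lambda>u. pr (V_param u)) B'"
    using locally_injective[OF V_chart, of ?v'] w0 c by auto
  have prV: "pr (V_param u) = upt (u $ 1) (u $ 2)" for u by (simp add: V_param_def upt_pr)
  have chart: "(A, \<lambda>u. pr (V_param u)) \<in> charts U"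
    if A: "open A" "A \<subseteq> {v::complex^2. v $ 1 \<noteq> 0}" "inj_on (\<lambda>u. pr (V_param u)) A" for A
  proof -
    have "(A, \<lambda>u. pr (V_param u)) \<in> charts S" using A V_chart unfolding charts_S by blast
    moreover have "A = {v\<in>A. pr (V_param v) \<in> points U}" using A(2) by (auto simp only: prV intro: upt_in_U)
    ultimately show ?thesis unfolding charts_U by blast
  qed
  note ch = chart[OF B(1,3,4)] chart[OF B'(1,3,4)]
  define T where "T = {v\<in>B. F (pr (V_param v)) \<in> (\<lambda>u. pr (V_param u)) ` B'}"
  define \<tau> where "\<tau> = inv_into B' (\<lambda>u. pr (V_param u)) \<circ> F \<circ> (\<lambda>u. pr (V_param u))"
  have T: "open T" "holo_on \<tau> T"
    unfolding T_def \<tau>_def using holomorphic_mapD[OF F compatible_atlas_U compatible_atlas_U ch] by blast+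
  have \<tau>: "\<tau> u \<in> B'" "pr (V_param (\<tau> u)) = F (pr (V_param u))" if "u \<in> T" for u
  proof -
    have *: "F (pr (V_param u)) \<in> (\<lambda>u. pr (V_param u)) ` B'" using that unfolding T_def by blast
    show "\<tau> u \<in> B'" unfolding \<tau>_def o_def by (rule inv_into_into[OF *])
    show "pr (V_param (\<tau> u)) = F (pr (V_param u))" unfolding \<tau>_def o_def by (rule f_inv_into_f[OF *])
  qed
  have Fv: "F (pr (V_param ?v)) = pr (V_param ?v')" using eq[OF w0, of 1] by (simp add: prV)
  have vT: "?v \<in> T" unfolding T_def using B(2) B'(2) Fv by blast
  have \<tau>v: "\<tau> ?v = ?v'"
    by (rule inj_onD[OF B'(4) _ \<tau>(1)[OF vT] B'(2)]) (simp only: \<tau>(2)[OF vT] Fv)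
  \<comment> \<open>The ratio of the two candidates for the base coordinate. It is |\<alpha>|^n for
    the deck index n, continuous at \<open>w0\<close> and 1 there, so n = 0 nearby.\<close>
  define q where "q w = norm (\<tau> (vec2 w 1) $ 1) / norm (c * w)" for w
  have "holo_at (\<lambda>v. \<tau> v $ 1) ?v" by (rule holo_on_compose_holo_at[OF T(2) vT holo_at_nth])
  then have fd1: "(\<lambda>w. \<tau> (vec2 w 1) $ 1) field_differentiable (at w0)"
    using holo_at_curve[of "\<lambda>v. \<tau> v $ 1" "\<lambda>w. w" w0 "\<lambda>_. 1"] by simp
  have "holo_at (\<lambda>v. \<tau> v $ 2) ?v" by (rule holo_on_compose_holo_at[OF T(2) vT holo_at_nth])
  then have fd2: "(\<lambda>w. \<tau> (vec2 w 1) $ 2) field_differentiable (at w0)"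
    using holo_at_curve[of "\<lambda>v. \<tau> v $ 2" "\<lambda>w. w" w0 "\<lambda>_. 1"] by simp
  have "isCont q w0"
    unfolding q_def
    by (rule isCont_divide[OF isCont_norm[OF field_differentiable_imp_continuous_at[OF fd1]]])
       (use w0 c in \<open>auto intro!: continuous_intros\<close>)
  then have q: "q \<midarrow>w0\<rightarrow> q w0" by (simp add: isCont_def)
  have q0: "q w0 = 1" using w0 c by (simp add: q_def \<tau>v)
  have "eventually (\<lambda>w. norm \<alpha> < q w) (at w0)"
    using order_tendstoD(1)[OF q] \<alpha>_less_1 q0 by simp
  moreover have "eventually (\<lambda>w. q w < inverse (norm \<alpha>)) (at w0)"
    using order_tendstoD(2)[OF q] \<alpha>_pos \<alpha>_less_1 q0 by (simp add: one_less_inverse)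
  moreover have "eventually (\<lambda>w. vec2 w 1 \<in> T) (at w0)"
  proof -
    have "isCont (\<lambda>w. vec2 w 1) w0"
      using continuous_on_vec2[OF continuous_on_id continuous_on_const, of UNIV 1]
      by (simp add: continuous_on_eq_continuous_at)
    then have "((\<lambda>w. vec2 w 1) \<longlongrightarrow> ?v) (at w0)" by (simp add: isCont_def)
    then show ?thesis using topological_tendstoD T(1) vT by blast
  qed
  moreover have "eventually (\<lambda>w. w \<noteq> 0) (at w0)"
    using w0 by (simp add: eventually_neq_at_within eventually_at_topological)
  ultimately have ev: "eventually (\<lambda>w. a w = \<tau> (vec2 w 1) $ 2) (at w0)"
  proof eventually_elim
    case (elim w)
    have nz: "\<tau> (vec2 w 1) $ 1 \<noteq> 0" "c * w \<noteq> 0" using \<tau>(1)[OF elim(3)] B'(3) elim(4) c by auto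
    have "upt (c * w) (a w) = upt (\<tau> (vec2 w 1) $ 1) (\<tau> (vec2 w 1) $ 2)"
      using \<tau>(2)[OF elim(3)] eq[OF elim(4), of 1] by (simp add: prV)
    then obtain n where n: "\<tau> (vec2 w 1) $ 1 = \<alpha> powi n * (c * w)"
      "\<tau> (vec2 w 1) $ 2 = \<alpha> powi (int m * triangular n) * (c * w) powi (int m * n) * a w"
      using upt_eq_iff[OF nz(2,1)] by blast
    have "q w = norm (\<alpha> powi n)" unfolding q_def n(1) norm_mult[of "\<alpha> powi n"] using nz(2) by simp
    then have "n = 0" using \<alpha>_powi_near_1[of n] elim(1,2) by simp
    then show ?case using n(2) by simp
  qed
  have "a w0 = \<tau> ?v $ 2" by (simp add: \<tau>v)
  then show "a field_differentiable at w0"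
    using field_differentiable_transform_within[where f = "\<lambda>w. \<tau> (vec2 w 1) $ 2" and S = UNIV and g = a and x = w0] fd2 ev
    unfolding eventually_at by (metis UNIV_I dist_nz)
qed

text \<open>Injectivity makes the fiber coefficient zero-free, and evaluating F at both
  representatives of the class of (w, 1) makes it automorphic, so the monomial lemma applies as it
  does for automorphisms of S.\<close>

lemma bundle_automorphism_is_toric:
  assumes "F \<in> carrier (translation_bundle_Aut m \<alpha>)"
  obtains c a j where "admissible c a j" "F = restrict (toric_map c a j) (points U)"
proof -
  obtain g where g: "bundle_automorphism_over m \<alpha> g F" "E_translation m \<alpha> g"
    using assms by (auto simp: translation_bundle_Aut_def)
  obtain c where c: "c \<noteq> 0" "\<And>w. w \<noteq> 0 \<Longrightarrow> g (ept w) = ept (c * w)"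
    using g(2) unfolding E_translation_def by blast
  have F: "F \<in> carrier (Aut U)" and lin: "linear_on_fibers m \<alpha> g F"
    using g(1) by (auto simp: bundle_automorphism_over_def)
  have "\<exists>k. \<forall>x. F (upt w x) = upt (c * w) (k * x)" if "w \<noteq> 0" for w
  proof -
    have "c * w \<noteq> 0" using c(1) that by simp
    then have "\<exists>T. Vector_Spaces.linear (*) (*) T \<and> (\<forall>x. F (upt w x) = upt (c * w) (T x))"
      using lin[unfolded linear_on_fibers_def, rule_format, OF that _ c(2)[OF that]] by blast
    then show ?thesis unfolding linear_complex_iff by blast
  qed
  then obtain a where eq: "\<And>w x. w \<noteq> 0 \<Longrightarrow> F (upt w x) = upt (c * w) (a w * x)" by metis
  have hol: "holomorphic_map U U F" and inj: "inj_on F (points U)"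
    using F by (auto simp: mem_Aut Bij_def bij_betw_def)
  have a0: "a w \<noteq> 0" if "w \<noteq> 0" for w
  proof
    assume "a w = 0"
    then have "F (upt w 1) = F (upt w 0)" using eq[OF that] by simp
    then have "upt w 1 = upt w 0" by (rule inj_onD[OF inj]) (use that in simp_all)
    then show False using that by simp
  qed
  have aut: "a (\<alpha> * w) = c ^ m * a w" if w: "w \<noteq> 0" for w
  proof -
    have cw: "c * w \<noteq> 0" "\<alpha> * (c * w) \<noteq> 0" using c w by auto
    have "upt (\<alpha> * (c * w)) (a (\<alpha> * w) * (w ^ m * 1)) = F (upt (\<alpha> * w) (w ^ m * 1))"
      using eq[of "\<alpha> * w" "w ^ m * 1"] w by (simp add: algebra_simps)
    also have "\<dots> = upt (c * w) (a w)" using upt_gamma[OF w, of 1] eq[OF w, of 1] by simp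
    also have "\<dots> = upt (\<alpha> * (c * w)) ((c * w) ^ m * a w)" using upt_gamma[OF cw(1)] by simp
    finally have "a (\<alpha> * w) * (w ^ m * 1) = (c * w) ^ m * a w" using upt_eq_iff_same[OF cw(2)] by blast
    then show ?thesis using w by (simp add: power_mult_distrib)
  qed
  obtain A j where A: "A \<noteq> 0" "c ^ m = \<alpha> powi j" "\<And>w. w \<noteq> 0 \<Longrightarrow> a w = A * w powi j"
    using automorphic_nonvanishing_is_monomial[OF fiber_coefficient_holomorphic[OF hol c(1) eq] a0 \<alpha>_pos \<alpha>_less_1 aut]
    by blast
  have adm: "admissible c A j" using c(1) A(1,2) by (simp add: admissible_def)
  have "F = restrict (toric_map c A j) (points U)"
  proof (rule extensionalityI)
    show "F \<in> extensional (points U)" using F by (simp add: mem_Aut Bij_def)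
    fix p assume p: "p \<in> points U"
    then obtain w x where "w \<noteq> 0" "p = upt w x" by (rule points_U_cases)
    then show "F p = restrict (toric_map c A j) (points U) p"
      using eq A(3) toric_map_upt[OF adm] by simp
  qed simp
  with adm show ?thesis by (rule that)
qed

section \<open>The restriction isomorphism\<close>

lemma restrict_automorphism_is_toric:
  assumes "f \<in> carrier (Aut S)"
  obtains c a j where "admissible c a j" "restrict f (points U) = restrict (toric_map c a j) (points U)"
proof -
  obtain c A j where A: "c \<noteq> 0" "A \<noteq> 0" "\<alpha> powi j = c ^ m"
    "\<And>w x. w \<noteq> 0 \<Longrightarrow> f (upt w x) = upt (c * w) (A * w powi j * x)"
    using automorphism_classification[OF assms] by metis
  have adm: "admissible c A j" using A(1,2,3) by (simp add: admissible_def)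
  have "f p = toric_map c A j p" if p: "p \<in> points U" for p
  proof -
    obtain w x where "w \<noteq> 0" "p = upt w x" using points_U_cases[OF p] .
    then show ?thesis using A(4) toric_map_upt[OF adm] by simp
  qed
  then have "restrict f (points U) = restrict (toric_map c A j) (points U)" by (rule restrict_ext)
  with adm show ?thesis by (rule that)
qed

text \<open>Surjectivity rests on the toric formula: a bundle automorphism is given only over U, but
  its formula also makes sense along the cycle.\<close>

theorem restriction_iso: "(\<lambda>f. restrict f (points U)) \<in> iso (Aut S) (translation_bundle_Aut m \<alpha>)"
proof -
  let ?\<rho> = "\<lambda>f. restrict f (points U)"
  have US: "points U \<subseteq> points S" by (auto simp: points_U)
  have carrier: "?\<rho> f \<in> carrier (translation_bundle_Aut m \<alpha>)" if "f \<in> carrier (Aut S)" for f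
    using restrict_automorphism_is_toric[OF that] toric_map_bundle_automorphism by metis
  have BijS: "f \<in> Bij (points S)" if "f \<in> carrier (Aut S)" for f using that by (simp add: mem_Aut)
  have BijU: "F \<in> Bij (points U)" if "F \<in> carrier (translation_bundle_Aut m \<alpha>)" for F
    using that by (auto simp: translation_bundle_Aut_def bundle_automorphism_over_def mem_Aut)
  have "?\<rho> \<in> hom (Aut S) (translation_bundle_Aut m \<alpha>)"
  proof (rule homI)
    fix f g assume fg: "f \<in> carrier (Aut S)" "g \<in> carrier (Aut S)"
    have 1: "f \<otimes>\<^bsub>Aut S\<^esub> g = compose (points S) f g"
      using BijS[OF fg(1)] BijS[OF fg(2)] by (simp add: Aut_def BijGroup_def)
    have 2: "?\<rho> f \<otimes>\<^bsub>translation_bundle_Aut m \<alpha>\<^esub> ?\<rho> g = compose (points U) (?\<rho> f) (?\<rho> g)"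
      using BijU[OF carrier[OF fg(1)]] BijU[OF carrier[OF fg(2)]]
      by (simp add: translation_bundle_Aut_def BijGroup_def)
    show "?\<rho> (f \<otimes>\<^bsub>Aut S\<^esub> g) = ?\<rho> f \<otimes>\<^bsub>translation_bundle_Aut m \<alpha>\<^esub> ?\<rho> g"
      unfolding 1 2 compose_def using US Aut_U(1)[OF fg(2)]
      by (intro ext) (auto simp: restrict_def)
  qed (rule carrier)
  moreover have "bij_betw ?\<rho> (carrier (Aut S)) (carrier (translation_bundle_Aut m \<alpha>))"
    unfolding bij_betw_def
  proof (intro conjI subset_antisym subsetI)
    show "inj_on ?\<rho> (carrier (Aut S))"
    proof (rule inj_onI)
      fix f f' assume f: "f \<in> carrier (Aut S)" "f' \<in> carrier (Aut S)" "?\<rho> f = ?\<rho> f'"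
      have "f p = f' p" if "p \<in> points U" for p
        using fun_cong[OF f(3), of p] that by simp
      then have "f p = f' p" if "p \<in> points S" for p
        using holomorphic_eq_on_U_imp_eq[of f f' p] f Aut_cycle that by (simp add: mem_Aut)
      then show "f = f'"
        using BijS[OF f(1)] BijS[OF f(2)] by (intro extensionalityI[of _ "points S"]) (auto simp: Bij_def)
    qed
  next
    fix F assume "F \<in> carrier (translation_bundle_Aut m \<alpha>)"
    then obtain c a j where "admissible c a j" "F = ?\<rho> (toric_map c a j)"
      by (rule bundle_automorphism_is_toric)
    then show "F \<in> ?\<rho> ` carrier (Aut S)" using toric_map_Aut by blast
  next
    fix F assume "F \<in> ?\<rho> ` carrier (Aut S)"
    then show "F \<in> carrier (translation_bundle_Aut m \<alpha>)" using carrier by blast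
  qed
  ultimately show ?thesis by (simp add: iso_def)
qed

end

theorem mainTheorem3:
  fixes m :: nat and \<alpha> :: complex
  assumes "m > 0" and "0 < norm \<alpha>" and "norm \<alpha> < 1"
  shows "Aut (parabolic_Inoue m \<alpha>) \<cong> translation_bundle_Aut m \<alpha>"
proof -
  interpret parabolic_Inoue_data m \<alpha> using assms by unfold_locales
  show ?thesis using restriction_iso by (auto simp: is_iso_def)
qed

end
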